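(* Let $L$ be a finite-dimensional (right) Leibniz algebra over a field $F$ of characteristic zero. If $L$ is almost reductive, then $L$ is almost algebraic.
   Context: A (right) Leibniz algebra over $F$ is an $F$-vector space with a bilinear product $[\cdot,\cdot]$ satisfying $[x,[y,z]]=[[x,y],z]-[[x,z],y]$ for all $x,y,z$. The Leibniz kernel of $L$ is $I=\mathrm{span}\{x^2: x\in L\}$ with $x^2=[x,x]$; it is an ideal and $L/I$ is a Lie algebra. With $L^1=L$, $L^{k+1}=[L^k,L]$, $L$ is nilpotent if $L^n=0$ for some $n$; the nilradical $N(L)$ is the largest nilpotent ideal of $L$. Almost reductive: $L$ is almost reductive if $L=N(L)\dot{+}\Sigma$ (vector space direct sum) where $\Sigma$ is a subalgebra of $L$ that is a Lie algebra and $N(L)$ is a completely reducible $\Sigma$-bimodule, i.e. $N(L)$ is a direct sum of subspaces $A$ with $[A,\Sigma]\subseteq A$, $[\Sigma,A]\subseteq A$, each irreducible with respect to these left and right actions. Almost algebraic: a linear Lie algebra $\mathfrak g\leq \mathrm{gl}(V)$ is almost algebraic if it contains the semisimple and nilpotent Jordan components of each of its elements; an abstract Lie algebra $\mathfrak g$ is almost algebraic if $\mathrm{ad}\,\mathfrak g\leq \mathrm{gl}(\mathfrak g)$ is almost algebraic; a Leibniz algebra $L$ is almost algebraic if the Lie algebra $L/I$ is almost algebraic. *)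

theory Defs
  imports Complex_Main "HOL-Library.Set_Algebras" "HOL-Library.FuncSet"
begin

section \<open>Almost algebraic Lie algebras\<close>

text \<open>
  The quotient of a Leibniz algebra by its Leibniz kernel consists of cosets, so it is not a type
  of class \<open>ab_group_add\<close>. Abstract Lie algebras are therefore given with an explicit carrier and
  explicit operations.
\<close>

record ('f, 'a) lie_structure =
  carrier :: "'a set"
  vzero :: 'a
  vadd :: "'a \<Rightarrow> 'a \<Rightarrow> 'a"
  vscale :: "'f \<Rightarrow> 'a \<Rightarrow> 'a"
  lie :: "'a \<Rightarrow> 'a \<Rightarrow> 'a"

definition is_subspace :: "('f, 'a) lie_structure \<Rightarrow> 'a set \<Rightarrow> bool" where
  "is_subspace V W \<longleftrightarrow> W \<subseteq> carrier V \<and> vzero V \<in> W \<and>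
     (\<forall>x\<in>W. \<forall>y\<in>W. vadd V x y \<in> W) \<and> (\<forall>c. \<forall>x\<in>W. vscale V c x \<in> W)"

text \<open>Elements of \<open>gl(V)\<close> are extensional (\<open>undefined\<close> off the carrier), so that equality of
  endomorphisms is equality of functions.\<close>

definition gl :: "('f, 'a) lie_structure \<Rightarrow> ('a \<Rightarrow> 'a) set" where
  "gl V = {f \<in> carrier V \<rightarrow>\<^sub>E carrier V.
     (\<forall>x\<in>carrier V. \<forall>y\<in>carrier V. f (vadd V x y) = vadd V (f x) (f y)) \<and>
     (\<forall>c. \<forall>x\<in>carrier V. f (vscale V c x) = vscale V c (f x))}"

definition nilpotent_endo :: "('f, 'a) lie_structure \<Rightarrow> ('a \<Rightarrow> 'a) \<Rightarrow> bool" where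
  "nilpotent_endo V f \<longleftrightarrow> (\<exists>k. \<forall>x\<in>carrier V. (f ^^ k) x = vzero V)"

text \<open>The ground field need not be algebraically closed: semisimple means that every invariant
  subspace has an invariant complement.\<close>

definition semisimple_endo :: "('f, 'a) lie_structure \<Rightarrow> ('a \<Rightarrow> 'a) \<Rightarrow> bool" where
  "semisimple_endo V f \<longleftrightarrow>
     (\<forall>W. is_subspace V W \<and> f ` W \<subseteq> W \<longrightarrow>
       (\<exists>W'. is_subspace V W' \<and> f ` W' \<subseteq> W' \<and> W \<inter> W' = {vzero V} \<and>
          (\<forall>x\<in>carrier V. \<exists>w\<in>W. \<exists>w'\<in>W'. x = vadd V w w')))"

definition jordan_decomposition ::
  "('f, 'a) lie_structure \<Rightarrow> ('a \<Rightarrow> 'a) \<Rightarrow> ('a \<Rightarrow> 'a) \<Rightarrow> ('a \<Rightarrow> 'a) \<Rightarrow> bool" where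
  "jordan_decomposition V f s n \<longleftrightarrow>
     s \<in> gl V \<and> n \<in> gl V \<and> semisimple_endo V s \<and> nilpotent_endo V n \<and>
     (\<forall>x\<in>carrier V. f x = vadd V (s x) (n x)) \<and>
     (\<forall>x\<in>carrier V. s (n x) = n (s x))"

text \<open>In finite dimension and characteristic zero the pair \<open>(s, n)\<close> exists and is unique.\<close>

definition almost_algebraic_linear ::
  "('f, 'a) lie_structure \<Rightarrow> ('a \<Rightarrow> 'a) set \<Rightarrow> bool" where
  "almost_algebraic_linear V \<gg> \<longleftrightarrow>
     (\<forall>f\<in>\<gg>. \<exists>s n. jordan_decomposition V f s n \<and> s \<in> \<gg> \<and> n \<in> \<gg>)"

definition ad :: "('f, 'a) lie_structure \<Rightarrow> 'a \<Rightarrow> 'a \<Rightarrow> 'a" where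
  "ad \<gg> x = (\<lambda>y\<in>carrier \<gg>. lie \<gg> x y)"

definition almost_algebraic_lie :: "('f, 'a) lie_structure \<Rightarrow> bool" where
  "almost_algebraic_lie \<gg> \<longleftrightarrow> almost_algebraic_linear \<gg> (ad \<gg> ` carrier \<gg>)"


section \<open>Right Leibniz algebras\<close>

locale leibniz_algebra = vector_space scale
  for scale :: "'f::field_char_0 \<Rightarrow> 'v::ab_group_add \<Rightarrow> 'v" +
  fixes bracket :: "'v \<Rightarrow> 'v \<Rightarrow> 'v"
  assumes bracket_add_left: "bracket (x + y) z = bracket x z + bracket y z"
    and bracket_add_right: "bracket x (y + z) = bracket x y + bracket x z"
    and bracket_scale_left: "bracket (scale c x) y = scale c (bracket x y)"
    and bracket_scale_right: "bracket x (scale c y) = scale c (bracket x y)"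
    and leibniz: "bracket x (bracket y z) = bracket (bracket x y) z - bracket (bracket x z) y"
begin

definition ideal :: "'v set \<Rightarrow> bool" where
  "ideal A \<longleftrightarrow> subspace A \<and> (\<forall>a\<in>A. \<forall>x. bracket a x \<in> A \<and> bracket x a \<in> A)"

definition subalgebra :: "'v set \<Rightarrow> bool" where
  "subalgebra S \<longleftrightarrow> subspace S \<and> (\<forall>x\<in>S. \<forall>y\<in>S. bracket x y \<in> S)"

definition lie_subalgebra :: "'v set \<Rightarrow> bool" where
  "lie_subalgebra S \<longleftrightarrow> subalgebra S \<and> (\<forall>x\<in>S. bracket x x = 0) \<and>
     (\<forall>x\<in>S. \<forall>y\<in>S. \<forall>z\<in>S.
        bracket x (bracket y z) + bracket y (bracket z x) + bracket z (bracket x y) = 0)"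

text \<open>The index is shifted: \<open>lower_central A k\<close> is $A^{k+1}$.\<close>

primrec lower_central :: "'v set \<Rightarrow> nat \<Rightarrow> 'v set" where
  "lower_central A 0 = A"
| "lower_central A (Suc k) = span {bracket x y |x y. x \<in> lower_central A k \<and> y \<in> A}"

definition nilpotent :: "'v set \<Rightarrow> bool" where
  "nilpotent A \<longleftrightarrow> (\<exists>k. lower_central A k = {0})"

definition is_nilradical :: "'v set \<Rightarrow> bool" where
  "is_nilradical N \<longleftrightarrow> ideal N \<and> nilpotent N \<and> (\<forall>A. ideal A \<and> nilpotent A \<longrightarrow> A \<subseteq> N)"

definition subbimodule :: "'v set \<Rightarrow> 'v set \<Rightarrow> bool" where
  "subbimodule S A \<longleftrightarrow> subspace A \<and> (\<forall>a\<in>A. \<forall>s\<in>S. bracket a s \<in> A \<and> bracket s a \<in> A)"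

definition irreducible_bimodule :: "'v set \<Rightarrow> 'v set \<Rightarrow> bool" where
  "irreducible_bimodule S A \<longleftrightarrow> subbimodule S A \<and> A \<noteq> {0} \<and>
     (\<forall>B. subbimodule S B \<and> B \<subseteq> A \<longrightarrow> B = {0} \<or> B = A)"

definition direct_sum_of :: "'v set \<Rightarrow> 'v set set \<Rightarrow> bool" where
  "direct_sum_of N \<A> \<longleftrightarrow> finite \<A> \<and> (\<forall>A\<in>\<A>. subspace A) \<and>
     N = {\<Sum>A\<in>\<A>. f A |f. \<forall>A\<in>\<A>. f A \<in> A} \<and>
     (\<forall>f. (\<forall>A\<in>\<A>. f A \<in> A) \<and> (\<Sum>A\<in>\<A>. f A) = 0 \<longrightarrow> (\<forall>A\<in>\<A>. f A = 0))"

definition completely_reducible_bimodule :: "'v set \<Rightarrow> 'v set \<Rightarrow> bool" where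
  "completely_reducible_bimodule S N \<longleftrightarrow>
     (\<exists>\<A>. direct_sum_of N \<A> \<and> (\<forall>A\<in>\<A>. irreducible_bimodule S A))"

definition almost_reductive :: bool where
  "almost_reductive \<longleftrightarrow>
     (\<exists>N S. is_nilradical N \<and> lie_subalgebra S \<and> N + S = UNIV \<and> N \<inter> S = {0} \<and>
        completely_reducible_bimodule S N)"

definition leibniz_kernel :: "'v set" where
  "leibniz_kernel = span {bracket x x |x. True}"

text \<open>The algebra of cosets \<open>x +o I\<close>, with operations induced from representatives. The sum of two
  cosets is their elementwise sum.\<close>

definition quotient_algebra :: "'v set \<Rightarrow> ('f, 'v set) lie_structure" where
  "quotient_algebra I =
     \<lparr>carrier = range (\<lambda>x. x +o I),
      vzero = I,
      vadd = (\<lambda>A B. A + B),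
      vscale = (\<lambda>c A. \<Union>a\<in>A. scale c a +o I),
      lie = (\<lambda>A B. \<Union>a\<in>A. \<Union>b\<in>B. bracket a b +o I)\<rparr>"

definition almost_algebraic :: bool where
  "almost_algebraic \<longleftrightarrow> almost_algebraic_lie (quotient_algebra leibniz_kernel)"


subsection \<open>The quotient operations are computed on representatives\<close>

lemma coset_eq_iff:
  assumes "subspace I"
  shows "x +o I = y +o I \<longleftrightarrow> x - y \<in> I"
proof
  assume "x +o I = y +o I"
  moreover have "x \<in> x +o I"
    using subspace_0[OF assms] by (force simp: elt_set_plus_def)
  ultimately show "x - y \<in> I"
    by (auto simp: elt_set_plus_def)
next
  have sub: "u +o I \<subseteq> v +o I" if "u - v \<in> I" for u v
  proof
    fix w assume "w \<in> u +o I"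
    then obtain i where i: "i \<in> I" "w = u + i"
      by (auto simp: elt_set_plus_def)
    have "w = v + ((u - v) + i)" "(u - v) + i \<in> I"
      using i that subspace_add[OF assms] by auto
    then show "w \<in> v +o I"
      unfolding elt_set_plus_def by blast
  qed
  assume "x - y \<in> I"
  moreover from this have "y - x \<in> I"
    using subspace_neg[OF assms] by fastforce
  ultimately show "x +o I = y +o I"
    using sub by blast
qed

lemma quotient_add:
  assumes "subspace I"
  shows "vadd (quotient_algebra I) (x +o I) (y +o I) = (x + y) +o I"
proof -
  have "I + I = I"
  proof
    show "I + I \<subseteq> I"
      using subspace_add[OF assms] by (auto simp: set_plus_def)
    show "I \<subseteq> I + I"
    proof
      fix i assume "i \<in> I"
      then show "i \<in> I + I"
        using set_plus_intro[of i I 0 I] subspace_0[OF assms] by simp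
    qed
  qed
  then show ?thesis
    by (simp add: quotient_algebra_def set_plus_rearrange)
qed

lemma quotient_scale:
  assumes "subspace I"
  shows "vscale (quotient_algebra I) c (x +o I) = scale c x +o I"
proof -
  have "scale c a +o I = scale c x +o I" if a: "a \<in> x +o I" for a
  proof -
    obtain i where i: "i \<in> I" "a = x + i"
      using a by (auto simp: elt_set_plus_def)
    have "scale c a - scale c x \<in> I"
      using i subspace_scale[OF assms, of i c] by (simp add: scale_right_distrib)
    then show ?thesis
      by (simp add: coset_eq_iff[OF assms])
  qed
  moreover have "x \<in> x +o I"
    using subspace_0[OF assms] by (force simp: elt_set_plus_def)
  ultimately show ?thesis
    unfolding quotient_algebra_def lie_structure.simps by blast
qed

lemma quotient_bracket:
  assumes "ideal I"
  shows "lie (quotient_algebra I) (x +o I) (y +o I) = bracket x y +o I"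
proof -
  have I: "subspace I"
    using assms by (simp add: ideal_def)
  have "bracket a b +o I = bracket x y +o I" if ab: "a \<in> x +o I" "b \<in> y +o I" for a b
  proof -
    obtain i j where ij: "i \<in> I" "j \<in> I" "a = x + i" "b = y + j"
      using ab by (auto simp: elt_set_plus_def)
    have "bracket a b - bracket x y = bracket x j + bracket i b"
      by (simp add: ij bracket_add_left bracket_add_right)
    also have "\<dots> \<in> I"
      using ij(1,2) assms by (auto simp: ideal_def intro!: subspace_add[OF I])
    finally show ?thesis
      by (simp add: coset_eq_iff[OF I])
  qed
  moreover have "x \<in> x +o I" "y \<in> y +o I"
    using subspace_0[OF I] by (force simp: elt_set_plus_def)+
  ultimately show ?thesis
    unfolding quotient_algebra_def lie_structure.simps by blast
qed

lemma ideal_leibniz_kernel: "ideal leibniz_kernel"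
proof -
  let ?I = leibniz_kernel
  have sub: "subspace ?I"
    by (simp add: leibniz_kernel_def)
  have sq: "bracket x x \<in> ?I" for x
    unfolding leibniz_kernel_def by (rule span_base) auto
  have left: "bracket a x \<in> ?I" if "a \<in> ?I" for a x
    using that unfolding leibniz_kernel_def
  proof (induction rule: span_induct)
    case base
    have "subspace {a. bracket a x \<in> ?I}"
      using subspace_add[OF sub] subspace_scale[OF sub] subspace_0[OF sub]
        bracket_scale_left[of 0 0 x]
      by (auto simp: subspace_def bracket_add_left bracket_scale_left)
    then show ?case
      by (simp add: leibniz_kernel_def)
  next
    case (step a)
    then obtain y where y: "a = bracket y y"
      by auto
    let ?z = "bracket y x"
    have "bracket a x = bracket (y + ?z) (y + ?z) - bracket y y - bracket ?z ?z"
      using leibniz[of y y x] by (simp add: y bracket_add_left bracket_add_right)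
    also have "\<dots> \<in> ?I"
      by (intro subspace_diff[OF sub] sq)
    finally show ?case
      by (simp add: leibniz_kernel_def)
  qed
  have right: "bracket x a = 0" if "a \<in> ?I" for a x
    using that unfolding leibniz_kernel_def
  proof (induction rule: span_induct)
    case base
    show ?case
      using bracket_scale_right[of x 0 0]
      by (auto simp: subspace_def bracket_add_right bracket_scale_right)
  next
    case (step a)
    then obtain y where "a = bracket y y"
      by auto
    then show ?case
      using leibniz[of x y y] by simp
  qed
  show ?thesis
    using sub left right subspace_0[OF sub] by (auto simp: ideal_def)
qed

end

end

theory Submission
  imports Defs "HOL-Library.Function_Algebras" "HOL-Algebra.Algebraic_Closure_Type"
begin

text \<open>
  Write \<open>R x\<close> for right multiplication by \<open>x\<close>. Modulo the Leibniz kernel \<open>ad x\<close> is induced by \<open>R (- x)\<close>, so it suffices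
  to split every \<open>R x\<close> as \<open>R y + R z\<close> with \<open>R y\<close> semisimple, \<open>R z\<close> nilpotent and both commuting.

  For \<open>x\<close> in the complement \<open>\<Sigma>\<close>, the trace form of \<open>R\<close> is nondegenerate on \<open>[\<Sigma>, \<Sigma>]\<close>: by Cartan's criterion its radical
  yields an ideal of \<open>\<Sigma>\<close> acting by nilpotent maps, and complete reducibility of the nilradical \<open>N\<close> together with its
  maximality forces such an ideal to vanish. The nilpotent part of \<open>R x\<close> then differs from some \<open>R w\<close>,
  \<open>w \<in> [\<Sigma>, \<Sigma>]\<close>, by an endomorphism that commutes with \<open>R \<Sigma>\<close> and is nilpotent, hence zero by irreducibility.

  For \<open>x = \<sigma> + m\<close> with \<open>m \<in> N\<close>, automorphisms \<open>exp (R c)\<close> with \<open>c\<close> in the lower central series of \<open>N\<close> successively move \<open>m\<close>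
  into the centralizer of the semisimple part of \<open>\<sigma>\<close>, and there the nilpotent part of \<open>\<sigma>\<close> can absorb \<open>m\<close>.
\<close>

section \<open>Polynomials over a field\<close>

text \<open>The ground field need not contain the eigenvalues, yet two facts are about them: that
  \<open>ad\<close> of a semisimple part is a polynomial without constant term in \<open>ad\<close>
  of the endomorphism, and Cartan's criterion. The rest stays over \<open>F\<close>: semisimplicity
  is certified by a separable annihilating polynomial, and the semisimple part comes from Newton
  iteration. Where eigenvalues are unavoidable, vectors are replaced by functions with values in the
  algebraic closure instead of elements of a tensor product, and an \<open>F\<close>-linear
  retraction of the closure onto \<open>F\<close> brings coefficients back. Right multiplications
  are derivations, and those by elements of the Leibniz kernel vanish; left multiplications agree
  with their negatives only modulo that kernel. The trace form is studied on the derived algebra of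
  the complement because on the complement itself it can degenerate: a central element may have
  eigenvalues whose squares sum to zero.\<close>

lemma poly_bezout:
  fixes p q :: "'a::field poly"
  assumes "p \<noteq> 0 \<or> q \<noteq> 0"
  obtains d u v where "d \<noteq> 0" "d = u * p + v * q" "d dvd p" "d dvd q"
proof -
  let ?P = "\<lambda>d. d \<noteq> 0 \<and> (\<exists>u v. d = u * p + v * q)"
  have "p = 1 * p + 0 * q" "q = 0 * p + 1 * q" by simp_all
  then have "p \<noteq> 0 \<Longrightarrow> ?P p" "q \<noteq> 0 \<Longrightarrow> ?P q" by blast+
  then have "\<exists>d. ?P d"
    using assms by blast
  then obtain d where d: "?P d" and least: "\<And>c. ?P c \<Longrightarrow> degree d \<le> degree c"
    using ex_has_least_nat[of ?P _ degree] by blast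
  then obtain u v where uv: "d = u * p + v * q"
    by blast
  \<comment> \<open>Remainders modulo \<open>d\<close> stay in the ideal generated by
    \<open>p\<close> and \<open>q\<close>, so a nonzero one would contradict the minimal degree of
    \<open>d\<close>.\<close>
  have "d dvd a * p + b * q" for a b
  proof -
    let ?x = "a * p + b * q"
    have "?x mod d = (a - ?x div d * u) * p + (b - ?x div d * v) * q"
      by (simp add: minus_div_mult_eq_mod[symmetric] uv algebra_simps)
    then have "?x mod d = 0 \<or> degree d \<le> degree (?x mod d)"
      using least by blast
    then show ?thesis
      using d degree_mod_less[of d ?x] by (auto simp: dvd_eq_mod_eq_0)
  qed
  from this[of 1 0] this[of 0 1] have "d dvd p" "d dvd q"
    by simp_all
  then show ?thesis
    using d uv that by blast
qed

lemma poly_coprime_bezout: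
  fixes p q :: "'a::field poly"
  assumes "p \<noteq> 0 \<or> q \<noteq> 0" and "\<And>d. d dvd p \<Longrightarrow> d dvd q \<Longrightarrow> degree d = 0"
  shows "\<exists>u v. u * p + v * q = 1"
proof -
  obtain d u v where d: "d \<noteq> 0" "d = u * p + v * q" "d dvd p" "d dvd q"
    using poly_bezout[OF assms(1)] by blast
  then obtain c where c: "d = [:c:]" "c \<noteq> 0"
    using assms(2) by (metis degree_eq_zeroE pCons_0_0)
  have "smult (inverse c) u * p + smult (inverse c) v * q = smult (inverse c) d"
    by (simp add: d(2) smult_add_right)
  also have "\<dots> = 1"
    using c by (simp add: one_pCons)
  finally show ?thesis
    by blast
qed

text \<open>Coprimality of \<open>M\<close> and its derivative in Bezout form: this certificate can
  be composed with polynomials, mapped to the closure and applied to an endomorphism.\<close>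

definition separable :: "'a::field poly \<Rightarrow> bool" where
  "separable M \<longleftrightarrow> (\<exists>u v. u * M + v * pderiv M = 1)"

text \<open>Among the nonzero \<open>M\<close> with a power divisible by \<open>m\<close>, one of
  least degree has no repeated factor, since a repeated factor could be removed.\<close>

lemma separable_radical_exists:
  fixes m :: "'a::field_char_0 poly"
  assumes "m \<noteq> 0"
  obtains M e where "M \<noteq> 0" "m dvd M ^ e" "separable M"
proof -
  let ?P = "\<lambda>M. M \<noteq> 0 \<and> (\<exists>e. m dvd M ^ e)"
  have "?P m"
    using assms by (auto intro: exI[of _ 1])
  then obtain M where M: "?P M" and least: "\<And>c. ?P c \<Longrightarrow> degree M \<le> degree c"
    using ex_has_least_nat[of ?P _ degree] by blast
  have "degree d = 0" if "d dvd M" "d dvd pderiv M" for d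
  proof (rule ccontr)
    assume "degree d \<noteq> 0"
    \<comment> \<open>A common divisor of least positive degree substitutes for an irreducible one:
      it is coprime to its own derivative, which is nonzero in characteristic zero.\<close>
    let ?Q = "\<lambda>d. d dvd M \<and> d dvd pderiv M \<and> degree d \<noteq> 0"
    have "?Q d"
      using that \<open>degree d \<noteq> 0\<close> by simp
    then obtain c where c: "?Q c" and cleast: "\<And>b. ?Q b \<Longrightarrow> degree c \<le> degree b"
      using ex_has_least_nat[of ?Q _ degree] by blast
    then obtain q where q: "M = c * q"
      by (elim conjE dvdE)
    have q0: "q \<noteq> 0" "c \<noteq> 0"
      using M q by auto
    have "c dvd c * pderiv q + q * pderiv c"
      using c q by (simp add: pderiv_mult)
    then have div: "c dvd q * pderiv c"
      by (simp add: dvd_add_right_iff)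
    have c': "pderiv c \<noteq> 0" "degree (pderiv c) < degree c"
      using c by (simp_all add: pderiv_eq_0_iff degree_pderiv)
    have "\<exists>u v. u * c + v * pderiv c = 1"
    proof (rule poly_coprime_bezout)
      show "c \<noteq> 0 \<or> pderiv c \<noteq> 0"
        using q0 by simp
      fix b assume b: "b dvd c" "b dvd pderiv c"
      then have "degree b < degree c"
        using dvd_imp_degree_le[of b "pderiv c"] c' by linarith
      moreover have "b dvd M" "b dvd pderiv M"
        using b c dvd_trans by blast+
      ultimately show "degree b = 0"
        using cleast[of b] not_less by blast
    qed
    then obtain u v where "u * c + v * pderiv c = 1"
      by blast
    then have "q = q * (u * c + v * pderiv c)"
      by simp
    also have "\<dots> = c * (u * q) + v * (q * pderiv c)"
      by (simp add: distrib_left mult_ac)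
    finally have "q = c * (u * q) + v * (q * pderiv c)" .
    then have "c dvd q"
      using div by (metis dvd_add dvd_mult dvd_triv_left)
    then have "M dvd q ^ 2"
      by (simp add: q power2_eq_square mult_dvd_mono)
    moreover obtain e where "m dvd M ^ e"
      using M by blast
    ultimately have "m dvd q ^ (2 * e)"
      by (metis dvd_power_same dvd_trans power_mult)
    then have "degree M \<le> degree q"
      using least q0 by blast
    then show False
      using q q0 c by (simp add: degree_mult_eq)
  qed
  then have "separable M"
    unfolding separable_def using M by (intro poly_coprime_bezout) auto
  then show ?thesis
    using M that by blast
qed

text \<open>Taylor expansion to first order. Divisibility by \<open>h ^ 2\<close> is all that
  Newton's method asks of the remainder.\<close>

lemma pcompose_taylor:
  fixes p q h :: "'a::idom poly"
  shows "h ^ 2 dvd p \<circ>\<^sub>p (q + h) - p \<circ>\<^sub>p q - (pderiv p \<circ>\<^sub>p q) * h"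
proof (induction p)
  case 0
  then show ?case by simp
next
  case (pCons a p)
  let ?A = "p \<circ>\<^sub>p (q + h)" and ?B = "p \<circ>\<^sub>p q" and ?D = "pderiv p \<circ>\<^sub>p q"
  have "pCons a p \<circ>\<^sub>p (q + h) - pCons a p \<circ>\<^sub>p q - (pderiv (pCons a p) \<circ>\<^sub>p q) * h
    = (q + h) * (?A - ?B - ?D * h) + h ^ 2 * ?D"
    by (simp add: pcompose_pCons pderiv_pCons pcompose_add algebra_simps power2_eq_square)
  then show ?case
    using pCons.IH by (metis dvd_add dvd_mult dvd_triv_left)
qed

text \<open>Newton iteration in \<open>F[X]/(M\<^sup>e)\<close> lifts the root \<open>X\<close> of \<open>M\<close> modulo \<open>M\<close>.\<close>

lemma newton_lift:
  fixes M :: "'a::field poly"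
  assumes "separable M"
  obtains q where "M dvd q - [:0, 1:]" "M ^ e dvd M \<circ>\<^sub>p q"
proof -
  obtain u v where uv: "u * M + v * pderiv M = 1"
    using assms separable_def by blast
  have "\<exists>q. M dvd q - [:0, 1:] \<and> M ^ e dvd M \<circ>\<^sub>p q" for e
  proof (induction e)
    case 0
    then show ?case by (auto intro: exI[of _ "[:0,1:]"])
  next
    case (Suc e)
    show ?case
    \<comment> \<open>The Newton step presupposes that \<open>M\<close> divides
      \<open>M \<circ>\<^sub>p q\<close>, which exponent 0 does not give; exponent 1 is therefore
      reached directly with \<open>q = X\<close>.\<close>
    proof (cases "e = 0")
      case True
      have "M \<circ>\<^sub>p [:0,1:] = M" by (simp add: pcompose_idR)
      then show ?thesis using True by (auto intro!: exI[of _ "[:0,1:]"])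
    next
      case False
      obtain q where q: "M dvd q - [:0, 1:]" "M ^ e dvd M \<circ>\<^sub>p q"
        using Suc.IH by blast
      define N where "N = M \<circ>\<^sub>p q"
      \<comment> \<open>The Newton correction \<open>- M(q) / M'(q)\<close>: by the Bezout identity
        \<open>v(q)\<close> inverts \<open>M'(q)\<close> modulo \<open>N\<close>.\<close>
      define h where "h = - (N * (v \<circ>\<^sub>p q))"
      have "M dvd N"
        using False q(2) unfolding N_def by (metis dvd_power dvd_trans gr0I)
      then have "M dvd h"
        by (simp add: h_def)
      then have "M dvd (q - [:0, 1:]) + h"
        using q(1) by (rule dvd_add[rotated])
      moreover have "(q - [:0, 1:]) + h = (q + h) - [:0, 1:]"
        by simp
      ultimately have 1: "M dvd (q + h) - [:0, 1:]"
        by metis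
      have "(u \<circ>\<^sub>p q) * N + (v \<circ>\<^sub>p q) * (pderiv M \<circ>\<^sub>p q) = 1"
        using arg_cong[OF uv, of "\<lambda>x. x \<circ>\<^sub>p q"]
        by (simp add: pcompose_add pcompose_mult N_def pcompose_1)
      then have UN: "(u \<circ>\<^sub>p q) * N = 1 - (v \<circ>\<^sub>p q) * (pderiv M \<circ>\<^sub>p q)"
        by (simp add: eq_diff_eq)
      have "N + (pderiv M \<circ>\<^sub>p q) * h = N * ((u \<circ>\<^sub>p q) * N)"
        unfolding h_def UN by (simp add: right_diff_distrib mult_ac)
      then have "N ^ 2 dvd N + (pderiv M \<circ>\<^sub>p q) * h"
        by (simp add: power2_eq_square mult_dvd_mono)
      moreover have "N ^ 2 dvd M \<circ>\<^sub>p (q + h) - N - (pderiv M \<circ>\<^sub>p q) * h"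
        using pcompose_taylor[of h M q] unfolding N_def
        by (rule dvd_trans[rotated]) (simp add: h_def N_def power_mult_distrib)
      ultimately have "N ^ 2 dvd (M \<circ>\<^sub>p (q + h) - N - (pderiv M \<circ>\<^sub>p q) * h) + (N + (pderiv M \<circ>\<^sub>p q) * h)"
        using dvd_add by blast
      then have "N ^ 2 dvd M \<circ>\<^sub>p (q + h)"
        by (simp add: algebra_simps)
      moreover have "M ^ Suc e dvd N ^ 2"
      proof -
        have "M ^ e * M dvd N * N"
          using q(2) \<open>M dvd N\<close> unfolding N_def by (rule mult_dvd_mono)
        then show ?thesis by (simp add: power2_eq_square mult.commute)
      qed
      ultimately have "M ^ Suc e dvd M \<circ>\<^sub>p (q + h)"
        using dvd_trans by blast
      then show ?thesis using 1 by blast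
    qed
  qed
  then show ?thesis using that by blast
qed

text \<open>Up to the nonzero factor \<open>poly G a\<close>, \<open>G\<close> is
  \<open>1 - N\<close> with \<open>N\<close> divisible by \<open>X - a\<close>; the truncated
  geometric series inverts it.\<close>

lemma inverse_mod_linear_power:
  fixes G :: "'a::field poly"
  assumes "poly G a \<noteq> 0"
  obtains h where "[:-a, 1:] ^ e dvd G * h - 1"
proof -
  define N where "N = 1 - smult (inverse (poly G a)) G"
  have "[:-a, 1:] dvd N"
    using assms by (simp add: N_def poly_eq_0_iff_dvd[symmetric])
  then have d: "[:-a, 1:] ^ e dvd N ^ e"
    by (rule dvd_power_same)
  define h where "h = smult (inverse (poly G a)) (\<Sum>i<e. N ^ i)"
  have "G * h = (1 - N) * (\<Sum>i<e. N ^ i)"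
    by (simp add: h_def N_def)
  also have "\<dots> = 1 - N ^ e"
    by (simp add: one_diff_power_eq)
  finally have "G * h - 1 = - (N ^ e)" by simp
  then show ?thesis using d that by (metis dvd_minus_iff)
qed

lemma linear_powers_dvd:
  fixes P :: "'a::field poly"
  assumes "finite \<Lambda>" "\<And>a. a \<in> \<Lambda> \<Longrightarrow> [:-a, 1:] ^ e dvd P"
  shows "(\<Prod>a\<in>\<Lambda>. [:-a, 1:] ^ e) dvd P"
  using assms
proof (induction \<Lambda> rule: finite_induct)
  case (insert a \<Lambda>)
  let ?G = "\<Prod>a\<in>\<Lambda>. [:-a, 1:] ^ e"
  obtain w where w: "P = ?G * w"
    using insert by (metis dvdE insertCI)
  have "poly ?G a \<noteq> 0"
    using insert.hyps by (auto simp: poly_prod)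
  then obtain h where h: "[:-a, 1:] ^ e dvd ?G * h - 1"
    using inverse_mod_linear_power by blast
  \<comment> \<open>\<open>h\<close> inverts \<open>?G\<close> modulo the new prime power, so the
    cofactor \<open>w\<close> is congruent to \<open>P * h\<close>, that is, to 0.\<close>
  have "w = P * h - w * (?G * h - 1)"
    by (simp add: w algebra_simps)
  then have "[:-a, 1:] ^ e dvd w"
    using h insert.prems by (metis dvd_diff dvd_mult dvd_mult2 insertI1)
  then have "[:-a, 1:] ^ e * ?G dvd w * ?G"
    by (simp add: mult_dvd_mono)
  then show ?case
    using insert.hyps w by (simp add: mult.commute)
qed simp

text \<open>Chinese remainder theorem with constant residues: the correction of \<open>p\<close> is
  a multiple of \<open>?G\<close> and leaves the earlier residues alone.\<close>

lemma poly_interpolate_mod: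
  fixes c :: "'a::field \<Rightarrow> 'a"
  assumes "finite \<Lambda>"
  shows "\<exists>p. \<forall>a\<in>\<Lambda>. [:-a, 1:] ^ e dvd p - [:c a:]"
  using assms
proof (induction \<Lambda> rule: finite_induct)
    case (insert a \<Lambda>)
    then obtain p where p: "\<And>b. b \<in> \<Lambda> \<Longrightarrow> [:-b, 1:] ^ e dvd p - [:c b:]"
      by blast
    let ?G = "\<Prod>a\<in>\<Lambda>. [:-a, 1:] ^ e"
    have "poly ?G a \<noteq> 0"
      using insert.hyps by (auto simp: poly_prod)
    then obtain h where h: "[:-a, 1:] ^ e dvd ?G * h - 1"
      using inverse_mod_linear_power by blast
    let ?p = "p - ?G * h * (p - [:c a:])"
    have "?p - [:c a:] = - ((?G * h - 1) * (p - [:c a:]))"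
      by (simp add: algebra_simps)
    then have "[:-a, 1:] ^ e dvd ?p - [:c a:]"
      using h by (metis dvd_minus_iff dvd_mult2)
    moreover have "[:-b, 1:] ^ e dvd ?p - [:c b:]" if "b \<in> \<Lambda>" for b
    proof -
      have "[:-b, 1:] ^ e dvd ?G"
        using that insert.hyps by (intro dvd_prodI)
      then have "[:-b, 1:] ^ e dvd (p - [:c b:]) - ?G * h * (p - [:c a:])"
        using p[OF that] by (simp add: dvd_diff dvd_mult2)
      then show ?thesis by (simp add: algebra_simps)
    qed
    ultimately show ?case by (intro exI[of _ ?p]) blast
qed simp

section \<open>Polynomials in an endomorphism\<close>

text \<open>Definitions made in \<open>vector_space\<close> itself would be shadowed by their images under the interpretation
  for real vector spaces.\<close>

locale operator_space = vector_space scale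
  for scale :: "'a::field \<Rightarrow> 'b::ab_group_add \<Rightarrow> 'b"
begin

definition endo :: "('b \<Rightarrow> 'b) \<Rightarrow> bool" where
  "endo f \<longleftrightarrow> (\<forall>x y. f (x + y) = f x + f y) \<and> (\<forall>c x. f (scale c x) = scale c (f x))"

lemma endo_iff_linear: "endo f \<longleftrightarrow> Vector_Spaces.linear scale scale f"
  by (auto simp: endo_def Vector_Spaces.linear_iff vector_space_axioms)

lemma endo_add: "endo f \<Longrightarrow> f (x + y) = f x + f y"
  and endo_scale: "endo f \<Longrightarrow> f (scale c x) = scale c (f x)"
  by (simp_all add: endo_def)

lemma endo_0: "endo f \<Longrightarrow> f 0 = 0"
  using endo_scale[of f 0 0] by simp

lemma endo_neg: "endo f \<Longrightarrow> f (- x) = - f x"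
  using endo_scale[of f "-1" x] by simp

lemma endo_diff: "endo f \<Longrightarrow> f (x - y) = f x - f y"
  using endo_add[of f x "-y"] endo_neg[of f y] by simp

lemma endo_sum: "endo f \<Longrightarrow> f (sum g A) = (\<Sum>a\<in>A. f (g a))"
  by (induction A rule: infinite_finite_induct) (simp_all add: endo_0 endo_add)

lemma endo_compose: "endo f \<Longrightarrow> endo g \<Longrightarrow> endo (\<lambda>v. f (g v))"
  by (simp add: endo_def)

lemma endo_diff_fun: "endo f \<Longrightarrow> endo g \<Longrightarrow> endo (\<lambda>v. f v - g v)"
  by (simp add: endo_def scale_right_diff_distrib)

lemma endo_funpow: "endo f \<Longrightarrow> endo (f ^^ k)"
  by (induction k) (simp_all add: endo_def)

lemma endo_kernel_subspace: "endo f \<Longrightarrow> subspace {v. f v = 0}"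
  by (auto simp: subspace_def endo_0 endo_add endo_scale)

lemma endo_image_subspace: "endo f \<Longrightarrow> subspace U \<Longrightarrow> subspace (f ` U)"
  unfolding subspace_def by safe (metis endo_0 endo_add endo_scale image_iff)+

section \<open>Polynomial calculus of an endomorphism\<close>

definition poly_op :: "'a poly \<Rightarrow> ('b \<Rightarrow> 'b) \<Rightarrow> 'b \<Rightarrow> 'b" where
  "poly_op p f v = (\<Sum>i\<le>Polynomial.degree p. scale (poly.coeff p i) ((f ^^ i) v))"

lemma poly_op_altdef:
  assumes "Polynomial.degree p \<le> n"
  shows "poly_op p f v = (\<Sum>i\<le>n. scale (poly.coeff p i) ((f ^^ i) v))"
  unfolding poly_op_def by (rule sum.mono_neutral_left) (use assms in \<open>auto simp: coeff_eq_0\<close>)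

lemma poly_op_0 [simp]: "poly_op 0 f v = 0"
  by (simp add: poly_op_def)

text \<open>Applying \<open>f\<close> to the argument first makes this recursion hold for every
  function \<open>f\<close>, linear or not.\<close>

lemma poly_op_pCons [simp]: "poly_op (pCons a p) f v = scale a v + poly_op p f (f v)"
proof -
  have "poly_op (pCons a p) f v =
      (\<Sum>i\<le>Suc (Polynomial.degree p). scale (poly.coeff (pCons a p) i) ((f ^^ i) v))"
    by (rule poly_op_altdef) (rule degree_pCons_le)
  also have "\<dots> = scale a v + poly_op p f (f v)"
    by (simp add: sum.atMost_Suc_shift poly_op_def funpow_Suc_right del: funpow.simps sum.atMost_Suc)
  finally show ?thesis .
qed

lemma poly_op_1 [simp]: "poly_op 1 f v = v"
  by (simp add: one_pCons)

lemma poly_op_add: "poly_op (p + q) f v = poly_op p f v + poly_op q f v"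
proof -
  let ?n = "max (Polynomial.degree p) (Polynomial.degree q)"
  have "Polynomial.degree (p + q) \<le> ?n"
    by (rule degree_add_le_max)
  then show ?thesis
    by (simp add: poly_op_altdef[of _ ?n] scale_left_distrib sum.distrib)
qed

lemma poly_op_smult: "poly_op (smult c p) f v = scale c (poly_op p f v)"
  by (simp add: poly_op_altdef[OF degree_smult_le] poly_op_def scale_sum_right)

lemma poly_op_diff: "poly_op (p - q) f v = poly_op p f v - poly_op q f v"
  using poly_op_add[of "p - q" q f v] by (simp add: eq_diff_eq)

lemma endo_poly_op: "endo f \<Longrightarrow> endo (poly_op p f)"
  unfolding endo_def[of "poly_op p f"] poly_op_def
  by (simp add: endo_add[OF endo_funpow] endo_scale[OF endo_funpow] scale_right_distrib
      sum.distrib scale_sum_right mult.commute)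

lemma funpow_intertwine:
  assumes "\<And>v. g (f v) = f' (g v)"
  shows "g ((f ^^ k) v) = (f' ^^ k) (g v)"
  using assms by (induction k) simp_all

lemma poly_op_intertwine:
  assumes "\<And>v w. g (v + w) = g v + g w" "\<And>c v. g (scale c v) = scale c (g v)"
    and "\<And>v. g (f v) = f' (g v)"
  shows "g (poly_op p f v) = poly_op p f' (g v)"
proof -
  have "endo g" using assms by (simp add: endo_def)
  then show ?thesis
    by (simp add: poly_op_def endo_sum endo_scale funpow_intertwine[of g f f', OF assms(3)])
qed

lemma poly_op_commute:
  "endo g \<Longrightarrow> (\<And>v. g (f v) = f (g v)) \<Longrightarrow> g (poly_op p f v) = poly_op p f (g v)"
  by (rule poly_op_intertwine) (simp_all add: endo_def)

lemma poly_op_mult: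
  assumes "endo f"
  shows "poly_op (p * q) f v = poly_op p f (poly_op q f v)"
proof (induction p arbitrary: v)
  case (pCons a p)
  have "f (poly_op q f v) = poly_op q f (f v)"
    by (rule poly_op_commute) (simp_all add: assms)
  with pCons.IH show ?case
    by (simp add: poly_op_add poly_op_smult)
qed simp

lemma poly_op_poly_commute:
  assumes "endo f"
  shows "poly_op p f (poly_op q f v) = poly_op q f (poly_op p f v)"
  by (metis poly_op_mult[OF assms] mult.commute)

lemma poly_op_power:
  assumes "endo f"
  shows "poly_op (p ^ k) f v = ((poly_op p f) ^^ k) v"
  by (induction k) (simp_all add: poly_op_mult assms)

lemma poly_op_pcompose:
  assumes "endo f"
  shows "poly_op (p \<circ>\<^sub>p q) f v = poly_op p (poly_op q f) v"
proof (induction p arbitrary: v)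
  case (pCons a p)
  have "poly_op q f (poly_op (p \<circ>\<^sub>p q) f v) = poly_op (p \<circ>\<^sub>p q) f (poly_op q f v)"
    by (rule poly_op_poly_commute[OF assms])
  with pCons.IH show ?case
    by (simp add: pcompose_pCons poly_op_add poly_op_mult assms)
qed simp

lemma poly_op_dvd:
  assumes "endo f" "p dvd q" "poly_op p f v = 0"
  shows "poly_op q f v = 0"
proof -
  obtain r where "q = r * p"
    using assms(2) by (metis dvdE mult.commute)
  then show ?thesis
    using assms by (simp add: poly_op_mult endo_0[OF endo_poly_op])
qed

lemma funpow_invariant: "f ` U \<subseteq> U \<Longrightarrow> v \<in> U \<Longrightarrow> (f ^^ k) v \<in> U"
  by (induction k) auto

lemma poly_op_invariant:
  assumes "subspace U" "f ` U \<subseteq> U" "v \<in> U"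
  shows "poly_op p f v \<in> U"
  unfolding poly_op_def
  by (intro subspace_sum subspace_scale assms funpow_invariant) 

text \<open>Averaging: with \<open>u M + v M' = 1\<close>, the endomorphism
  \<open>v(f) (\<Sum>\<^sub>k M\<^sub>k \<Sum>\<^sub>i f\<^sup>i \<pi> f\<^sup>k\<^sup>-\<^sup>1\<^sup>-\<^sup>i)\<close> built from any projection \<open>\<pi>\<close> onto \<open>W\<close> is again such a projection,
  and it commutes with \<open>f\<close>.\<close>

lemma separable_invariant_complement:
  assumes f: "endo f" and M: "separable M" "\<And>v. poly_op M f v = 0"
    and W: "subspace W" "f ` W \<subseteq> W"
  obtains W' where "subspace W'" "f ` W' \<subseteq> W'" "W \<inter> W' = {0}"
    "\<And>x. \<exists>w\<in>W. \<exists>w'\<in>W'. x = w + w'"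
proof -
  interpret vector_space_pair scale scale ..
  obtain \<pi> where "Vector_Spaces.linear scale scale \<pi>" and
    \<pi>W: "\<And>v. \<pi> v \<in> W" and \<pi>id: "\<And>v. v \<in> W \<Longrightarrow> \<pi> v = v"
    using linear_exists_left_inverse_on[of id W] W(1) linear_id by auto
  then have \<pi>: "endo \<pi>" by (simp add: endo_iff_linear)
  obtain u v where uv: "u * M + v * pderiv M = 1"
    using M(1) separable_def by blast
  let ?n = "Polynomial.degree M"
  define A where "A x = (\<Sum>k\<le>?n. scale (poly.coeff M k) (\<Sum>i<k. (f ^^ i) (\<pi> ((f ^^ (k - Suc i)) x))))"
    for x
  define P where "P x = poly_op v f (A x)" for x
  have A: "endo A"
    unfolding endo_def A_def
    by (simp add: endo_add[OF \<pi>] endo_scale[OF \<pi>] endo_add[OF endo_funpow[OF f]]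
        endo_scale[OF endo_funpow[OF f]] scale_right_distrib sum.distrib scale_sum_right mult.commute)
  have fA: "f (A x) = A (f x)" for x
  proof -
    \<comment> \<open>Both sums run over the terms \<open>f^i \<pi> f^(k-i) x\<close>, with indices
      shifted by one, so the difference telescopes. Summing against the coefficients of
      \<open>M\<close> leaves the commutator of \<open>M(f) = 0\<close> with
      \<open>\<pi>\<close>.\<close>
    have tele: "f (\<Sum>i<k. (f ^^ i) (\<pi> ((f ^^ (k - Suc i)) x))) - (\<Sum>i<k. (f ^^ i) (\<pi> ((f ^^ (k - Suc i)) (f x))))
       = (f ^^ k) (\<pi> x) - \<pi> ((f ^^ k) x)" for k
    proof -
      define g where "g i = (f ^^ i) (\<pi> ((f ^^ (k - i)) x))" for i
      have "(\<Sum>i<k. (f ^^ i) (\<pi> ((f ^^ (k - Suc i)) (f x)))) = (\<Sum>i<k. g i)"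
      proof (rule sum.cong)
        fix i assume "i \<in> {..<k}"
        then have "k - i = Suc (k - Suc i)" by auto
        then have "(f ^^ (k - i)) x = (f ^^ (k - Suc i)) (f x)"
          by (simp add: funpow_Suc_right del: funpow.simps)
        then show "(f ^^ i) (\<pi> ((f ^^ (k - Suc i)) (f x))) = g i"
          by (simp add: g_def)
      qed simp
      moreover have "f (\<Sum>i<k. (f ^^ i) (\<pi> ((f ^^ (k - Suc i)) x))) = (\<Sum>i<k. g (Suc i))"
        by (simp add: endo_sum[OF f] g_def)
      ultimately show ?thesis
        by (simp add: sum_subtractf[symmetric] sum_lessThan_telescope) (simp add: g_def)
    qed
    have "f (A x) - A (f x) = (\<Sum>k\<le>?n. scale (poly.coeff M k) ((f ^^ k) (\<pi> x) - \<pi> ((f ^^ k) x)))"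
      unfolding A_def endo_sum[OF f, of _ "{..?n}"] endo_scale[OF f] sum_subtractf[symmetric, of _ "{..?n}"]
        scale_right_diff_distrib[symmetric] tele ..
    also have "\<dots> = poly_op M f (\<pi> x) - \<pi> (poly_op M f x)"
      by (simp add: poly_op_def endo_sum[OF \<pi>] endo_scale[OF \<pi>] scale_right_diff_distrib sum_subtractf)
    also have "\<dots> = 0"
      by (simp add: M(2) endo_0[OF \<pi>])
    finally show ?thesis by simp
  qed
  have AW: "A x \<in> W" for x
    unfolding A_def
    by (intro subspace_sum subspace_scale W funpow_invariant \<pi>W)
  \<comment> \<open>On \<open>W\<close> the projection is the identity, the inner sum is
    \<open>k f^(k-1)\<close>, and \<open>A\<close> becomes the formal derivative
    \<open>M'(f)\<close>, which \<open>v(f)\<close> inverts.\<close>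
  have A_on: "A x = poly_op (pderiv M) f x" if "x \<in> W" for x
  proof -
    have "(\<Sum>i<k. (f ^^ i) (\<pi> ((f ^^ (k - Suc i)) x))) = scale (of_nat k) ((f ^^ (k - 1)) x)" for k
    proof -
      have "(\<Sum>i<k. (f ^^ i) (\<pi> ((f ^^ (k - Suc i)) x))) = (\<Sum>i<k. (f ^^ (k - 1)) x)"
      proof (rule sum.cong)
        fix i assume "i \<in> {..<k}"
        then have "i + (k - Suc i) = k - 1" by auto
        then show "(f ^^ i) (\<pi> ((f ^^ (k - Suc i)) x)) = (f ^^ (k - 1)) x"
          using \<pi>id[OF funpow_invariant[OF W(2) that]] by (metis funpow_add comp_apply)
      qed simp
      then show ?thesis by (simp add: sum_constant_scale)
    qed
    then have "A x = (\<Sum>k\<le>Suc ?n. scale (poly.coeff M k) (scale (of_nat k) ((f ^^ (k - 1)) x)))"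
      by (simp add: A_def coeff_eq_0)
    also have "\<dots> = (\<Sum>k\<le>?n. scale (poly.coeff (pderiv M) k) ((f ^^ k) x))"
      by (simp add: sum.atMost_Suc_shift coeff_pderiv mult.commute del: sum.atMost_Suc)
    also have "\<dots> = poly_op (pderiv M) f x"
      by (rule poly_op_altdef[symmetric]) (simp add: degree_le coeff_pderiv coeff_eq_0)
    finally show ?thesis .
  qed
  have P: "endo P"
    unfolding P_def by (rule endo_compose[OF endo_poly_op[OF f] A])
  have PW: "P x \<in> W" for x
    unfolding P_def by (rule poly_op_invariant[OF W AW])
  have Pid: "P x = x" if "x \<in> W" for x
  proof -
    have "P x = poly_op (v * pderiv M) f x"
      by (simp add: P_def A_on[OF that] poly_op_mult[OF f])
    also have "\<dots> = poly_op (u * M + v * pderiv M) f x"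
      by (simp add: poly_op_add poly_op_mult[OF f] M(2) endo_0[OF endo_poly_op[OF f]])
    finally show ?thesis by (simp add: uv)
  qed
  have fP: "f (P x) = P (f x)" for x
    unfolding P_def fA[symmetric] by (rule poly_op_commute[OF f]) simp
  show ?thesis
  proof
    show "subspace {x. P x = 0}"
      by (rule endo_kernel_subspace[OF P])
    show "f ` {x. P x = 0} \<subseteq> {x. P x = 0}"
      by (auto simp: fP[symmetric] endo_0[OF f])
    show "W \<inter> {x. P x = 0} = {0}"
      using Pid subspace_0[OF W(1)] endo_0[OF P] by auto
    show "\<exists>w\<in>W. \<exists>w'\<in>{x. P x = 0}. x = w + w'" for x
      by (intro bexI[of _ "P x"] bexI[of _ "x - P x"]) (simp_all add: PW endo_diff[OF P] Pid)
  qed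
qed

section \<open>Traces\<close>

definition fin_dim :: "'b set \<Rightarrow> bool" where
  "fin_dim U \<longleftrightarrow> (\<exists>B. finite B \<and> independent B \<and> span B = U)"

lemma fin_dim_subspace: "fin_dim U \<Longrightarrow> subspace U"
  unfolding fin_dim_def by auto

lemma fin_dim_extend:
  assumes "fin_dim W" "subspace U" "U \<subseteq> W"
  obtains B C where "finite C" "independent C" "span C = W" "B \<subseteq> C" "finite B" "independent B" "span B = U"
proof -
  obtain D where D: "finite D" "independent D" "span D = W"
    using assms(1) fin_dim_def by blast
  obtain B where B: "B \<subseteq> U" "independent B" "U \<subseteq> span B"
    using maximal_independent_subset by blast
  obtain C where C: "B \<subseteq> C" "C \<subseteq> W" "independent C" "W \<subseteq> span C"
    using maximal_independent_subset_extend[of B W] B assms(3) by blast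
  have "finite C"
    using independent_span_bound[OF D(1) C(3)] C(2) D(3) by blast
  moreover have "span C = W"
    using C assms(1) by (intro span_subspace fin_dim_subspace)
  moreover have "span B = U"
    using B assms(2) by (intro span_subspace)
  moreover have "finite B"
    using \<open>finite C\<close> C(1) finite_subset by blast
  ultimately show ?thesis
    using B(2) C(1,3) by (intro that[of C B])
qed

lemma fin_dim_subset: "fin_dim W \<Longrightarrow> subspace U \<Longrightarrow> U \<subseteq> W \<Longrightarrow> fin_dim U"
  by (rule fin_dim_extend) (auto simp: fin_dim_def)

definition trace_basis :: "'b set \<Rightarrow> ('b \<Rightarrow> 'b) \<Rightarrow> 'a" where
  "trace_basis B f = (\<Sum>b\<in>B. representation B (f b) b)"

text \<open>The trace is only meaningful on a finite-dimensional \<open>U\<close> with \<open>f ` U \<subseteq> U\<close>.\<close>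

definition trace_on :: "'b set \<Rightarrow> ('b \<Rightarrow> 'b) \<Rightarrow> 'a" where
  "trace_on U f = trace_basis (SOME B. finite B \<and> independent B \<and> span B = U) f"

text \<open>Expanding over \<open>C\<close> and then over \<open>B\<close> turns both traces into
  the same double sum of coordinate products.\<close>

lemma trace_basis_eq:
  assumes B: "finite B" "independent B" and C: "finite C" "independent C" "span C = span B"
    and f: "endo f" "f ` span B \<subseteq> span B"
  shows "trace_basis B f = trace_basis C f"
proof -
  let ?R = representation
  have inB: "f c \<in> span B" if "c \<in> C" for c
    using that f(2) span_base C(3) by blast
  have 1: "?R B (f b) b = (\<Sum>c\<in>C. ?R C b c * ?R B (f c) b)" if "b \<in> B" for b
  proof -
    have "f b = f (\<Sum>c\<in>C. scale (?R C b c) c)"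
      using sum_representation_eq[of C b C] that C span_base by auto
    then have "f b = (\<Sum>c\<in>C. scale (?R C b c) (f c))"
      by (simp add: endo_sum[OF f(1)] endo_scale[OF f(1)])
    then have "?R B (f b) b = ?R B (\<Sum>c\<in>C. scale (?R C b c) (f c)) b"
      by simp
    also have "\<dots> = (\<Sum>c\<in>C. ?R C b c * ?R B (f c) b)"
      using B inB by (simp add: representation_sum representation_scale span_scale)
    finally show ?thesis .
  qed
  have 2: "(\<Sum>b\<in>B. ?R C b c * ?R B (f c) b) = ?R C (f c) c" if "c \<in> C" for c
  proof -
    have "f c = (\<Sum>b\<in>B. scale (?R B (f c) b) b)"
      using sum_representation_eq[of B "f c" B] inB that B by auto
    then have "?R C (f c) c = ?R C (\<Sum>b\<in>B. scale (?R B (f c) b) b) c"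
      by simp
    also have "\<dots> = (\<Sum>b\<in>B. ?R B (f c) b * ?R C b c)"
      using C by (simp add: representation_sum representation_scale span_scale span_base)
    finally show ?thesis
      by (simp add: mult.commute)
  qed
  have "trace_basis B f = (\<Sum>b\<in>B. \<Sum>c\<in>C. ?R C b c * ?R B (f c) b)"
    by (simp add: trace_basis_def 1)
  also have "\<dots> = trace_basis C f"
    by (subst sum.swap) (simp add: trace_basis_def 2)
  finally show ?thesis .
qed

lemma trace_on_eq:
  assumes "finite B" "independent B" "span B = U" "endo f" "f ` U \<subseteq> U"
  shows "trace_on U f = trace_basis B f"
proof -
  define C where "C = (SOME B. finite B \<and> independent B \<and> span B = U)"
  have "finite C \<and> independent C \<and> span C = U"
    unfolding C_def by (rule someI[of _ B]) (use assms in blast)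
  then show ?thesis
    unfolding trace_on_def C_def[symmetric] using assms by (intro trace_basis_eq) auto
qed

lemma trace_on_cong:
  assumes "fin_dim U" "\<And>v. v \<in> U \<Longrightarrow> f v = g v"
  shows "trace_on U f = trace_on U g"
proof -
  define C where "C = (SOME B. finite B \<and> independent B \<and> span B = U)"
  have "finite C \<and> independent C \<and> span C = U"
    unfolding C_def by (rule someI_ex) (use assms fin_dim_def in blast)
  then have "C \<subseteq> U" using span_superset by blast
  then show ?thesis
    unfolding trace_on_def C_def[symmetric] trace_basis_def using assms by (intro sum.cong) auto
qed

text \<open>Extend a basis of \<open>U\<close> to \<open>W\<close>: the added vectors are mapped
  into \<open>U\<close> and contribute nothing to the diagonal.\<close>

lemma trace_on_restrict:
  assumes "fin_dim W" "subspace U" "U \<subseteq> W" "endo f" "f ` W \<subseteq> U"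
  shows "trace_on W f = trace_on U f"
proof -
  obtain B C where BC: "finite C" "independent C" "span C = W" "B \<subseteq> C" "finite B" "independent B" "span B = U"
    using fin_dim_extend[OF assms(1-3)] by blast
  have fc: "f c \<in> span B" if "c \<in> C" for c
    using that assms(5) BC(3,7) span_base by blast
  have R: "representation C (f c) = representation B (f c)" if "c \<in> C" for c
    by (rule representation_extend[OF BC(2) fc[OF that] BC(4)])
  have "trace_on W f = (\<Sum>b\<in>C. representation B (f b) b)"
  proof -
    have "f ` W \<subseteq> W" using assms(3,5) by blast
    then show ?thesis using trace_on_eq[OF BC(1-3) assms(4)] R by (simp add: trace_basis_def)
  qed
  also have "\<dots> = (\<Sum>b\<in>B. representation B (f b) b)"
    using BC by (intro sum.mono_neutral_right) (auto dest: representation_ne_zero)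
  also have "\<dots> = trace_on U f"
  proof -
    have "f ` U \<subseteq> U" using assms(3,5) by blast
    then show ?thesis using trace_on_eq[OF BC(5-7) assms(4)] by (simp add: trace_basis_def)
  qed
  finally show ?thesis .
qed

lemma trace_on_commute:
  assumes "fin_dim U" "endo f" "f ` U \<subseteq> U" "endo g" "g ` U \<subseteq> U"
  shows "trace_on U (\<lambda>v. f (g v)) = trace_on U (\<lambda>v. g (f v))"
proof -
  obtain B where B: "finite B" "independent B" "span B = U"
    using assms(1) fin_dim_def by blast
  let ?R = "representation B"
  have *: "trace_basis B (\<lambda>v. f (g v)) = (\<Sum>b\<in>B. \<Sum>c\<in>B. ?R (g b) c * ?R (f c) b)"
    if f: "endo f" "f ` U \<subseteq> U" and g: "endo g" "g ` U \<subseteq> U" for f g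
    unfolding trace_basis_def
  proof (rule sum.cong)
    fix b assume "b \<in> B"
    have "b \<in> U" using \<open>b \<in> B\<close> B span_base by blast
    then have "g b \<in> span B" using g(2) B by blast
    then have "g b = (\<Sum>c\<in>B. scale (?R (g b) c) c)"
      using sum_representation_eq[of B "g b" B] B by auto
    then have "f (g b) = (\<Sum>c\<in>B. scale (?R (g b) c) (f c))"
      by (metis (no_types, lifting) endo_scale[OF f(1)] endo_sum[OF f(1)] sum.cong)
    moreover have "f c \<in> span B" if "c \<in> B" for c
      using that f(2) B span_base by blast
    ultimately show "?R (f (g b)) b = (\<Sum>c\<in>B. ?R (g b) c * ?R (f c) b)"
      using B(1,2) by (simp add: representation_sum representation_scale span_scale)
  qed simp
  have "trace_basis B (\<lambda>v. f (g v)) = trace_basis B (\<lambda>v. g (f v))"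
    unfolding *[OF assms(2-5)] *[OF assms(4,5,2,3)]
    by (subst sum.swap) (simp add: mult.commute)
  moreover have "trace_on U (\<lambda>v. f (g v)) = trace_basis B (\<lambda>v. f (g v))"
    by (rule trace_on_eq[OF B endo_compose[OF assms(2,4)]]) (use assms(3,5) in blast)
  moreover have "trace_on U (\<lambda>v. g (f v)) = trace_basis B (\<lambda>v. g (f v))"
    by (rule trace_on_eq[OF B endo_compose[OF assms(4,2)]]) (use assms(3,5) in blast)
  ultimately show ?thesis
    by simp
qed

lemma trace_on_sum:
  assumes "fin_dim U" "finite I" "\<And>i. i \<in> I \<Longrightarrow> endo (f i)" "\<And>i. i \<in> I \<Longrightarrow> f i ` U \<subseteq> U"
  shows "trace_on U (\<lambda>v. \<Sum>i\<in>I. scale (c i) (f i v)) = (\<Sum>i\<in>I. c i * trace_on U (f i))"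
proof -
  obtain B where B: "finite B" "independent B" "span B = U"
    using assms(1) fin_dim_def by blast
  have U: "subspace U" using assms(1) by (rule fin_dim_subspace)
  have BU: "b \<in> B \<Longrightarrow> b \<in> U" for b using B span_base by blast
  have "endo (\<lambda>v. \<Sum>i\<in>I. scale (c i) (f i v))"
    using assms(3) by (simp add: endo_def scale_right_distrib sum.distrib scale_sum_right mult.commute)
  moreover have "(\<lambda>v. \<Sum>i\<in>I. scale (c i) (f i v)) ` U \<subseteq> U"
    using assms(4) by (auto intro!: subspace_sum subspace_scale U)
  ultimately have "trace_on U (\<lambda>v. \<Sum>i\<in>I. scale (c i) (f i v)) = trace_basis B (\<lambda>v. \<Sum>i\<in>I. scale (c i) (f i v))"
    by (intro trace_on_eq B)
  also have "\<dots> = (\<Sum>b\<in>B. \<Sum>i\<in>I. c i * representation B (f i b) b)"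
    unfolding trace_basis_def
  proof (rule sum.cong)
    fix b assume "b \<in> B"
    then have "f i b \<in> span B" if "i \<in> I" for i
      using that assms(4) BU B(3) by blast
    then show "representation B (\<Sum>i\<in>I. scale (c i) (f i b)) b = (\<Sum>i\<in>I. c i * representation B (f i b) b)"
      using B(1,2) by (simp add: representation_sum representation_scale span_scale)
  qed simp
  also have "\<dots> = (\<Sum>i\<in>I. c i * trace_basis B (f i))"
    by (subst sum.swap) (simp add: trace_basis_def sum_distrib_left)
  also have "\<dots> = (\<Sum>i\<in>I. c i * trace_on U (f i))"
    using assms B by (intro sum.cong) (auto simp: trace_on_eq)
  finally show ?thesis .
qed

lemma trace_on_add:
  assumes "fin_dim U" "endo f" "f ` U \<subseteq> U" "endo g" "g ` U \<subseteq> U"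
  shows "trace_on U (\<lambda>v. f v + g v) = trace_on U f + trace_on U g"
  using trace_on_sum[of U UNIV "\<lambda>b. if b then f else g" "\<lambda>_. 1"] assms by (simp add: UNIV_bool add.commute)

lemma trace_on_scale:
  assumes "fin_dim U" "endo f" "f ` U \<subseteq> U"
  shows "trace_on U (\<lambda>v. scale c (f v)) = c * trace_on U f"
  using trace_on_sum[of U "{()}" "\<lambda>_. f" "\<lambda>_. c"] assms by simp

lemma trace_on_diff:
  assumes "fin_dim U" "endo f" "f ` U \<subseteq> U" "endo g" "g ` U \<subseteq> U"
  shows "trace_on U (\<lambda>v. f v - g v) = trace_on U f - trace_on U g"
  using trace_on_sum[of U UNIV "\<lambda>b. if b then f else g" "\<lambda>b. if b then 1 else -1"] assms
  by (simp add: UNIV_bool add.commute)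

lemma trace_on_poly_op:
  assumes "fin_dim U" "endo f" "f ` U \<subseteq> U"
  shows "trace_on U (poly_op p f) = (\<Sum>i\<le>Polynomial.degree p. poly.coeff p i * trace_on U (f ^^ i))"
  unfolding poly_op_def[abs_def]
  by (rule trace_on_sum) (use assms funpow_invariant endo_funpow in auto)

text \<open>The trace can be taken on the image of \<open>U\<close>, where one power of
  \<open>f\<close> less suffices to reach zero.\<close>

lemma trace_on_nilpotent:
  assumes "fin_dim U" "endo f" "f ` U \<subseteq> U" "\<And>v. v \<in> U \<Longrightarrow> (f ^^ k) v = 0"
  shows "trace_on U f = 0"
  using assms
proof (induction k arbitrary: U)
  case 0
  then have "U \<subseteq> {0}" by auto
  then have "trace_on U f = trace_on {0} f"
    using 0 subspace_0[OF fin_dim_subspace] by (metis insertI1 subset_singletonD empty_iff)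
  also have "\<dots> = trace_basis {} f"
    using 0 by (intro trace_on_eq) (auto simp: endo_0 independent_empty)
  finally show ?case by (simp add: trace_basis_def)
next
  case (Suc k)
  have sub: "subspace (f ` U)"
    using Suc.prems fin_dim_subspace endo_image_subspace by blast
  have "trace_on U f = trace_on (f ` U) f"
    using Suc.prems sub by (intro trace_on_restrict) auto
  also have "\<dots> = 0"
  proof (rule Suc.IH)
    show "fin_dim (f ` U)"
      using Suc.prems sub fin_dim_subset by blast
    show "(f ^^ k) v = 0" if "v \<in> f ` U" for v
      using that Suc.prems(4) by (auto simp: funpow_Suc_right simp del: funpow.simps)
  qed (use Suc.prems in auto)
  finally show ?case .
qed

text \<open>The trace can be taken on the image, where \<open>e\<close> is the identity. In
  characteristic zero this converts vanishing traces into vanishing dimensions.\<close>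

lemma trace_on_idempotent:
  assumes "fin_dim U" "endo e" "e ` U \<subseteq> U" "\<And>v. v \<in> U \<Longrightarrow> e (e v) = e v"
  shows "trace_on U e = of_nat (dim (e ` U))"
proof -
  have sub: "subspace (e ` U)"
    using assms fin_dim_subspace endo_image_subspace by blast
  obtain B where B: "finite B" "independent B" "span B = e ` U"
    using fin_dim_subset[OF assms(1) sub assms(3)] fin_dim_def by blast
  have "trace_on U e = trace_on (e ` U) e"
    using assms sub by (intro trace_on_restrict) auto
  also have "\<dots> = trace_basis B e"
    using assms B by (intro trace_on_eq) auto
  also have "\<dots> = (\<Sum>b\<in>B. 1)"
    unfolding trace_basis_def
  proof (rule sum.cong)
    fix b assume "b \<in> B"
    then have "b \<in> e ` U" using B span_base by blast
    then have "e b = b" using assms(4) by auto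
    then show "representation B (e b) b = 1"
      using representation_basis[OF B(2) \<open>b \<in> B\<close>] by simp
  qed simp
  also have "\<dots> = of_nat (dim (e ` U))"
    using dim_span_eq_card_independent[OF B(2)] B(3) by simp
  finally show ?thesis .
qed

section \<open>Commuting endomorphisms\<close>

text \<open>Each application of \<open>A - B\<close> yields one vector with smaller \<open>i\<close>
  and one with smaller \<open>j\<close>; this induction replaces the binomial expansion.\<close>

lemma funpow_diff_commuting:
  assumes A: "endo A" and B: "endo B" and AB: "\<And>v. A (B v) = B (A v)"
    and "(A ^^ i) w = 0" "(B ^^ j) w = 0"
  shows "((\<lambda>v. A v - B v) ^^ (i + j)) w = 0"
proof -
  let ?D = "\<lambda>v. A v - B v"
  have D: "endo ?D" using A B by (rule endo_diff_fun)
  have "n = i + j \<Longrightarrow> (?D ^^ n) w = 0" for n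
    using assms(4,5)
  proof (induction n arbitrary: i j w)
    case 0
    then show ?case by simp
  next
    case (Suc n)
    show ?case
    proof (cases "i = 0 \<or> j = 0")
      case True
      then have "w = 0" using Suc.prems by auto
      then show ?thesis by (simp only: endo_0[OF endo_funpow[OF D]])
    next
      case False
      then obtain i' j' where ij: "i = Suc i'" "j = Suc j'"
        by (metis not0_implies_Suc)
      have "(?D ^^ n) (A w) = 0"
      proof (rule Suc.IH)
        show "n = i' + j" using Suc.prems ij by simp
        show "(A ^^ i') (A w) = 0"
          using Suc.prems(2) ij by (simp add: funpow_Suc_right del: funpow.simps)
        have "(B ^^ j) (A w) = A ((B ^^ j) w)"
          by (rule funpow_intertwine[symmetric]) (rule AB)
        then show "(B ^^ j) (A w) = 0"
          using Suc.prems(3) by (simp add: endo_0[OF A])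
      qed
      moreover have "(?D ^^ n) (B w) = 0"
      proof (rule Suc.IH)
        show "n = i + j'" using Suc.prems ij by simp
        show "(B ^^ j') (B w) = 0"
          using Suc.prems(3) ij by (simp add: funpow_Suc_right del: funpow.simps)
        have "(A ^^ i) (B w) = B ((A ^^ i) w)"
          by (rule funpow_intertwine[symmetric]) (rule AB[symmetric])
        then show "(A ^^ i) (B w) = 0"
          using Suc.prems(2) by (simp add: endo_0[OF B])
      qed
      ultimately have "(?D ^^ n) (?D w) = 0"
        by (simp add: endo_diff[OF endo_funpow[OF D]])
      then show ?thesis
        by (simp add: funpow_Suc_right del: funpow.simps)
    qed
  qed
  then show ?thesis by blast
qed

lemma poly_op_on_primary:
  assumes "endo S" "poly_op ([:-a, 1:] ^ e) S w = 0" "[:-a, 1:] ^ e dvd r - [:c:]"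
  shows "poly_op r S w = scale c w"
  using poly_op_dvd[OF assms(1,3,2)] by (simp add: poly_op_diff)

end

text \<open>The residues of \<open>q a\<close> at the points of \<open>\<Lambda>\<close> are
  Kronecker deltas, so these are the primary idempotents of the polynomial ring modulo
  \<open>m\<close>.\<close>

lemma primary_idempotents:
  fixes \<Lambda> :: "'a::field set" and e :: nat
  assumes "finite \<Lambda>"
  defines "m \<equiv> \<Prod>a\<in>\<Lambda>. [:-a, 1:] ^ e"
  obtains q where "\<And>a. a \<in> \<Lambda> \<Longrightarrow> m dvd [:-a, 1:] ^ e * q a" "m dvd (\<Sum>a\<in>\<Lambda>. q a) - 1"
    "\<And>a. a \<in> \<Lambda> \<Longrightarrow> m dvd q a * q a - q a"
proof -
  have "\<forall>a. \<exists>p. \<forall>b\<in>\<Lambda>. [:-b, 1:] ^ e dvd p - [:if a = b then 1 else 0:]"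
    by (rule allI) (rule poly_interpolate_mod[OF assms(1)])
  then obtain q where "\<forall>a. \<forall>b\<in>\<Lambda>. [:-b, 1:] ^ e dvd q a - [:if a = b then 1 else 0:]"
    by (elim choice[THEN exE]) blast
  then have q: "\<And>a b. b \<in> \<Lambda> \<Longrightarrow> [:-b, 1:] ^ e dvd q a - [:if a = b then 1 else 0:]"
    by blast
  have q1: "[:-a, 1:] ^ e dvd q a - 1" if "a \<in> \<Lambda>" for a
    using q[OF that, of a] by (simp add: one_pCons)
  have q0: "[:-b, 1:] ^ e dvd q a" if "b \<in> \<Lambda>" "a \<noteq> b" for a b
    using q[OF that(1), of a] that(2) by simp
  show ?thesis
  proof
    show "m dvd [:-a, 1:] ^ e * q a" if "a \<in> \<Lambda>" for a
      unfolding m_def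
    proof (rule linear_powers_dvd[OF assms(1)])
      fix b assume "b \<in> \<Lambda>"
      then show "[:-b, 1:] ^ e dvd [:-a, 1:] ^ e * q a"
        using q0[of b a] by (cases "a = b") (auto intro: dvd_mult)
    qed
    show "m dvd (\<Sum>a\<in>\<Lambda>. q a) - 1"
      unfolding m_def
    proof (rule linear_powers_dvd[OF assms(1)])
      fix b assume b: "b \<in> \<Lambda>"
      have eq: "(\<Sum>a\<in>\<Lambda>. q a) - 1 = (q b - 1) + (\<Sum>a\<in>\<Lambda> - {b}. q a)"
        using b assms(1) by (simp add: sum.remove)
      show "[:-b, 1:] ^ e dvd (\<Sum>a\<in>\<Lambda>. q a) - 1"
        unfolding eq using q1[OF b] q0[OF b] by (intro dvd_add dvd_sum) auto
    qed
    show "m dvd q a * q a - q a" if "a \<in> \<Lambda>" for a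
      unfolding m_def
    proof (rule linear_powers_dvd[OF assms(1)])
      fix b assume b: "b \<in> \<Lambda>"
      have "q a * q a - q a = q a * (q a - 1)"
        by (simp add: algebra_simps)
      then show "[:-b, 1:] ^ e dvd q a * q a - q a"
        using q1[of a] q0[OF b, of a] b by (cases "a = b") (auto intro: dvd_mult dvd_mult2)
    qed
  qed
qed

context operator_space
begin

text \<open>On the joint generalized eigenspaces of \<open>S\<close> and \<open>T\<close>, with eigenvalues \<open>a\<close> and \<open>b\<close>,
  \<open>S - T\<close> has the single eigenvalue \<open>a - b\<close>.\<close>

lemma poly_op_difference:
  fixes \<Lambda> :: "'a set" and e :: nat
  assumes S: "endo S" and T: "endo T" and ST: "\<And>v. S (T v) = T (S v)" and \<Lambda>: "finite \<Lambda>"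
  defines "m \<equiv> \<Prod>a\<in>\<Lambda>. [:-a, 1:] ^ e"
  assumes mS: "poly_op m S l = 0" and mT: "poly_op m T l = 0"
    and p: "\<And>a. a \<in> \<Lambda> \<Longrightarrow> [:-a, 1:] ^ e dvd p - [:\<phi> a:]"
    and r: "\<And>a b. a \<in> \<Lambda> \<Longrightarrow> b \<in> \<Lambda> \<Longrightarrow> [:-(a - b), 1:] ^ (e + e) dvd r - [:\<phi> a - \<phi> b:]"
  shows "poly_op r (\<lambda>v. S v - T v) l = poly_op p S l - poly_op p T l"
proof -
  let ?D = "\<lambda>v. S v - T v"
  obtain q where q: "\<And>a. a \<in> \<Lambda> \<Longrightarrow> m dvd [:-a, 1:] ^ e * q a" "m dvd (\<Sum>a\<in>\<Lambda>. q a) - 1"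
    using primary_idempotents[OF \<Lambda>, of e] unfolding m_def by blast
  have D: "endo ?D" using S T by (rule endo_diff_fun)
  have sum_op: "poly_op (\<Sum>a\<in>\<Lambda>. q a) f v = (\<Sum>a\<in>\<Lambda>. poly_op (q a) f v)" for f v
    using \<Lambda> by induction (simp_all add: poly_op_add)
  have split: "(\<Sum>a\<in>\<Lambda>. poly_op (q a) f v) = v" if "endo f" "poly_op m f v = 0" for f v
    using poly_op_dvd[OF that(1) q(2) that(2)] by (simp add: poly_op_diff sum_op)
  have PST: "poly_op x S (T v) = T (poly_op x S v)" for x v
    by (rule poly_op_commute[symmetric]) (simp_all add: T ST)
  have comm: "poly_op x S (poly_op y T v) = poly_op y T (poly_op x S v)" for x y v
    by (rule poly_op_commute) (simp_all add: endo_poly_op S PST)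
  \<comment> \<open>The component of \<open>l\<close> with eigenvalue \<open>a\<close> under
    \<open>S\<close> and \<open>b\<close> under \<open>T\<close>.\<close>
  define w where "w a b = poly_op (q a) S (poly_op (q b) T l)" for a b
  have "l = (\<Sum>a\<in>\<Lambda>. poly_op (q a) S l)"
    using split[OF S mS] by simp
  also have "\<dots> = (\<Sum>a\<in>\<Lambda>. poly_op (q a) S (\<Sum>b\<in>\<Lambda>. poly_op (q b) T l))"
    using split[OF T mT] by simp
  also have "\<dots> = (\<Sum>a\<in>\<Lambda>. \<Sum>b\<in>\<Lambda>. w a b)"
    by (simp add: w_def endo_sum[OF endo_poly_op[OF S]])
  finally have l: "l = (\<Sum>a\<in>\<Lambda>. \<Sum>b\<in>\<Lambda>. w a b)" .
  have w: "poly_op r ?D (w a b) = poly_op p S (w a b) - poly_op p T (w a b)"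
    if a: "a \<in> \<Lambda>" and b: "b \<in> \<Lambda>" for a b
  proof -
    have "poly_op ([:-a, 1:] ^ e * q a) S l = 0"
      by (rule poly_op_dvd[OF S q(1)[OF a] mS])
    then have wS: "poly_op ([:-a, 1:] ^ e) S (w a b) = 0"
      unfolding w_def comm by (simp add: comm poly_op_mult[OF S] endo_0[OF endo_poly_op[OF T]])
    have "poly_op ([:-b, 1:] ^ e * q b) T l = 0"
      by (rule poly_op_dvd[OF T q(1)[OF b] mT])
    then have wT: "poly_op ([:-b, 1:] ^ e) T (w a b) = 0"
      unfolding w_def by (simp add: comm[symmetric] poly_op_mult[OF T] endo_0[OF endo_poly_op[OF S]])
    let ?A = "poly_op [:-a, 1:] S" and ?B = "poly_op [:-b, 1:] T"
    \<comment> \<open>\<open>D - (a - b)\<close> is the difference of the commuting maps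
      \<open>S - a\<close> and \<open>T - b\<close>, each of which kills the component after
      \<open>e\<close> steps; hence the exponent \<open>e + e\<close> in \<open>r\<close>.\<close>
    have AB: "(\<lambda>v. ?A v - ?B v) = poly_op [:-(a - b), 1:] ?D"
      by (rule ext) (simp add: algebra_simps)
    have A0: "(?A ^^ e) (w a b) = 0"
      using wS by (simp only: poly_op_power[OF S])
    have B0: "(?B ^^ e) (w a b) = 0"
      using wT by (simp only: poly_op_power[OF T])
    have "((\<lambda>v. ?A v - ?B v) ^^ (e + e)) (w a b) = 0"
      by (rule funpow_diff_commuting[OF endo_poly_op[OF S] endo_poly_op[OF T] comm A0 B0])
    then have wD: "poly_op ([:-(a - b), 1:] ^ (e + e)) ?D (w a b) = 0"
      by (simp only: AB poly_op_power[OF D])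
    show ?thesis
      using poly_op_on_primary[OF S wS p[OF a]] poly_op_on_primary[OF T wT p[OF b]]
        poly_op_on_primary[OF D wD r[OF a b]] by (simp add: scale_left_diff_distrib)
  qed
  have "poly_op r ?D (\<Sum>a\<in>\<Lambda>. \<Sum>b\<in>\<Lambda>. w a b) =
      poly_op p S (\<Sum>a\<in>\<Lambda>. \<Sum>b\<in>\<Lambda>. w a b) - poly_op p T (\<Sum>a\<in>\<Lambda>. \<Sum>b\<in>\<Lambda>. w a b)"
    by (simp add: endo_sum[OF endo_poly_op[OF S]] endo_sum[OF endo_poly_op[OF T]]
        endo_sum[OF endo_poly_op[OF D]] w sum_subtractf)
  then show ?thesis
    by (simp only: l[symmetric])
qed

end

text \<open>\<open>\<pi>\<close> is a linear functional on the larger field, viewed as a vector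
  space over the smaller one. With \<open>z = 1\<close> it retracts the closure onto the ground
  field; over the rationals \<open>z\<close> will be a nonzero eigenvalue.\<close>

lemma field_hom_retraction:
  fixes h :: "'a::field \<Rightarrow> 'k::field"
  assumes "\<And>x y. h (x + y) = h x + h y" "\<And>x y. h (x * y) = h x * h y" "h 1 = 1" and "z \<noteq> 0"
  shows "\<exists>\<pi>. (\<forall>x y. \<pi> (x + y) = \<pi> x + \<pi> y) \<and> (\<forall>c x. \<pi> (h c * x) = c * \<pi> x) \<and> \<pi> z = 1"
proof -
  interpret vector_space_pair "\<lambda>c x. h c * x" "\<lambda>c x :: 'a. c * x"
    by unfold_locales (simp_all add: assms(1-3) distrib_left distrib_right mult.assoc)
  have "vs1.independent {z}"
    using assms(4) by simp
  from linear_independent_extend[OF this, of "\<lambda>_. 1"] obtain \<pi>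
    where "Vector_Spaces.linear (\<lambda>c x. h c * x) (*) \<pi>" "\<pi> z = 1"
    by blast
  then show ?thesis
    by (intro exI[of _ \<pi>]) (simp add: Vector_Spaces.linear_iff)
qed

section \<open>Finite-dimensional spaces\<close>

locale fd_operator_space = operator_space scale + finite_dimensional_vector_space scale Basis
  for scale :: "'a::field_char_0 \<Rightarrow> 'b::ab_group_add \<Rightarrow> 'b" and Basis :: "'b set"
begin

abbreviation tr :: "('b \<Rightarrow> 'b) \<Rightarrow> 'a" where
  "tr \<equiv> trace_on UNIV"

abbreviation nilpotent_op :: "('b \<Rightarrow> 'b) \<Rightarrow> bool" where
  "nilpotent_op f \<equiv> \<exists>k. \<forall>v. (f ^^ k) v = 0"

lemma fin_dim_UNIV: "fin_dim UNIV"
  unfolding fin_dim_def using finite_Basis independent_Basis span_Basis by blast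

lemma fin_dim: "subspace U \<Longrightarrow> fin_dim U"
  using fin_dim_subset[OF fin_dim_UNIV] by blast

lemma tr_def: "endo f \<Longrightarrow> tr f = (\<Sum>b\<in>Basis. representation Basis (f b) b)"
  using trace_on_eq[OF finite_Basis independent_Basis span_Basis] by (simp add: trace_basis_def)

lemma vector_annihilator_exists:
  assumes f: "endo f"
  shows "\<exists>p. p \<noteq> 0 \<and> poly_op p f v = 0"
proof -
  let ?g = "\<lambda>i. (f ^^ i) v"
  let ?n = "card Basis"
  show ?thesis
  \<comment> \<open>Linear dependence concerns the set of iterates and does not see repetitions. A
    repetition yields the annihilator \<open>X^i - X^j\<close>; distinct iterates are too many to be
    independent.\<close>
  proof (cases "inj_on ?g {..?n}")
    case False
    then obtain i j where ij: "?g i = ?g j" "i \<noteq> j"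
      by (auto simp: inj_on_def)
    have mon: "poly_op (monom 1 k) f v = ?g k" for k
      by (simp add: poly_op_def degree_monom_eq if_distrib[of "\<lambda>c. scale c _"] sum.delta' cong: if_cong)
    have "poly.coeff (monom 1 i - monom (1::'a) j) i = 1"
      using ij(2) by simp
    then have "monom 1 i - monom (1::'a) j \<noteq> 0"
      by (metis coeff_0 zero_neq_one)
    moreover have "poly_op (monom 1 i - monom 1 j) f v = 0"
      using ij(1) by (simp add: poly_op_diff mon)
    ultimately show ?thesis by blast
  next
    case True
    have "dependent (?g ` {..?n})"
    proof (rule ccontr)
      assume "independent (?g ` {..?n})"
      then have "card (?g ` {..?n}) \<le> card Basis"
        using independent_span_bound[OF finite_Basis] span_Basis by blast
      then show False
        using True by (simp add: card_image)
    qed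
    then obtain u where u: "\<exists>x\<in>?g ` {..?n}. u x \<noteq> 0" "(\<Sum>x\<in>?g ` {..?n}. scale (u x) x) = 0"
      by (auto simp: dependent_finite)
    define p where "p = (\<Sum>i\<le>?n. monom (u (?g i)) i)"
    have coeff: "poly.coeff p i = u (?g i)" if "i \<le> ?n" for i
      using that by (simp add: p_def coeff_sum sum.delta)
    have "p \<noteq> 0"
      using u(1) coeff by auto
    moreover have "Polynomial.degree p \<le> ?n"
      unfolding p_def by (intro degree_sum_le) (auto intro: order_trans[OF degree_monom_le])
    then have "poly_op p f v = (\<Sum>i\<le>?n. scale (u (?g i)) (?g i))"
      by (simp add: poly_op_altdef[of p ?n] coeff)
    then have "poly_op p f v = 0"
      using u(2) True by (simp add: sum.reindex)
    ultimately show ?thesis by blast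
  qed
qed

lemma annihilator_exists:
  assumes f: "endo f"
  obtains m where "m \<noteq> 0" "\<And>v. poly_op m f v = 0"
proof -
  have "\<forall>v. \<exists>p. p \<noteq> 0 \<and> poly_op p f v = 0"
    by (rule allI) (rule vector_annihilator_exists[OF f])
  then obtain P where P: "\<And>v. P v \<noteq> 0" "\<And>v. poly_op (P v) f v = 0"
    by (elim choice[THEN exE]) blast
  define m where "m = (\<Prod>b\<in>Basis. P b)"
  have "m \<noteq> 0"
    by (simp add: m_def prod_zero_iff[OF finite_Basis] P(1))
  moreover have "poly_op m f v = 0" for v
  proof -
    have "poly_op m f b = 0" if "b \<in> Basis" for b
      using poly_op_dvd[OF f _ P(2)] dvd_prodI[OF finite_Basis that] m_def by blast
    then have "span Basis \<subseteq> {v. poly_op m f v = 0}"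
      by (intro span_minimal endo_kernel_subspace endo_poly_op f) auto
    then show ?thesis using span_Basis by auto
  qed
  ultimately show ?thesis by (rule that)
qed

text \<open>Fitting decomposition: \<open>E(f)\<close> is the idempotent onto the part on which \<open>f\<close> is bijective.\<close>

lemma fitting_polynomial:
  assumes f: "endo f"
  obtains E k where "poly.coeff E 0 = 0" "\<And>v. poly_op E f (poly_op E f v) = poly_op E f v"
    "\<And>v. (f ^^ k) (v - poly_op E f v) = 0"
proof -
  obtain m where m: "m \<noteq> 0" "\<And>v. poly_op m f v = 0"
    using annihilator_exists[OF f] by blast
  define k where "k = order 0 m"
  obtain G where G: "m = [:-0, 1:] ^ k * G" "\<not> [:-0, 1:] dvd G"
    using order_decomp[OF m(1), of 0] k_def by blast
  then have "poly G 0 \<noteq> 0"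
    by (metis poly_eq_0_iff_dvd)
  \<comment> \<open>The exponent is \<open>Suc k\<close> rather than \<open>k\<close> so that
    \<open>E\<close> has zero constant term even when \<open>k = 0\<close>.\<close>
  then obtain h where "[:-0, 1:] ^ Suc k dvd G * h - 1"
    using inverse_mod_linear_power by blast
  then obtain w where w: "G * h - 1 = [:-0, 1:] ^ Suc k * w"
    by blast
  define E where "E = 1 - G * h"
  have E: "E = pCons 0 ([:-0, 1:] ^ k * (- w))"
  proof -
    have "E = - ([:-0, 1:] ^ Suc k * w)" using w by (simp add: E_def algebra_simps)
    then show ?thesis by simp
  qed
  have "E * E - E = - (E * (G * h))"
    by (simp add: E_def algebra_simps)
  also have "\<dots> = m * (pCons 0 1 * w * h)"
    by (simp add: E G algebra_simps one_pCons)
  finally have eq: "E * E - E = m * (pCons 0 1 * w * h)" .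
  have "m dvd E * E - E"
    unfolding eq by (rule dvd_triv_left)
  from poly_op_dvd[OF f this m(2)] have "poly_op E f (poly_op E f v) = poly_op E f v" for v
    by (simp add: poly_op_diff poly_op_mult[OF f])
  moreover have "(f ^^ k) (v - poly_op E f v) = 0" for v
  proof -
    have mon: "f = poly_op [:-0, 1:] f"
      by (rule ext) simp
    have "[:-0, 1:] ^ k * (1 - E) = m * h"
      by (simp add: E_def G)
    then have "m dvd [:-0, 1:] ^ k * (1 - E)" by simp
    from poly_op_dvd[OF f this m(2)] have "poly_op ([:-0, 1:] ^ k) f (v - poly_op E f v) = 0"
      by (simp only: poly_op_mult[OF f] poly_op_diff poly_op_1)
    then show ?thesis
      by (simp only: poly_op_power[OF f] mon[symmetric])
  qed
  moreover have "poly.coeff E 0 = 0" by (simp add: E)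
  ultimately show ?thesis using that by blast
qed

lemma trace_poly_op: "endo f \<Longrightarrow> tr (poly_op p f) = (\<Sum>i\<le>Polynomial.degree p. poly.coeff p i * tr (f ^^ i))"
  by (rule trace_on_poly_op) (simp_all add: fin_dim_UNIV)

text \<open>\<open>\<Phi> w\<close> has the numbers \<open>\<beta> w b\<close> as coordinates;
  nondegeneracy makes it injective on \<open>U\<close>, and the dimension then makes it
  onto.\<close>

lemma nondegenerate_represents:
  assumes U: "subspace U"
    and lin: "\<And>x y z. \<beta> (x + y) z = \<beta> x z + \<beta> y z" "\<And>c x z. \<beta> (scale c x) z = c * \<beta> x z"
      "\<And>x y z. \<beta> z (x + y) = \<beta> z x + \<beta> z y" "\<And>c x z. \<beta> z (scale c x) = c * \<beta> z x"
    and l: "\<And>x y. l (x + y) = l x + l y" "\<And>c x. l (scale c x) = c * l x"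
    and nondeg: "\<And>w. w \<in> U \<Longrightarrow> (\<And>b. b \<in> U \<Longrightarrow> \<beta> w b = 0) \<Longrightarrow> w = 0"
  obtains w where "w \<in> U" "\<And>b. b \<in> U \<Longrightarrow> \<beta> w b = l b"
proof -
  interpret finite_dimensional_vector_space_pair_1 scale Basis scale ..
  obtain B where B: "finite B" "independent B" "span B = U"
    using fin_dim[OF U] fin_dim_def by blast
  have ext: "\<forall>b\<in>U. g b = g' b"
    if g: "\<And>x y. g (x + y) = g x + g y" "\<And>c x. g (scale c x) = c * g x"
      and g': "\<And>x y. g' (x + y) = g' x + g' y" "\<And>c x. g' (scale c x) = c * g' x"
      and eq: "\<And>b. b \<in> B \<Longrightarrow> g b = g' b" for g g' :: "'b \<Rightarrow> 'a"
  proof -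
    have "g 0 = 0" "g' 0 = 0" using g(2)[of 0 0] g'(2)[of 0 0] by simp_all
    then have "subspace {b. g b = g' b}" using g g' by (simp add: subspace_def)
    then have "span B \<subseteq> {b. g b = g' b}" using eq by (intro span_minimal) auto
    then show ?thesis using B(3) by blast
  qed
  define \<Phi> where "\<Phi> w = (\<Sum>b\<in>B. scale (\<beta> w b) b)" for w
  have \<Phi>: "endo \<Phi>"
    by (simp add: endo_def \<Phi>_def lin scale_left_distrib sum.distrib scale_sum_right)
  have coeffs: "\<forall>b\<in>B. c b = d b" if "(\<Sum>b\<in>B. scale (c b) b) = (\<Sum>b\<in>B. scale (d b) b)" for c d :: "'b \<Rightarrow> 'a"
  proof -
    have "(\<Sum>b\<in>B. scale (c b - d b) b) = 0"
      using that by (simp add: scale_left_diff_distrib sum_subtractf)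
    moreover have "\<forall>u. (\<Sum>b\<in>B. scale (u b) b) = 0 \<longrightarrow> (\<forall>b\<in>B. u b = 0)"
      using B(2) unfolding dependent_finite[OF B(1)] by blast
    ultimately have "\<forall>b\<in>B. c b - d b = 0"
      by (elim allE[of _ "\<lambda>b. c b - d b"]) simp
    then show ?thesis by simp
  qed
  have "inj_on \<Phi> U"
  proof (rule inj_onI)
    fix x y assume xy: "x \<in> U" "y \<in> U" "\<Phi> x = \<Phi> y"
    have "\<forall>b\<in>B. \<beta> x b = \<beta> y b"
      using xy(3) unfolding \<Phi>_def by (rule coeffs[of "\<beta> x" "\<beta> y"])
    then have *: "\<forall>b\<in>U. \<beta> x b = \<beta> y b" by (intro ext) (simp_all add: lin)
    have "\<beta> (x - y) b = 0" if "b \<in> U" for b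
    proof -
      have "\<beta> (x - y) b + \<beta> y b = \<beta> x b" using lin(1)[of "x - y" y b] by simp
      then show ?thesis using * that by simp
    qed
    then have "x - y = 0" using nondeg subspace_diff[OF U] xy by blast
    then show "x = y" by simp
  qed
  then have "dim (\<Phi> ` U) = dim U"
    using U \<Phi> by (intro dim_image_eq) (simp_all add: endo_iff_linear span_eq_iff[THEN iffD2, OF U])
  moreover have "\<Phi> ` U \<subseteq> U"
    unfolding \<Phi>_def using B(3) span_base by (auto intro!: subspace_sum subspace_scale U)
  ultimately have "\<Phi> ` U = U"
    using U \<Phi> by (intro subspace_dim_equal endo_image_subspace) auto
  moreover have "(\<Sum>b\<in>B. scale (l b) b) \<in> U"
    using B(3) span_base by (auto intro!: subspace_sum subspace_scale U)
  ultimately obtain w where w: "w \<in> U" "\<Phi> w = (\<Sum>b\<in>B. scale (l b) b)"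
    by (metis imageE)
  have "\<forall>b\<in>B. \<beta> w b = l b" using w(2) unfolding \<Phi>_def by (rule coeffs[of "\<beta> w" l])
  then have "\<forall>b\<in>U. \<beta> w b = l b" by (intro ext) (simp_all add: lin l)
  then show ?thesis using w(1) that by blast
qed

end

section \<open>Extension of scalars to the algebraic closure\<close>

lemma coeff_map_to_ac [simp]: "poly.coeff (map_poly to_ac p) k = to_ac (poly.coeff p k)"
  by (simp add: coeff_map_poly)

lemma degree_map_to_ac [simp]: "Polynomial.degree (map_poly to_ac p) = Polynomial.degree p"
  by (rule degree_map_poly) simp

lemma map_to_ac_add: "map_poly to_ac (p + q) = map_poly to_ac p + map_poly to_ac q"
  and map_to_ac_diff: "map_poly to_ac (p - q) = map_poly to_ac p - map_poly to_ac q"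
  and map_to_ac_mult: "map_poly to_ac (p * q) = map_poly to_ac p * map_poly to_ac q"
  and map_to_ac_pCons: "map_poly to_ac (pCons c p) = pCons (to_ac c) (map_poly to_ac p)"
  and map_to_ac_pderiv: "map_poly to_ac (pderiv p) = pderiv (map_poly to_ac p)"
  by (rule poly_eqI, simp add: coeff_mult to_ac_sum coeff_pderiv coeff_pCons split: nat.split)+

lemma map_to_ac_1: "map_poly to_ac 1 = 1"
  by (simp add: one_pCons map_to_ac_pCons)

lemma map_to_ac_power: "map_poly to_ac (p ^ n) = map_poly to_ac p ^ n"
  by (induction n) (simp_all add: map_to_ac_1 map_to_ac_mult)

lemma map_to_ac_pcompose: "map_poly to_ac (p \<circ>\<^sub>p q) = map_poly to_ac p \<circ>\<^sub>p map_poly to_ac q"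
  by (induction p) (simp_all add: pcompose_pCons map_to_ac_add map_to_ac_mult map_to_ac_pCons)

lemma map_to_ac_dvd: "p dvd q \<Longrightarrow> map_poly to_ac p dvd map_poly to_ac q"
  by (elim dvdE) (simp add: map_to_ac_mult)

lemma map_to_ac_eq_0: "map_poly to_ac p = 0 \<longleftrightarrow> p = 0"
  by (simp add: poly_eq_iff)

lemma dvd_root_powers:
  fixes p :: "'k::alg_closed_field poly"
  assumes "p \<noteq> 0"
  shows "p dvd (\<Prod>a | poly p a = 0. [:-a, 1:] ^ Suc (Polynomial.degree p))"
proof -
  obtain A where A: "size A = Polynomial.degree p"
      "p = smult (lead_coeff p) (\<Prod>x\<in>#A. [:-x, 1:])"
    using alg_closed_imp_factorization[OF assms] by blast
  let ?R = "{a. poly p a = 0}"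
  let ?G = "\<Prod>a\<in>?R. [:-a, 1:]"
  have fin: "finite ?R"
    using assms by (rule poly_roots_finite)
  have "(\<Prod>x\<in>#B. [:-x, 1:]) dvd ?G ^ size B" if "set_mset B \<subseteq> ?R" for B
    using that
  proof (induction B)
    case (add x B)
    then have "[:-x, 1:] dvd ?G"
      using dvd_prodI[OF fin, of x "\<lambda>a. [:-a, 1:]"] by simp
    moreover have "(\<Prod>x\<in>#B. [:-x, 1:]) dvd ?G ^ size B"
      using add by simp
    ultimately have "[:-x, 1:] * (\<Prod>x\<in>#B. [:-x, 1:]) dvd ?G * ?G ^ size B"
      by (rule mult_dvd_mono)
    then show ?case
      by (simp only: image_mset_add_mset prod_mset.add_mset size_add_mset power_Suc)
  qed simp
  moreover have "set_mset A \<subseteq> ?R"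
  proof
    fix x assume "x \<in> set_mset A"
    then have "[:-x, 1:] dvd (\<Prod>x\<in>#A. [:-x, 1:])"
      by (intro dvd_prod_mset) auto
    then have "[:-x, 1:] dvd p"
      by (subst A(2)) (rule dvd_smult)
    then show "x \<in> ?R"
      by (simp add: poly_eq_0_iff_dvd)
  qed
  ultimately have "(\<Prod>x\<in>#A. [:-x, 1:]) dvd ?G ^ Polynomial.degree p"
    using A(1) by metis
  \<comment> \<open>The extra power keeps the exponent positive even for constant \<open>p\<close>;
    later arguments extract a factor \<open>X - a\<close> from it.\<close>
  also have "\<dots> dvd ?G ^ Suc (Polynomial.degree p)"
    by (rule le_imp_power_dvd) simp
  finally have "p dvd ?G ^ Suc (Polynomial.degree p)"
    by (subst A(2)) (use assms in \<open>simp add: smult_dvd_iff\<close>)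
  then show ?thesis
    by (simp only: prod_power_distrib)
qed

text \<open>Functions with values in the closure take the place of vectors after extension of
  scalars, so that the results on \<open>operator_space\<close> apply over the larger field.\<close>

definition fscale :: "'k::field \<Rightarrow> ('x \<Rightarrow> 'k) \<Rightarrow> 'x \<Rightarrow> 'k" where
  "fscale c \<chi> = (\<lambda>x. c * \<chi> x)"

interpretation fun_space: operator_space fscale
  by unfold_locales (simp_all add: fscale_def fun_eq_iff algebra_simps)

lemma sum_fun_apply: "(\<Sum>i\<in>A. F i) x = (\<Sum>i\<in>A. F i x)"
  by (induction A rule: infinite_finite_induct) simp_all

lemma fun_space_poly_op_apply:
  "fun_space.poly_op P S l x = (\<Sum>k\<le>Polynomial.degree P. poly.coeff P k * ((S ^^ k) l) x)"
  by (simp add: fun_space.poly_op_def sum_fun_apply fscale_def)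

definition commutator :: "('b::ab_group_add \<Rightarrow> 'b) \<Rightarrow> ('b \<Rightarrow> 'b) \<Rightarrow> 'b \<Rightarrow> 'b" where
  "commutator f g = (\<lambda>v. f (g v) - g (f v))"

context fd_operator_space
begin

text \<open>For a functional \<open>\<chi>\<close>, the scalars \<open>\<chi> (f\<^sup>i g f\<^sup>j v)\<close> form a double sequence over the algebraic closure on
  which left and right multiplication by \<open>f\<close> act as the two shifts.\<close>

definition orbit_seq :: "('b \<Rightarrow> 'b) \<Rightarrow> ('b \<Rightarrow> 'a) \<Rightarrow> 'b \<Rightarrow> ('b \<Rightarrow> 'b) \<Rightarrow> nat \<times> nat \<Rightarrow> 'a alg_closure" where
  "orbit_seq f \<chi> v g = (\<lambda>x. to_ac (\<chi> ((f ^^ fst x) (g ((f ^^ snd x) v)))))"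

definition lshift :: "(nat \<times> nat \<Rightarrow> 'k) \<Rightarrow> nat \<times> nat \<Rightarrow> 'k" where
  "lshift l = (\<lambda>x. l (Suc (fst x), snd x))"

definition rshift :: "(nat \<times> nat \<Rightarrow> 'k) \<Rightarrow> nat \<times> nat \<Rightarrow> 'k" where
  "rshift l = (\<lambda>x. l (fst x, Suc (snd x)))"

lemma endo_lshift: "fun_space.endo lshift" and endo_rshift: "fun_space.endo rshift"
  by (simp_all add: fun_space.endo_def lshift_def rshift_def fscale_def fun_eq_iff)

lemma lshift_rshift: "lshift (rshift l) = rshift (lshift l)"
  by (simp add: lshift_def rshift_def)

definition functional :: "('b \<Rightarrow> 'a) \<Rightarrow> bool" where
  "functional \<chi> \<longleftrightarrow> (\<forall>x y. \<chi> (x + y) = \<chi> x + \<chi> y) \<and> (\<forall>c x. \<chi> (scale c x) = c * \<chi> x)"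

lemma functional_0: "functional \<chi> \<Longrightarrow> \<chi> 0 = 0"
  unfolding functional_def by (metis scale_zero_left mult_zero_left)

lemma functional_diff: "functional \<chi> \<Longrightarrow> \<chi> (x - y) = \<chi> x - \<chi> y"
  unfolding functional_def by (metis add_diff_cancel_right' diff_add_cancel)

lemma functional_sum: "functional \<chi> \<Longrightarrow> \<chi> (\<Sum>i\<in>A. scale (c i) (F i)) = (\<Sum>i\<in>A. c i * \<chi> (F i))"
  by (induction A rule: infinite_finite_induct) (simp_all add: functional_0, simp add: functional_def)

lemma functional_coordinate: "functional (\<lambda>u. representation Basis u b)"
  using independent_Basis span_Basis
  by (simp add: functional_def representation_add representation_scale)

lemma lshift_orbit: "lshift (orbit_seq f \<chi> v g) = orbit_seq f \<chi> v (\<lambda>v. f (g v))"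
  by (simp add: lshift_def orbit_seq_def funpow_swap1)

lemma rshift_orbit: "rshift (orbit_seq f \<chi> v g) = orbit_seq f \<chi> v (\<lambda>v. g (f v))"
  by (simp add: rshift_def orbit_seq_def)

lemma lshift_funpow_orbit: "(lshift ^^ k) (orbit_seq f \<chi> v g) = orbit_seq f \<chi> v (\<lambda>v. (f ^^ k) (g v))"
  by (induction k) (simp_all add: lshift_orbit)

lemma rshift_funpow_orbit: "(rshift ^^ k) (orbit_seq f \<chi> v g) = orbit_seq f \<chi> v (\<lambda>v. g ((f ^^ k) v))"
  by (induction k) (simp_all add: rshift_orbit funpow_swap1)

text \<open>\<open>ad f\<close> is left minus right multiplication by \<open>f\<close>; on double
  sequences it is a difference of commuting shifts, to which \<open>poly_op_difference\<close>
  applies.\<close>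

lemma shift_diff_orbit:
  assumes "endo f" "functional \<chi>"
  shows "((\<lambda>l. lshift l - rshift l) ^^ k) (orbit_seq f \<chi> v g) = orbit_seq f \<chi> v ((commutator f ^^ k) g)"
proof (induction k)
  case (Suc k)
  have "lshift (orbit_seq f \<chi> v h) - rshift (orbit_seq f \<chi> v h) = orbit_seq f \<chi> v (commutator f h)" for h
    unfolding lshift_orbit rshift_orbit
    by (simp add: fun_eq_iff orbit_seq_def commutator_def
        endo_diff[OF endo_funpow[OF assms(1)]] functional_diff[OF assms(2)])
  then show ?case by (simp only: funpow.simps comp_apply Suc.IH)
qed simp

lemma poly_lshift_orbit:
  assumes f: "endo f" and \<chi>: "functional \<chi>"
  shows "fun_space.poly_op (map_poly to_ac P) lshift (orbit_seq f \<chi> v g) = orbit_seq f \<chi> v (\<lambda>v. poly_op P f (g v))"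
  by (rule ext) (simp add: fun_space_poly_op_apply lshift_funpow_orbit, simp add: orbit_seq_def poly_op_def
      endo_sum[OF endo_funpow[OF f]] endo_scale[OF endo_funpow[OF f]] functional_sum[OF \<chi>] to_ac_sum)

lemma poly_rshift_orbit:
  assumes f: "endo f" and g: "endo g" and \<chi>: "functional \<chi>"
  shows "fun_space.poly_op (map_poly to_ac P) rshift (orbit_seq f \<chi> v g) = orbit_seq f \<chi> v (\<lambda>v. g (poly_op P f v))"
  by (rule ext) (simp add: fun_space_poly_op_apply rshift_funpow_orbit, simp add: orbit_seq_def poly_op_def
      endo_sum[OF g] endo_scale[OF g]
      endo_sum[OF endo_funpow[OF f]] endo_scale[OF endo_funpow[OF f]] functional_sum[OF \<chi>] to_ac_sum
      poly_op_commute)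

text \<open>\<open>r\<close> has coefficients in the closure and cannot be applied to
  \<open>f\<close>, but it can be applied to a shift, and there only its class modulo
  \<open>m\<close> counts. Evaluation at \<open>(0, 0)\<close> recovers the scalars.\<close>

lemma poly_orbit_cong:
  assumes f: "endo f" and \<chi>: "functional \<chi>" and m: "\<And>v. poly_op m f v = 0"
    and dvd: "map_poly to_ac m dvd r - map_poly to_ac q"
  shows "(\<Sum>k\<le>Polynomial.degree r. poly.coeff r k * to_ac (\<chi> ((f ^^ k) v))) = to_ac (\<chi> (poly_op q f v))"
proof -
  let ?l = "orbit_seq f \<chi> v (\<lambda>v. v)"
  have "fun_space.poly_op (map_poly to_ac m) lshift ?l = 0"
    unfolding poly_lshift_orbit[OF f \<chi>]
    by (simp add: m orbit_seq_def endo_0[OF endo_funpow[OF f]] functional_0[OF \<chi>] fun_eq_iff)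
  then have "fun_space.poly_op (r - map_poly to_ac q) lshift ?l = 0"
    by (rule fun_space.poly_op_dvd[OF endo_lshift dvd])
  then have "fun_space.poly_op r lshift ?l = fun_space.poly_op (map_poly to_ac q) lshift ?l"
    by (simp add: fun_space.poly_op_diff)
  also have "\<dots> = orbit_seq f \<chi> v (\<lambda>v. poly_op q f v)"
    by (rule poly_lshift_orbit[OF f \<chi>])
  finally have "fun_space.poly_op r lshift ?l (0, 0) = orbit_seq f \<chi> v (\<lambda>v. poly_op q f v) (0, 0)"
    by simp
  then show ?thesis
    by (simp only: fun_space_poly_op_apply lshift_funpow_orbit) (simp add: orbit_seq_def)
qed

text \<open>In coordinates: \<open>r(ad f)\<close> applied to \<open>g\<close> is the commutator of
  \<open>p(f)\<close> with \<open>g\<close>. The conditions on \<open>r\<close> sit at differences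
  of eigenvalues because the eigenvalues of \<open>ad f\<close> lie there.\<close>

lemma commutator_polynomial:
  fixes \<Lambda> :: "'a alg_closure set" and e :: nat
  assumes f: "endo f" and g: "endo g" and \<chi>: "functional \<chi>" and m: "\<And>v. poly_op m f v = 0"
    and \<Lambda>: "finite \<Lambda>" "map_poly to_ac m dvd (\<Prod>a\<in>\<Lambda>. [:-a, 1:] ^ e)"
    and p: "\<And>a. a \<in> \<Lambda> \<Longrightarrow> [:-a, 1:] ^ e dvd p - [:\<phi> a:]"
    and r: "\<And>a b. a \<in> \<Lambda> \<Longrightarrow> b \<in> \<Lambda> \<Longrightarrow> [:-(a - b), 1:] ^ (e + e) dvd r - [:\<phi> a - \<phi> b:]"
  shows "(\<Sum>k\<le>Polynomial.degree r. poly.coeff r k * to_ac (\<chi> ((commutator f ^^ k) g v))) =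
    (\<Sum>k\<le>Polynomial.degree p. poly.coeff p k * to_ac (\<chi> ((f ^^ k) (g v) - g ((f ^^ k) v))))"
proof -
  let ?l = "orbit_seq f \<chi> v g"
  have zero: "orbit_seq f \<chi> v (\<lambda>v. 0) = 0"
    by (simp add: orbit_seq_def endo_0[OF endo_funpow[OF f]] functional_0[OF \<chi>] fun_eq_iff)
  have "fun_space.poly_op (map_poly to_ac m) lshift ?l = 0"
    unfolding poly_lshift_orbit[OF f \<chi>] by (simp add: m zero)
  then have L: "fun_space.poly_op (\<Prod>a\<in>\<Lambda>. [:-a, 1:] ^ e) lshift ?l = 0"
    by (rule fun_space.poly_op_dvd[OF endo_lshift \<Lambda>(2)])
  have "fun_space.poly_op (map_poly to_ac m) rshift ?l = 0"
    unfolding poly_rshift_orbit[OF f g \<chi>] by (simp add: m zero endo_0[OF g])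
  then have R: "fun_space.poly_op (\<Prod>a\<in>\<Lambda>. [:-a, 1:] ^ e) rshift ?l = 0"
    by (rule fun_space.poly_op_dvd[OF endo_rshift \<Lambda>(2)])
  have "fun_space.poly_op r (\<lambda>l. lshift l - rshift l) ?l =
      fun_space.poly_op p lshift ?l - fun_space.poly_op p rshift ?l"
    by (rule fun_space.poly_op_difference[OF endo_lshift endo_rshift lshift_rshift \<Lambda>(1) L R p r])
  then have "fun_space.poly_op r (\<lambda>l. lshift l - rshift l) ?l (0, 0) =
      fun_space.poly_op p lshift ?l (0, 0) - fun_space.poly_op p rshift ?l (0, 0)"
    by simp
  then show ?thesis
    by (simp only: fun_space_poly_op_apply lshift_funpow_orbit rshift_funpow_orbit shift_diff_orbit[OF f \<chi>])
      (simp add: orbit_seq_def functional_diff[OF \<chi>] sum_subtractf right_diff_distrib)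
qed

lemma coordinates_eqI:
  assumes "\<And>\<chi>. functional \<chi> \<Longrightarrow> \<chi> u = \<chi> w"
  shows "u = w"
proof -
  have "representation Basis u b = representation Basis w b" for b
    using assms[OF functional_coordinate] .
  then have "(\<Sum>b\<in>Basis. scale (representation Basis u b) b) = (\<Sum>b\<in>Basis. scale (representation Basis w b) b)"
    by simp
  then show ?thesis
    using sum_representation_eq[OF independent_Basis _ finite_Basis order_refl] span_Basis by simp
qed

section \<open>The Jordan decomposition and its adjoint action\<close>

text \<open>The Bezout identity at \<open>a\<close> shows that the root is simple:
  \<open>M = (X - a) G\<close> with \<open>G(a)\<close> nonzero. In
  \<open>M(q) = (q - a) G(q)\<close> the second factor is invertible modulo powers of
  \<open>X - a\<close>, so the first one carries the whole power.\<close>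

lemma separable_eigenvalue_lift:
  fixes M :: "'k::field_char_0 poly" and a :: "'k alg_closure"
  assumes "separable M" and root: "poly (map_poly to_ac M) a = 0"
    and q: "M dvd q - [:0, 1:]" "M ^ N dvd M \<circ>\<^sub>p q"
  shows "[:-a, 1:] ^ N dvd map_poly to_ac q - [:a:]"
proof -
  let ?H = "map_poly to_ac :: 'k poly \<Rightarrow> 'k alg_closure poly"
  obtain u v where "u * M + v * pderiv M = 1"
    using assms(1) separable_def by blast
  then have "?H (u * M + v * pderiv M) = ?H 1" by simp
  then have uv: "?H u * ?H M + ?H v * pderiv (?H M) = 1"
    by (simp only: map_to_ac_add map_to_ac_mult map_to_ac_pderiv map_to_ac_1)
  have lin: "[:-a, 1:] dvd ?H M"
    using root by (simp add: poly_eq_0_iff_dvd)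
  then obtain G where G: "?H M = [:-a, 1:] * G"
    by (elim dvdE)
  have "poly (pderiv (?H M)) a = poly G a"
    by (simp only: G pderiv_mult) (simp add: pderiv_pCons)
  then have "poly (?H v) a * poly G a = 1"
    using arg_cong[OF uv, of "\<lambda>p. poly p a"] root by simp
  then have Ga: "poly G a \<noteq> 0" by auto
  have "?H M dvd ?H q - [:0, 1:]"
    using map_to_ac_dvd[OF q(1)] by (simp add: map_to_ac_diff map_to_ac_pCons)
  then have "[:-a, 1:] dvd ?H q - [:0, 1:]"
    using lin dvd_trans by blast
  then have qa: "poly (?H q) a = a"
    by (simp add: poly_eq_0_iff_dvd[symmetric])
  let ?K = "G \<circ>\<^sub>p ?H q"
  have comp: "?H M \<circ>\<^sub>p ?H q = (?H q - [:a:]) * ?K"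
    by (simp only: G pcompose_mult) (simp add: pcompose_pCons)
  have "[:-a, 1:] ^ N dvd ?H M ^ N"
    using lin by (rule dvd_power_same)
  also have "\<dots> dvd ?H M \<circ>\<^sub>p ?H q"
    using map_to_ac_dvd[OF q(2)] by (simp add: map_to_ac_power map_to_ac_pcompose)
  finally have 1: "[:-a, 1:] ^ N dvd (?H q - [:a:]) * ?K"
    by (simp only: comp)
  have "poly ?K a \<noteq> 0"
    using Ga qa by (simp add: poly_pcompose)
  then obtain h where h: "[:-a, 1:] ^ N dvd ?K * h - 1"
    using inverse_mod_linear_power by blast
  have "?H q - [:a:] = (?H q - [:a:]) * ?K * h - (?H q - [:a:]) * (?K * h - 1)"
    by (simp only: right_diff_distrib mult.assoc mult_1_right) simp
  moreover have "[:-a, 1:] ^ N dvd (?H q - [:a:]) * ?K * h - (?H q - [:a:]) * (?K * h - 1)"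
    by (rule dvd_diff[OF dvd_mult2[OF 1] dvd_mult[OF h]])
  ultimately show ?thesis by simp
qed

text \<open>One \<open>p\<close> must yield both the semisimple part of \<open>f\<close> and, from
  \<open>ad f\<close>, its adjoint action. Newton's \<open>q\<close> is built for the first task
  only; so \<open>r\<close> is interpolated over the closure for both tasks and its coefficients are
  retracted to \<open>F\<close>.\<close>

theorem jordan_polynomial:
  assumes f: "endo f"
  shows "\<exists>p M. poly.coeff p 0 = 0 \<and> separable M \<and> (\<forall>v. poly_op M (poly_op p f) v = 0) \<and>
    nilpotent_op (\<lambda>v. f v - poly_op p f v) \<and>
    (\<forall>g v. endo g \<longrightarrow> (\<Sum>k\<le>Polynomial.degree p. scale (poly.coeff p k) ((commutator f ^^ k) g v)) =
      poly_op p f (g v) - g (poly_op p f v))"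
proof -
  let ?H = "map_poly to_ac :: 'a poly \<Rightarrow> 'a alg_closure poly"
  obtain m where m: "m \<noteq> 0" "\<And>v. poly_op m f v = 0"
    using annihilator_exists[OF f] by blast
  obtain M e where M: "M \<noteq> 0" "m dvd M ^ e" "separable M"
    using separable_radical_exists[OF m(1)] by blast
  define E where "E = Suc (Polynomial.degree m)"
  \<comment> \<open>The summand \<open>e\<close> makes \<open>m\<close> divide \<open>M(q)\<close>;
    the summand \<open>E\<close> gives \<open>q\<close> the residue \<open>a\<close> to order
    \<open>E\<close> at every eigenvalue \<open>a\<close>.\<close>
  obtain q where q: "M dvd q - [:0, 1:]" "M ^ (e + E) dvd M \<circ>\<^sub>p q"
    using newton_lift[OF M(3), of "e + E"] by blast
  define s where "s = poly_op q f"
  have Ms: "poly_op M s v = 0" for v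
  proof -
    have "m dvd M ^ (e + E)"
      using M(2) by (simp add: power_add)
    then have "m dvd M \<circ>\<^sub>p q"
      using q(2) by (rule dvd_trans)
    then have "poly_op (M \<circ>\<^sub>p q) f v = 0"
      by (rule poly_op_dvd[OF f _ m(2)])
    then show ?thesis
      by (simp add: s_def poly_op_pcompose[OF f])
  qed
  have nil: "((\<lambda>v. f v - s v) ^^ e) v = 0" for v
  proof -
    have "M dvd [:0, 1:] - q"
      using q(1) by (simp add: dvd_diff_commute)
    then have "m dvd ([:0, 1:] - q) ^ e"
      using M(2) by (meson dvd_power_same dvd_trans)
    then have "poly_op (([:0, 1:] - q) ^ e) f v = 0"
      by (rule poly_op_dvd[OF f _ m(2)])
    moreover have "poly_op ([:0, 1:] - q) f = (\<lambda>v. f v - s v)"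
      by (rule ext) (simp add: poly_op_diff s_def)
    ultimately show ?thesis
      by (simp only: poly_op_power[OF f])
  qed
  define \<Lambda> where "\<Lambda> = {a. poly (?H m) a = 0}"
  have Hm: "?H m \<noteq> 0"
    using m(1) by (simp add: map_to_ac_eq_0)
  have fin: "finite \<Lambda>"
    unfolding \<Lambda>_def using Hm by (rule poly_roots_finite)
  have Hdvd: "?H m dvd (\<Prod>a\<in>\<Lambda>. [:-a, 1:] ^ E)"
    using dvd_root_powers[OF Hm] by (simp add: \<Lambda>_def E_def)
  have qa: "[:-a, 1:] ^ E dvd ?H q - [:a:]" if "a \<in> \<Lambda>" for a
  proof -
    have "[:-a, 1:] dvd ?H m"
      using that by (simp add: \<Lambda>_def poly_eq_0_iff_dvd)
    also have "\<dots> dvd ?H M ^ e"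
      using map_to_ac_dvd[OF M(2)] by (simp add: map_to_ac_power)
    finally have "poly (?H M) a = 0"
      by (simp add: poly_eq_0_iff_dvd[symmetric])
    then have "[:-a, 1:] ^ (e + E) dvd ?H q - [:a:]"
      by (rule separable_eigenvalue_lift[OF M(3) _ q])
    then show ?thesis
      by (simp only: power_add) (rule dvd_mult_right)
  qed
  \<comment> \<open>Differences serve \<open>ad f\<close>, the eigenvalues themselves make
    \<open>r\<close> agree with \<open>q\<close> modulo \<open>m\<close>, and 0 removes the constant
    term.\<close>
  define \<Gamma> where "\<Gamma> = (\<lambda>x. fst x - snd x) ` (\<Lambda> \<times> \<Lambda>) \<union> \<Lambda> \<union> {0}"
  have "finite \<Gamma>"
    unfolding \<Gamma>_def using fin by simp
  from poly_interpolate_mod[OF this, of "E + E" "\<lambda>x. x"]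
  obtain r where r: "\<And>a. a \<in> \<Gamma> \<Longrightarrow> [:-a, 1:] ^ (E + E) dvd r - [:a:]"
    by blast
  have r_diff: "[:-(a - b), 1:] ^ (E + E) dvd r - [:a - b:]" if "a \<in> \<Lambda>" "b \<in> \<Lambda>" for a b
    by (rule r) (use that in \<open>auto simp: \<Gamma>_def intro!: image_eqI[of _ _ "(a, b)"]\<close>)
  have "[:-0, 1:] ^ (E + E) dvd r - [:0:]"
    by (rule r) (simp add: \<Gamma>_def)
  then have "[:-0, 1:] dvd r"
    by (simp add: E_def dvd_mult_left)
  then have r0: "poly.coeff r 0 = 0"
    by (simp only: poly_eq_0_iff_dvd[symmetric] poly_0_coeff_0)
  have rq: "?H m dvd r - ?H q"
  proof -
    have "[:-a, 1:] ^ E dvd r - ?H q" if "a \<in> \<Lambda>" for a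
    proof -
      have "[:-a, 1:] ^ (E + E) dvd r - [:a:]"
        by (rule r) (use that in \<open>simp add: \<Gamma>_def\<close>)
      then have "[:-a, 1:] ^ E dvd r - [:a:]"
        by (simp only: power_add) (rule dvd_mult_right)
      then have "[:-a, 1:] ^ E dvd (r - [:a:]) - (?H q - [:a:])"
        using qa[OF that] by (rule dvd_diff)
      then show ?thesis by simp
    qed
    then have "(\<Prod>a\<in>\<Lambda>. [:-a, 1:] ^ E) dvd r - ?H q"
      by (rule linear_powers_dvd[OF fin])
    with Hdvd show ?thesis by (rule dvd_trans)
  qed
  \<comment> \<open>The identities for \<open>r\<close> are linear in its coefficients with all
    other data from \<open>F\<close>, so they survive \<open>\<pi>\<close>.\<close>
  obtain \<pi> :: "'a alg_closure \<Rightarrow> 'a" where \<pi>: "\<And>x y. \<pi> (x + y) = \<pi> x + \<pi> y"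
      "\<And>c x. \<pi> (to_ac c * x) = c * \<pi> x" "\<pi> 1 = 1"
    using field_hom_retraction[of "to_ac :: 'a \<Rightarrow> 'a alg_closure" 1, OF to_ac_add to_ac_mult to_ac_1] by auto
  have \<pi>0: "\<pi> 0 = 0" using \<pi>(2)[of 0 0] by simp
  have \<pi>_ac: "\<pi> (to_ac c) = c" for c using \<pi>(2)[of c 1] \<pi>(3) by simp
  have \<pi>_sum: "\<pi> (\<Sum>k\<in>A. c k * to_ac (d k)) = (\<Sum>k\<in>A. \<pi> (c k) * d k)" for A :: "nat set" and c d
    by (induction A rule: infinite_finite_induct) (simp_all add: \<pi>0 \<pi>(1) \<pi>(2) mult.commute[of "c _"] mult.commute[of _ "d _"])
  define p where "p = map_poly \<pi> r"
  have coeff_p: "poly.coeff p k = \<pi> (poly.coeff r k)" for k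
    by (simp add: p_def coeff_map_poly \<pi>0)
  have deg_p: "Polynomial.degree p \<le> Polynomial.degree r"
    by (rule degree_le) (simp add: coeff_p coeff_eq_0 \<pi>0)
  have ps: "poly_op p f = s"
  proof (rule ext, rule coordinates_eqI)
    fix v \<chi> assume \<chi>: "functional \<chi>"
    have "\<chi> (poly_op p f v) = (\<Sum>k\<le>Polynomial.degree r. \<pi> (poly.coeff r k) * \<chi> ((f ^^ k) v))"
      by (simp add: poly_op_altdef[OF deg_p] functional_sum[OF \<chi>] coeff_p)
    also have "\<dots> = \<pi> (to_ac (\<chi> (poly_op q f v)))"
      by (simp only: \<pi>_sum[symmetric] poly_orbit_cong[OF f \<chi> m(2) rq])
    finally show "\<chi> (poly_op p f v) = \<chi> (s v)"
      by (simp add: \<pi>_ac s_def)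
  qed
  have ad: "(\<Sum>k\<le>Polynomial.degree p. scale (poly.coeff p k) ((commutator f ^^ k) g v)) = s (g v) - g (s v)"
    if g: "endo g" for g v
  proof (rule coordinates_eqI)
    fix \<chi> assume \<chi>: "functional \<chi>"
    have "(\<Sum>k\<le>Polynomial.degree p. scale (poly.coeff p k) ((commutator f ^^ k) g v)) =
        (\<Sum>k\<le>Polynomial.degree r. scale (poly.coeff p k) ((commutator f ^^ k) g v))"
      by (rule sum.mono_neutral_left) (use deg_p in \<open>auto simp: coeff_eq_0\<close>)
    then have "\<chi> (\<Sum>k\<le>Polynomial.degree p. scale (poly.coeff p k) ((commutator f ^^ k) g v)) =
        (\<Sum>k\<le>Polynomial.degree r. \<pi> (poly.coeff r k) * \<chi> ((commutator f ^^ k) g v))"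
      by (simp add: functional_sum[OF \<chi>] coeff_p)
    also have "\<dots> = \<pi> (\<Sum>k\<le>Polynomial.degree (?H q). poly.coeff (?H q) k * to_ac (\<chi> ((f ^^ k) (g v) - g ((f ^^ k) v))))"
      by (simp only: \<pi>_sum[symmetric] commutator_polynomial[OF f g \<chi> m(2) fin Hdvd qa r_diff])
    also have "\<dots> = (\<Sum>k\<le>Polynomial.degree q. poly.coeff q k * \<chi> ((f ^^ k) (g v) - g ((f ^^ k) v)))"
      by (simp add: \<pi>_sum \<pi>_ac)
    also have "\<dots> = \<chi> (s (g v) - g (s v))"
      by (simp add: s_def poly_op_def functional_diff[OF \<chi>] functional_sum[OF \<chi>] endo_sum[OF g] endo_scale[OF g]
          right_diff_distrib sum_subtractf)
    finally show "\<chi> (\<Sum>k\<le>Polynomial.degree p. scale (poly.coeff p k) ((commutator f ^^ k) g v)) = \<chi> (s (g v) - g (s v))" .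
  qed
  have "poly.coeff p 0 = 0" by (simp add: coeff_p r0 \<pi>0)
  then show ?thesis
    by (intro exI[of _ p] exI[of _ M]) (use M(3) Ms nil ad in \<open>auto simp: ps\<close>)
qed

section \<open>Trace criteria for nilpotency\<close>

lemma tr_nilpotent: "endo f \<Longrightarrow> nilpotent_op f \<Longrightarrow> tr f = 0"
  using trace_on_nilpotent[OF fin_dim_UNIV] by auto

lemma tr_cong: "(\<And>v. f v = g v) \<Longrightarrow> tr f = tr g"
  by (rule trace_on_cong[OF fin_dim_UNIV])

lemma tr_commute: "endo f \<Longrightarrow> endo g \<Longrightarrow> tr (\<lambda>v. f (g v)) = tr (\<lambda>v. g (f v))"
  by (rule trace_on_commute[OF fin_dim_UNIV]) simp_all

lemma tr_diff: "endo f \<Longrightarrow> endo g \<Longrightarrow> tr (\<lambda>v. f v - g v) = tr f - tr g"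
  by (rule trace_on_diff[OF fin_dim_UNIV]) simp_all

lemma tr_add: "endo f \<Longrightarrow> endo g \<Longrightarrow> tr (\<lambda>v. f v + g v) = tr f + tr g"
  by (rule trace_on_add[OF fin_dim_UNIV]) simp_all

lemma tr_scale: "endo f \<Longrightarrow> tr (\<lambda>v. scale c (f v)) = c * tr f"
  by (rule trace_on_scale[OF fin_dim_UNIV]) simp_all

lemma tr_sum: "finite I \<Longrightarrow> (\<And>i. i \<in> I \<Longrightarrow> endo (f i)) \<Longrightarrow> tr (\<lambda>v. \<Sum>i\<in>I. f i v) = (\<Sum>i\<in>I. tr (f i))"
  using trace_on_sum[OF fin_dim_UNIV, of I f "\<lambda>_. 1"] by simp

text \<open>The Fitting idempotent is a polynomial in \<open>f\<close> without constant term, so its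
  trace vanishes; that trace is the dimension of the part on which \<open>f\<close> is
  bijective.\<close>

lemma nilpotent_if_traces_zero:
  assumes f: "endo f" and "\<And>k. tr (f ^^ Suc k) = 0"
  shows "nilpotent_op f"
proof -
  obtain E k where E: "poly.coeff E 0 = 0" "\<And>v. poly_op E f (poly_op E f v) = poly_op E f v"
    "\<And>v. (f ^^ k) (v - poly_op E f v) = 0"
    using fitting_polynomial[OF f] by metis
  have "poly.coeff E i * tr (f ^^ i) = 0" for i
    using E(1) assms(2)[of "i - 1"] by (cases i) auto
  then have "tr (poly_op E f) = 0"
    unfolding trace_poly_op[OF f] by (intro sum.neutral ballI)
  moreover have "tr (poly_op E f) = of_nat (dim (range (poly_op E f)))"
    using E(2) by (intro trace_on_idempotent fin_dim_UNIV endo_poly_op f) auto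
  ultimately have "dim (range (poly_op E f)) = 0"
    by simp
  then have "poly_op E f v = 0" for v
    unfolding dim_eq_0 by blast
  then have "(f ^^ k) v = 0" for v
    using E(3)[of v] by simp
  then show ?thesis by blast
qed

text \<open>The dual of the space extended to the closure, realized as the \<open>F\<close>-linear
  maps into the closure. Endomorphisms act by their transposes \<open>pull g\<close>, which keep the
  trace.\<close>

definition dual :: "('b \<Rightarrow> 'a alg_closure) set" where
  "dual = {\<chi>. (\<forall>x y. \<chi> (x + y) = \<chi> x + \<chi> y) \<and> (\<forall>c x. \<chi> (scale c x) = to_ac c * \<chi> x)}"

definition dual_coord :: "'b \<Rightarrow> 'b \<Rightarrow> 'a alg_closure" where
  "dual_coord b = (\<lambda>v. to_ac (representation Basis v b))"

definition pull :: "('b \<Rightarrow> 'b) \<Rightarrow> ('b \<Rightarrow> 'k) \<Rightarrow> 'b \<Rightarrow> 'k" where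
  "pull g \<chi> = (\<lambda>v. \<chi> (g v))"

lemma dual_coord_in_dual: "dual_coord b \<in> dual"
  using independent_Basis span_Basis
  by (simp add: dual_def dual_coord_def representation_add representation_scale)

lemma dual_coord_basis: "b \<in> Basis \<Longrightarrow> c \<in> Basis \<Longrightarrow> dual_coord b c = (if b = c then 1 else 0)"
  by (simp add: dual_coord_def representation_basis[OF independent_Basis])

lemma dual_0: "\<chi> \<in> dual \<Longrightarrow> \<chi> 0 = 0"
  unfolding dual_def mem_Collect_eq by (metis scale_zero_left mult_zero_left to_ac_0)

lemma dual_sum: "\<chi> \<in> dual \<Longrightarrow> \<chi> (\<Sum>i\<in>A. scale (c i) (F i)) = (\<Sum>i\<in>A. to_ac (c i) * \<chi> (F i))"
  by (induction A rule: infinite_finite_induct) (simp_all add: dual_0, simp add: dual_def)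

lemma basis_expand: "(\<Sum>b\<in>Basis. scale (representation Basis v b) b) = v"
  by (rule sum_representation_eq[OF independent_Basis _ finite_Basis order_refl]) (simp add: span_Basis)

lemma dual_expand:
  assumes "\<chi> \<in> dual"
  shows "\<chi> = (\<Sum>b\<in>Basis. fscale (\<chi> b) (dual_coord b))"
proof
  fix v
  have "\<chi> (\<Sum>b\<in>Basis. scale (representation Basis v b) b) = (\<Sum>b\<in>Basis. fscale (\<chi> b) (dual_coord b)) v"
    unfolding dual_sum[OF assms] by (simp add: sum_fun_apply fscale_def dual_coord_def mult.commute)
  then show "\<chi> v = (\<Sum>b\<in>Basis. fscale (\<chi> b) (dual_coord b)) v"
    by (simp only: basis_expand)
qed

lemma dual_coord_inj: "inj_on dual_coord Basis"
proof (rule inj_onI)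
  fix b c assume bc: "b \<in> Basis" "c \<in> Basis" "dual_coord b = dual_coord c"
  then have "dual_coord c b = 1"
    using dual_coord_basis[of b b] by simp
  then show "b = c"
    using bc dual_coord_basis[of c b] by (simp split: if_splits)
qed

lemma dual_coord_sum_apply:
  "c \<in> Basis \<Longrightarrow> (\<Sum>\<chi>\<in>dual_coord ` Basis. fscale (u \<chi>) \<chi>) c = u (dual_coord c)"
  by (simp add: sum.reindex[OF dual_coord_inj] sum_fun_apply fscale_def dual_coord_basis
      if_distrib[of "\<lambda>x. _ * x"] sum.delta' finite_Basis cong: if_cong)

lemma dual_basis:
  "finite (dual_coord ` Basis)" "fun_space.independent (dual_coord ` Basis)"
  "fun_space.span (dual_coord ` Basis) = dual"
proof -
  show fin: "finite (dual_coord ` Basis)"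
    using finite_Basis by simp
  have "\<forall>\<chi>\<in>dual_coord ` Basis. u \<chi> = 0" if "(\<Sum>\<chi>\<in>dual_coord ` Basis. fscale (u \<chi>) \<chi>) = 0" for u
    using dual_coord_sum_apply[of _ u] that by auto
  then show "fun_space.independent (dual_coord ` Basis)"
    by (simp only: fun_space.dependent_finite[OF fin]) blast
  have sub: "fun_space.subspace dual"
    by (simp add: fun_space.subspace_def dual_def fscale_def distrib_left)
  show "fun_space.span (dual_coord ` Basis) = dual"
  proof
    show "fun_space.span (dual_coord ` Basis) \<subseteq> dual"
      by (rule fun_space.span_minimal[OF _ sub]) (use dual_coord_in_dual in blast)
    show "dual \<subseteq> fun_space.span (dual_coord ` Basis)"
    proof
      fix \<chi> assume "\<chi> \<in> dual"
      have "(\<Sum>b\<in>Basis. fscale (\<chi> b) (dual_coord b)) \<in> fun_space.span (dual_coord ` Basis)"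
        by (intro fun_space.span_sum fun_space.span_scale fun_space.span_base imageI)
      then show "\<chi> \<in> fun_space.span (dual_coord ` Basis)"
        using dual_expand[OF \<open>\<chi> \<in> dual\<close>] by simp
    qed
  qed
qed

lemma fin_dim_dual: "fun_space.fin_dim dual"
  unfolding fun_space.fin_dim_def using dual_basis by blast

lemma endo_pull: "fun_space.endo (pull g)"
  by (simp add: fun_space.endo_def pull_def fscale_def fun_eq_iff)

lemma pull_dual: "endo g \<Longrightarrow> pull g ` dual \<subseteq> dual"
  by (auto simp: pull_def dual_def endo_add endo_scale)

lemma pull_funpow: "pull f ^^ k = pull (f ^^ k)"
  by (induction k) (simp_all add: pull_def fun_eq_iff funpow_swap1)

lemma dual_representation:
  assumes "\<chi> \<in> dual" "b \<in> Basis"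
  shows "fun_space.representation (dual_coord ` Basis) \<chi> (dual_coord b) = \<chi> b"
proof -
  have "(\<Sum>c\<in>dual_coord ` Basis. fscale (fun_space.representation (dual_coord ` Basis) \<chi> c) c) = \<chi>"
    by (rule fun_space.sum_representation_eq) (use dual_basis assms in auto)
  then have "(\<Sum>c\<in>dual_coord ` Basis. fscale (fun_space.representation (dual_coord ` Basis) \<chi> c) c) b = \<chi> b"
    by simp
  then show ?thesis
    by (simp only: dual_coord_sum_apply[OF assms(2)])
qed

lemma trace_pull:
  assumes "endo g"
  shows "fun_space.trace_on dual (pull g) = to_ac (tr g)"
proof -
  have "fun_space.trace_on dual (pull g) = fun_space.trace_basis (dual_coord ` Basis) (pull g)"
    by (rule fun_space.trace_on_eq[OF dual_basis endo_pull pull_dual[OF assms]])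
  also have "\<dots> = (\<Sum>b\<in>Basis. pull g (dual_coord b) b)"
    unfolding fun_space.trace_basis_def sum.reindex[OF dual_coord_inj] comp_apply
    by (rule sum.cong[OF refl], rule dual_representation)
      (use pull_dual[OF assms] dual_coord_in_dual in auto)
  also have "\<dots> = to_ac (tr g)"
    by (simp add: tr_def[OF assms] to_ac_sum pull_def dual_coord_def)
  finally show ?thesis .
qed

lemma poly_pull:
  assumes "endo f" "\<chi> \<in> dual"
  shows "fun_space.poly_op (map_poly to_ac P) (pull f) \<chi> = (\<lambda>v. \<chi> (poly_op P f v))"
  by (rule ext) (simp add: fun_space_poly_op_apply pull_funpow pull_def poly_op_def dual_sum[OF assms(2)])

lemma trace_poly_pull:
  assumes f: "endo f" and n: "Polynomial.degree P \<le> n"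
  shows "fun_space.trace_on dual (fun_space.poly_op P (pull f)) = (\<Sum>k\<le>n. poly.coeff P k * to_ac (tr (f ^^ k)))"
proof -
  have "fun_space.trace_on dual (fun_space.poly_op P (pull f)) =
      (\<Sum>k\<le>Polynomial.degree P. poly.coeff P k * to_ac (tr (f ^^ k)))"
    unfolding fun_space.trace_on_poly_op[OF fin_dim_dual endo_pull pull_dual[OF f]] pull_funpow
    by (simp only: trace_pull[OF endo_funpow[OF f]])
  also have "\<dots> = (\<Sum>k\<le>n. poly.coeff P k * to_ac (tr (f ^^ k)))"
    by (rule sum.mono_neutral_left) (use n in \<open>auto simp: coeff_eq_0\<close>)
  finally show ?thesis .
qed

text \<open>The multiplicities \<open>d a\<close> are the dimensions of the generalized eigenspaces of \<open>f\<close> on the dual space.\<close>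

lemma trace_multiplicities:
  fixes m :: "'a poly"
  assumes f: "endo f" and m: "m \<noteq> 0" "\<And>v. poly_op m f v = 0"
  defines "\<Lambda> \<equiv> {a. poly (map_poly to_ac m) a = 0}" and "e \<equiv> Suc (Polynomial.degree m)"
  shows "\<exists>d :: 'a alg_closure \<Rightarrow> nat.
    (\<forall>p \<phi>. (\<forall>a\<in>\<Lambda>. [:-a, 1:] ^ e dvd p - [:\<phi> a:]) \<longrightarrow>
      (\<Sum>k\<le>Polynomial.degree p. poly.coeff p k * to_ac (tr (f ^^ Suc k))) = (\<Sum>a\<in>\<Lambda>. (a * \<phi> a) * of_nat (d a))) \<and>
    ((\<forall>a\<in>\<Lambda>. a \<noteq> 0 \<longrightarrow> d a = 0) \<longrightarrow> nilpotent_op f)"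
proof -
  let ?H = "map_poly to_ac :: 'a poly \<Rightarrow> 'a alg_closure poly"
  define G where "G = (\<Prod>a\<in>\<Lambda>. [:-a, 1:] ^ e)"
  let ?S = "pull f :: ('b \<Rightarrow> 'a alg_closure) \<Rightarrow> _"
  let ?op = "\<lambda>P. fun_space.poly_op P ?S"
  note S = endo_pull[of f] and Sd = pull_dual[OF f]
  have Hm: "?H m \<noteq> 0"
    using m(1) by (simp add: map_to_ac_eq_0)
  have fin: "finite \<Lambda>"
    unfolding \<Lambda>_def using Hm by (rule poly_roots_finite)
  have Hdvd: "?H m dvd G"
    using dvd_root_powers[OF Hm] by (simp add: \<Lambda>_def e_def G_def)
  have kill: "?op P \<chi> = 0" if "G dvd P" "\<chi> \<in> dual" for P \<chi>
  proof -
    have "?op (?H m) \<chi> = 0"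
      unfolding poly_pull[OF f that(2)] by (simp add: m(2) dual_0[OF that(2)] fun_eq_iff)
    then show ?thesis
      by (rule fun_space.poly_op_dvd[OF S dvd_trans[OF Hdvd that(1)]])
  qed
  have inv: "?op P ` dual \<subseteq> dual" for P
    using fun_space.poly_op_invariant[OF fun_space.fin_dim_subspace[OF fin_dim_dual] Sd] by blast
  obtain q where q: "\<And>a. a \<in> \<Lambda> \<Longrightarrow> G dvd [:-a, 1:] ^ e * q a" "G dvd (\<Sum>a\<in>\<Lambda>. q a) - 1"
      "\<And>a. a \<in> \<Lambda> \<Longrightarrow> G dvd q a * q a - q a"
    using primary_idempotents[OF fin, of e] unfolding G_def by blast
  define d where "d a = fun_space.dim (?op (q a) ` dual)" for a
  have tq: "fun_space.trace_on dual (?op (q a)) = of_nat (d a)" if "a \<in> \<Lambda>" for a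
    unfolding d_def
  proof (rule fun_space.trace_on_idempotent[OF fin_dim_dual fun_space.endo_poly_op[OF S] inv])
    fix \<chi> assume "\<chi> \<in> dual"
    then have "?op (q a * q a - q a) \<chi> = 0"
      using kill[OF q(3)[OF that]] by blast
    then show "?op (q a) (?op (q a) \<chi>) = ?op (q a) \<chi>"
      by (simp add: fun_space.poly_op_diff fun_space.poly_op_mult[OF S])
  qed
  have main: "(\<Sum>k\<le>Polynomial.degree p. poly.coeff p k * to_ac (tr (f ^^ Suc k))) = (\<Sum>a\<in>\<Lambda>. (a * \<phi> a) * of_nat (d a))"
    if p: "\<And>a. a \<in> \<Lambda> \<Longrightarrow> [:-a, 1:] ^ e dvd p - [:\<phi> a:]" for p \<phi>
  proof -
    \<comment> \<open>\<open>?P\<close> is \<open>X p\<close>, because the traces to be computed are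
      those of \<open>f p(f)\<close>.\<close>
    let ?P = "pCons 0 p"
    have part: "fun_space.trace_on dual (?op (?P * q a)) = (a * \<phi> a) * of_nat (d a)" if a: "a \<in> \<Lambda>" for a
    proof -
      let ?c = "a * \<phi> a"
      \<comment> \<open>On the part cut out by \<open>q a\<close>, the polynomial \<open>?P\<close>
        acts as the scalar \<open>?c\<close> plus the nilpotent \<open>?N\<close>, which has trace
        zero.\<close>
      let ?N = "(?P - [:?c:]) * q a"
      have "[:-a, 1:] dvd [:-a, 1:] ^ e"
        by (simp only: e_def power_Suc dvd_triv_left)
      then have "[:-a, 1:] dvd p - [:\<phi> a:]"
        using p[OF a] by (rule dvd_trans)
      then have "poly p a = \<phi> a"
        by (simp add: poly_eq_0_iff_dvd[symmetric])
      then have "[:-a, 1:] dvd ?P - [:?c:]"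
        by (simp add: poly_eq_0_iff_dvd[symmetric])
      then have "[:-a, 1:] ^ e dvd (?P - [:?c:]) ^ e"
        by (rule dvd_power_same)
      moreover have "q a dvd q a ^ e"
        by (simp only: e_def power_Suc dvd_triv_left)
      ultimately have "[:-a, 1:] ^ e * q a dvd (?P - [:?c:]) ^ e * q a ^ e"
        by (rule mult_dvd_mono)
      then have "G dvd ?N ^ e"
        unfolding power_mult_distrib by (rule dvd_trans[OF q(1)[OF a]])
      then have "(?op ?N ^^ e) \<chi> = 0" if "\<chi> \<in> dual" for \<chi>
        using kill that by (simp only: fun_space.poly_op_power[OF S, symmetric])
      then have N: "fun_space.trace_on dual (?op ?N) = 0"
        by (rule fun_space.trace_on_nilpotent[OF fin_dim_dual fun_space.endo_poly_op[OF S] inv])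
      have "?P * q a = smult ?c (q a) + ?N"
        by (simp only: left_diff_distrib) simp
      then have "?op (?P * q a) = (\<lambda>\<chi>. ?op (smult ?c (q a)) \<chi> + ?op ?N \<chi>)"
        by (simp only: fun_space.poly_op_add[abs_def])
      then have "fun_space.trace_on dual (?op (?P * q a)) =
          fun_space.trace_on dual (?op (smult ?c (q a))) + fun_space.trace_on dual (?op ?N)"
        by (simp only: fun_space.trace_on_add[OF fin_dim_dual fun_space.endo_poly_op[OF S] inv fun_space.endo_poly_op[OF S] inv])
      also have "fun_space.trace_on dual (?op (smult ?c (q a))) = ?c * fun_space.trace_on dual (?op (q a))"
        unfolding fun_space.poly_op_smult[abs_def]
        by (rule fun_space.trace_on_scale[OF fin_dim_dual fun_space.endo_poly_op[OF S] inv])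
      finally show ?thesis
        by (simp only: N tq[OF a] add_0_right)
    qed
    have "fun_space.trace_on dual (?op ?P) = (\<Sum>k\<le>Suc (Polynomial.degree p). poly.coeff ?P k * to_ac (tr (f ^^ k)))"
      by (rule trace_poly_pull[OF f]) (rule degree_pCons_le)
    also have "\<dots> = (\<Sum>k\<le>Polynomial.degree p. poly.coeff p k * to_ac (tr (f ^^ Suc k)))"
      by (simp add: sum.atMost_Suc_shift del: sum.atMost_Suc funpow.simps)
    finally have 1: "fun_space.trace_on dual (?op ?P) = \<dots>" .
    have "?op ?P \<chi> = (\<Sum>a\<in>\<Lambda>. fscale 1 (?op (?P * q a) \<chi>))" if "\<chi> \<in> dual" for \<chi>
    proof -
      have "G dvd ?P * ((\<Sum>a\<in>\<Lambda>. q a) - 1)"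
        using q(2) by (rule dvd_mult)
      then have "?op (?P * ((\<Sum>a\<in>\<Lambda>. q a) - 1)) \<chi> = 0"
        using that by (rule kill)
      moreover have "?P * ((\<Sum>a\<in>\<Lambda>. q a) - 1) = (\<Sum>a\<in>\<Lambda>. ?P * q a) - ?P"
        by (simp only: right_diff_distrib sum_distrib_left mult_1_right)
      moreover have "?op (\<Sum>a\<in>\<Lambda>. R a) \<chi> = (\<Sum>a\<in>\<Lambda>. ?op (R a) \<chi>)" for R
        using fin by induction (simp_all only: sum.insert sum.empty fun_space.poly_op_add fun_space.poly_op_0 not_False_eq_True)
      ultimately show ?thesis
        by (simp only: fun_space.poly_op_diff fun_space.scale_one right_minus_eq)
    qed
    then have "fun_space.trace_on dual (?op ?P) = fun_space.trace_on dual (\<lambda>\<chi>. \<Sum>a\<in>\<Lambda>. fscale 1 (?op (?P * q a) \<chi>))"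
      by (rule fun_space.trace_on_cong[OF fin_dim_dual])
    also have "\<dots> = (\<Sum>a\<in>\<Lambda>. 1 * fun_space.trace_on dual (?op (?P * q a)))"
      by (rule fun_space.trace_on_sum[OF fin_dim_dual fin fun_space.endo_poly_op[OF S] inv])
    also have "\<dots> = (\<Sum>a\<in>\<Lambda>. (a * \<phi> a) * of_nat (d a))"
      by (rule sum.cong[OF refl]) (simp only: part mult_1_left)
    finally show ?thesis
      using 1 by simp
  qed
  have nil: "nilpotent_op f" if d0: "\<And>a. a \<in> \<Lambda> \<Longrightarrow> a \<noteq> 0 \<Longrightarrow> d a = 0"
  proof -
    have "(?S ^^ e) \<chi> = 0" if \<chi>: "\<chi> \<in> dual" for \<chi>
    proof -
      \<comment> \<open>The part for a nonzero eigenvalue is zero by assumption, and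
        \<open>X^e\<close> kills the part for 0.\<close>
      have each: "?op ([:0, 1:] ^ e * q a) \<chi> = 0" if a: "a \<in> \<Lambda>" for a
      proof (cases "a = 0")
        case True
        then show ?thesis
          using kill[OF q(1)[OF a] \<chi>] by simp
      next
        case False
        have "fun_space.fin_dim (?op (q a) ` dual)"
          using inv fun_space.endo_image_subspace[OF fun_space.endo_poly_op[OF S]]
            fun_space.fin_dim_subspace[OF fin_dim_dual]
          by (intro fun_space.fin_dim_subset[OF fin_dim_dual]) auto
        then obtain B where B: "finite B" "fun_space.independent B" "fun_space.span B = ?op (q a) ` dual"
          using fun_space.fin_dim_def by blast
        have "card B = 0"
          using d0[OF a False] fun_space.dim_span_eq_card_independent[OF B(2)] by (simp add: d_def B(3))
        then have "?op (q a) ` dual = {0}"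
          using B by simp
        then have "?op (q a) \<chi> = 0"
          using \<chi> by blast
        then show ?thesis
          by (simp only: fun_space.poly_op_mult[OF S] fun_space.endo_0[OF fun_space.endo_poly_op[OF S]])
      qed
      have "G dvd [:0, 1:] ^ e * ((\<Sum>a\<in>\<Lambda>. q a) - 1)"
        using q(2) by (rule dvd_mult)
      then have "?op ([:0, 1:] ^ e * ((\<Sum>a\<in>\<Lambda>. q a) - 1)) \<chi> = 0"
        using \<chi> by (rule kill)
      moreover have "[:0, 1:] ^ e * ((\<Sum>a\<in>\<Lambda>. q a) - 1) = (\<Sum>a\<in>\<Lambda>. [:0, 1:] ^ e * q a) - [:0, 1:] ^ e"
        by (simp only: right_diff_distrib sum_distrib_left mult_1_right)
      moreover have "?op (\<Sum>a\<in>\<Lambda>. R a) \<chi> = (\<Sum>a\<in>\<Lambda>. ?op (R a) \<chi>)" for R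
        using fin by induction (simp_all only: sum.insert sum.empty fun_space.poly_op_add fun_space.poly_op_0 not_False_eq_True)
      ultimately have "?op ([:0, 1:] ^ e) \<chi> = 0"
        using each by (simp add: fun_space.poly_op_diff)
      moreover have "?op [:0, 1:] = ?S"
        by (rule ext) simp
      ultimately show ?thesis
        by (simp only: fun_space.poly_op_power[OF S])
    qed
    then have "pull (f ^^ e) (dual_coord b) v = 0" for b v
      using dual_coord_in_dual[of b] by (simp add: pull_funpow)
    then have "representation Basis ((f ^^ e) v) b = 0" for b v
      by (simp add: pull_def dual_coord_def)
    then have "(f ^^ e) v = 0" for v
      using basis_expand[of "(f ^^ e) v"] by simp
    then show ?thesis by blast
  qed
  show ?thesis
    by (intro exI[of _ d] conjI allI impI main nil) auto
qed

text \<open>Cartan's criterion. A \<open>\<rat>\<close>-linear functional \<open>\<phi>\<close> on the algebraic closure yields a polynomial \<open>p\<close> with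
  \<open>tr (f p(f)) = \<Sum> a \<phi>(a) d(a)\<close>, and this vanishes because \<open>ad (p(f))\<close> is a polynomial without constant term in \<open>ad f\<close>;
  applying \<open>\<phi>\<close> gives \<open>\<Sum> \<phi>(a)\<^sup>2 d(a) = 0\<close>.\<close>

theorem cartan_nilpotent:
  assumes f: "endo f" and I: "finite I" and g: "\<And>i. i \<in> I \<Longrightarrow> endo (g i)" and h: "\<And>i. i \<in> I \<Longrightarrow> endo (h i)"
    and f_eq: "\<And>v. f v = (\<Sum>i\<in>I. g i (h i v) - h i (g i v))"
    and tr0: "\<And>i k. i \<in> I \<Longrightarrow> tr (\<lambda>v. h i ((commutator f ^^ Suc k) (g i) v)) = 0"
  shows "nilpotent_op f"
proof -
  let ?H = "map_poly to_ac :: 'a poly \<Rightarrow> 'a alg_closure poly"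
  obtain m where m: "m \<noteq> 0" "\<And>v. poly_op m f v = 0"
    using annihilator_exists[OF f] by blast
  define \<Lambda> where "\<Lambda> = {a. poly (?H m) a = 0}"
  define e where "e = Suc (Polynomial.degree m)"
  have Hm: "?H m \<noteq> 0"
    using m(1) by (simp add: map_to_ac_eq_0)
  have fin: "finite \<Lambda>"
    unfolding \<Lambda>_def using Hm by (rule poly_roots_finite)
  have Hdvd: "?H m dvd (\<Prod>a\<in>\<Lambda>. [:-a, 1:] ^ e)"
    using dvd_root_powers[OF Hm] by (simp add: \<Lambda>_def e_def)
  obtain d :: "'a alg_closure \<Rightarrow> nat" where
    d: "\<forall>p \<phi>. (\<forall>a\<in>\<Lambda>. [:-a, 1:] ^ e dvd p - [:\<phi> a:]) \<longrightarrow>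
      (\<Sum>k\<le>Polynomial.degree p. poly.coeff p k * to_ac (tr (f ^^ Suc k))) = (\<Sum>a\<in>\<Lambda>. (a * \<phi> a) * of_nat (d a))"
    and nil: "(\<forall>a\<in>\<Lambda>. a \<noteq> 0 \<longrightarrow> d a = 0) \<longrightarrow> nilpotent_op f"
    using trace_multiplicities[OF f m] unfolding \<Lambda>_def[symmetric] e_def[symmetric] by blast
  have "d c = 0" if c: "c \<in> \<Lambda>" "c \<noteq> 0" for c
  proof -
    \<comment> \<open>Rational values make the squares in the final sum nonnegative, and
      \<open>\<phi> c = 1\<close> isolates the multiplicity of \<open>c\<close>.\<close>
    obtain \<phi> :: "'a alg_closure \<Rightarrow> rat" where \<phi>: "\<And>x y. \<phi> (x + y) = \<phi> x + \<phi> y"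
        "\<And>r x. \<phi> (of_rat r * x) = r * \<phi> x" "\<phi> c = 1"
      using field_hom_retraction[of "of_rat :: rat \<Rightarrow> 'a alg_closure" c, OF of_rat_add of_rat_mult of_rat_1 c(2)] by auto
    have \<phi>0: "\<phi> 0 = 0" using \<phi>(2)[of 0 0] by simp
    have \<phi>_diff: "\<phi> (x - y) = \<phi> x - \<phi> y" for x y
      using \<phi>(1)[of "x - y" y] by simp
    let ?\<phi> = "\<lambda>x. of_rat (\<phi> x) :: 'a alg_closure"
    obtain p where p: "\<And>a. a \<in> \<Lambda> \<Longrightarrow> [:-a, 1:] ^ e dvd p - [:?\<phi> a:]"
      using poly_interpolate_mod[OF fin, of e ?\<phi>] by blast
    define \<Gamma> where "\<Gamma> = (\<lambda>x. fst x - snd x) ` (\<Lambda> \<times> \<Lambda>) \<union> {0}"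
    have "finite \<Gamma>"
      unfolding \<Gamma>_def using fin by simp
    from poly_interpolate_mod[OF this, of "e + e" ?\<phi>]
    obtain r where r: "\<And>a. a \<in> \<Gamma> \<Longrightarrow> [:-a, 1:] ^ (e + e) dvd r - [:?\<phi> a:]"
      by blast
    have r_diff: "[:-(a - b), 1:] ^ (e + e) dvd r - [:?\<phi> a - ?\<phi> b:]" if "a \<in> \<Lambda>" "b \<in> \<Lambda>" for a b
    proof -
      have "a - b \<in> \<Gamma>"
        using that by (auto simp: \<Gamma>_def intro!: image_eqI[of _ _ "(a, b)"])
      from r[OF this] show ?thesis
        by (simp only: \<phi>_diff of_rat_diff)
    qed
    have "[:-0, 1:] ^ (e + e) dvd r - [:?\<phi> 0:]"
      by (rule r) (simp add: \<Gamma>_def)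
    then have "[:-0, 1:] dvd r"
      by (simp add: e_def dvd_mult_left \<phi>0)
    then have r0: "poly.coeff r 0 = 0"
      by (simp only: poly_eq_0_iff_dvd[symmetric] poly_0_coeff_0)
    let ?C = "\<lambda>k i v. (f ^^ k) (g i v) - g i ((f ^^ k) v)"
    have C: "endo (\<lambda>v. h i (?C k i v))" if "i \<in> I" for k i
      by (rule endo_compose[OF h[OF that] endo_diff_fun[OF endo_compose[OF endo_funpow[OF f] g[OF that]]
            endo_compose[OF g[OF that] endo_funpow[OF f]]]])
    \<comment> \<open>Write one factor \<open>f\<close> as the sum of commutators; cyclicity of the
      trace then moves \<open>g i\<close> across \<open>f^k\<close>.\<close>
    have tr_f: "tr (f ^^ Suc k) = (\<Sum>i\<in>I. tr (\<lambda>v. h i (?C k i v)))" for k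
    proof -
      have fk: "endo (f ^^ k)" by (rule endo_funpow[OF f])
      have "tr (f ^^ Suc k) = tr (\<lambda>v. \<Sum>i\<in>I. g i (h i ((f ^^ k) v)) - h i (g i ((f ^^ k) v)))"
        by (rule tr_cong) (simp add: f_eq)
      also have "\<dots> = (\<Sum>i\<in>I. tr (\<lambda>v. g i (h i ((f ^^ k) v)) - h i (g i ((f ^^ k) v))))"
        by (rule tr_sum[OF I], rule endo_diff_fun[OF endo_compose[OF g endo_compose[OF h fk]] endo_compose[OF h endo_compose[OF g fk]]])
      also have "\<dots> = (\<Sum>i\<in>I. tr (\<lambda>v. h i (?C k i v)))"
      proof (rule sum.cong[OF refl])
        fix i assume i: "i \<in> I"
        have hf: "endo (\<lambda>v. h i ((f ^^ k) v))" and gf: "endo (\<lambda>v. h i (g i ((f ^^ k) v)))"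
          and hfg: "endo (\<lambda>v. h i ((f ^^ k) (g i v)))"
          by (rule endo_compose[OF h[OF i] fk] endo_compose[OF h[OF i] endo_compose[OF g[OF i] fk]]
              endo_compose[OF h[OF i] endo_compose[OF fk g[OF i]]])+
        have "tr (\<lambda>v. g i (h i ((f ^^ k) v)) - h i (g i ((f ^^ k) v))) =
            tr (\<lambda>v. g i (h i ((f ^^ k) v))) - tr (\<lambda>v. h i (g i ((f ^^ k) v)))"
          by (rule tr_diff[OF endo_compose[OF g[OF i] hf] gf])
        also have "tr (\<lambda>v. g i (h i ((f ^^ k) v))) = tr (\<lambda>v. h i ((f ^^ k) (g i v)))"
          by (rule tr_commute[OF g[OF i] hf])
        also have "\<dots> - tr (\<lambda>v. h i (g i ((f ^^ k) v))) = tr (\<lambda>v. h i ((f ^^ k) (g i v)) - h i (g i ((f ^^ k) v)))"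
          by (rule tr_diff[OF hfg gf, symmetric])
        finally show "tr (\<lambda>v. g i (h i ((f ^^ k) v)) - h i (g i ((f ^^ k) v))) = tr (\<lambda>v. h i (?C k i v))"
          by (simp add: endo_diff[OF h[OF i]])
      qed
      finally show ?thesis .
    qed
    have comm_endo: "endo ((commutator f ^^ k) (g i))" if "i \<in> I" for k i
    proof (induction k)
      case (Suc k)
      then show ?case
        using endo_diff_fun[OF endo_compose[OF f Suc] endo_compose[OF Suc f]] by (simp add: commutator_def)
    qed (simp add: g[OF that])
    \<comment> \<open>The commutator of \<open>p(f)\<close> with \<open>g i\<close> is
      \<open>r(ad f)\<close> applied to \<open>g i\<close>: positive powers are traceless against
      \<open>h i\<close> by \<open>tr0\<close>, and \<open>r\<close> has no constant term.\<close>
    have zero: "(\<Sum>k\<le>Polynomial.degree p. poly.coeff p k * to_ac (tr (\<lambda>v. h i (?C k i v)))) = 0"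
      if i: "i \<in> I" for i
    proof -
      let ?\<chi> = "\<lambda>b u. representation Basis (h i u) b"
      have \<chi>: "functional (?\<chi> b)" for b
        using functional_coordinate[of b] by (simp add: functional_def endo_add[OF h[OF i]] endo_scale[OF h[OF i]])
      have "(\<Sum>k\<le>Polynomial.degree p. poly.coeff p k * to_ac (tr (\<lambda>v. h i (?C k i v)))) =
          (\<Sum>b\<in>Basis. \<Sum>k\<le>Polynomial.degree p. poly.coeff p k * to_ac (?\<chi> b (?C k i b)))"
        by (subst sum.swap) (simp add: tr_def[OF C[OF i]] to_ac_sum sum_distrib_left)
      also have "\<dots> = (\<Sum>b\<in>Basis. \<Sum>k\<le>Polynomial.degree r. poly.coeff r k * to_ac (?\<chi> b ((commutator f ^^ k) (g i) b)))"
        by (simp only: commutator_polynomial[OF f g[OF i] \<chi> m(2) fin Hdvd p r_diff, symmetric])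
      also have "\<dots> = (\<Sum>k\<le>Polynomial.degree r. poly.coeff r k * to_ac (tr (\<lambda>v. h i ((commutator f ^^ k) (g i) v))))"
        by (subst sum.swap) (simp add: tr_def[OF endo_compose[OF h[OF i] comm_endo[OF i]]] to_ac_sum sum_distrib_left)
      also have "\<dots> = 0"
      proof (rule sum.neutral, rule ballI)
        fix k
        show "poly.coeff r k * to_ac (tr (\<lambda>v. h i ((commutator f ^^ k) (g i) v))) = 0"
          using r0 tr0[OF i] by (cases k) (simp_all del: funpow.simps)
      qed
      finally show ?thesis .
    qed
    have "(\<Sum>a\<in>\<Lambda>. (a * ?\<phi> a) * of_nat (d a)) = (\<Sum>k\<le>Polynomial.degree p. poly.coeff p k * to_ac (tr (f ^^ Suc k)))"
      using d p by (intro d[rule_format, symmetric])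
    also have "\<dots> = (\<Sum>i\<in>I. \<Sum>k\<le>Polynomial.degree p. poly.coeff p k * to_ac (tr (\<lambda>v. h i (?C k i v))))"
      by (subst sum.swap) (simp add: tr_f to_ac_sum sum_distrib_left del: funpow.simps)
    also have "\<dots> = 0"
      using zero by simp
    finally have "\<phi> (\<Sum>a\<in>\<Lambda>. (a * ?\<phi> a) * of_nat (d a)) = 0"
      by (simp only: \<phi>0)
    moreover have "\<phi> (\<Sum>a\<in>A. (a * ?\<phi> a) * of_nat (d a)) = (\<Sum>a\<in>A. \<phi> a * \<phi> a * of_nat (d a))" if "finite A" for A
      using that
    proof induction
      case (insert a A)
      have "(a * ?\<phi> a) * of_nat (d a) = of_rat (\<phi> a * of_nat (d a)) * a"
        by (simp add: of_rat_mult)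
      then have "\<phi> ((a * ?\<phi> a) * of_nat (d a)) = \<phi> a * \<phi> a * of_nat (d a)"
        by (simp only: \<phi>(2)) simp
      with insert show ?case by (simp add: \<phi>(1))
    qed (simp add: \<phi>0)
    ultimately have "(\<Sum>a\<in>\<Lambda>. \<phi> a * \<phi> a * of_nat (d a)) = 0"
      using fin by simp
    then have "\<phi> c * \<phi> c * of_nat (d c) = 0"
      using c(1) fin by (subst (asm) sum_nonneg_eq_0_iff) auto
    then show ?thesis
      using \<phi>(3) by simp
  qed
  then show ?thesis
    using nil by blast
qed

end

section \<open>Right multiplications\<close>

locale fd_leibniz = leibniz_algebra scale bracket + fd_operator_space scale Basis
  for scale :: "'f::field_char_0 \<Rightarrow> 'v::ab_group_add \<Rightarrow> 'v" and bracket :: "'v \<Rightarrow> 'v \<Rightarrow> 'v"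
    and Basis :: "'v set"
begin

definition R :: "'v \<Rightarrow> 'v \<Rightarrow> 'v" where
  "R x = (\<lambda>v. bracket v x)"

lemma endo_R: "endo (R x)"
  by (simp add: endo_def R_def bracket_add_left bracket_scale_left)

lemma endo_left: "endo (bracket x)"
  by (simp add: endo_def bracket_add_right bracket_scale_right)

lemma R_zero [simp]: "bracket v 0 = 0" "bracket 0 v = 0"
  using endo_0[OF endo_left] endo_0[OF endo_R[of v]] by (simp_all add: R_def)

lemma bracket_neg: "bracket v (- x) = - bracket v x" "bracket (- v) x = - bracket v x"
  using endo_neg[OF endo_left] endo_neg[OF endo_R[of x]] by (simp_all add: R_def)

lemma bracket_diff: "bracket v (x - y) = bracket v x - bracket v y" "bracket (v - w) x = bracket v x - bracket w x"
  using endo_diff[OF endo_left] endo_diff[OF endo_R[of x]] by (simp_all add: R_def)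

lemma R_add: "R (x + y) v = R x v + R y v"
  by (simp add: R_def bracket_add_right)

lemma R_scale: "R (scale c x) v = scale c (R x v)"
  by (simp add: R_def bracket_scale_right)

lemma R_bracket: "R (bracket y z) v = R z (R y v) - R y (R z v)"
  by (simp add: R_def leibniz)

lemma derivation: "bracket (bracket v y) z = bracket v (bracket y z) + bracket (bracket v z) y"
  by (simp add: leibniz)

text \<open>Hence a polynomial in \<open>ad (R a)\<close> sends \<open>R c\<close> to right
  multiplication by the same polynomial in \<open>R a\<close> evaluated at \<open>c\<close>. This is
  how operator identities return to elements.\<close>

lemma commutator_R: "commutator (R a) (R c) = R (R a c)"
  by (rule ext) (simp add: commutator_def R_def leibniz)

lemma commutator_R_funpow: "(commutator (R a) ^^ k) (R c) = R ((R a ^^ k) c)"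
  by (induction k) (simp_all add: commutator_R)

text \<open>The Leibniz identity with \<open>y = z\<close> gives \<open>[x, [y, y]] = 0\<close>;
  thus \<open>R\<close> depends only on classes modulo the kernel.\<close>

lemma kernel_right: "a \<in> leibniz_kernel \<Longrightarrow> bracket x a = 0"
proof -
  have "leibniz_kernel \<subseteq> {a. bracket x a = 0}"
    unfolding leibniz_kernel_def
  proof (rule span_minimal)
    show "subspace {a. bracket x a = 0}"
      by (rule endo_kernel_subspace[OF endo_left])
    show "{bracket x x |x. True} \<subseteq> {a. bracket x a = 0}"
      using leibniz[of x] by auto
  qed
  then show "a \<in> leibniz_kernel \<Longrightarrow> bracket x a = 0" by blast
qed

lemma subspace_kernel: "subspace leibniz_kernel"
  using ideal_leibniz_kernel by (simp add: ideal_def)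

lemma kernel_left: "a \<in> leibniz_kernel \<Longrightarrow> bracket a x \<in> leibniz_kernel"
  using ideal_leibniz_kernel by (simp add: ideal_def)

lemma bracket_symmetric_part: "bracket x y + bracket y x \<in> leibniz_kernel"
proof -
  have sq: "bracket u u \<in> leibniz_kernel" for u
    unfolding leibniz_kernel_def by (rule span_base) auto
  have "bracket x y + bracket y x = bracket (x + y) (x + y) - bracket x x - bracket y y"
    by (simp add: bracket_add_left bracket_add_right)
  also have "\<dots> \<in> leibniz_kernel"
    by (intro subspace_diff[OF subspace_kernel] sq)
  finally show ?thesis .
qed

lemma alternating_imp_antisymmetric:
  assumes "bracket x x = 0" "bracket y y = 0" "bracket (x + y) (x + y) = 0"
  shows "bracket x y = - bracket y x"
proof -
  have "bracket x y + bracket y x = 0"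
    using assms by (simp add: bracket_add_left bracket_add_right add.commute)
  then show ?thesis by (rule eq_neg_iff_add_eq_0[THEN iffD2])
qed

lemma subspace_dim_less:
  assumes "subspace H" "subspace K" "H \<subset> K"
  shows "dim H < dim K"
proof -
  have eq: "span H = H" "span K = K"
    using assms by simp_all
  show ?thesis
    by (rule dim_psubset) (simp only: eq assms(3))
qed

text \<open>Engel's theorem, in a relative form that avoids passing to the quotient \<open>U / U'\<close>.\<close>

lemma engel:
  assumes "subspace J" "\<And>a b. a \<in> J \<Longrightarrow> b \<in> J \<Longrightarrow> bracket a b \<in> J" "\<And>a. a \<in> J \<Longrightarrow> bracket a a = 0"
    and "\<And>a. a \<in> J \<Longrightarrow> nilpotent_op (R a)"
    and "subspace U" "subspace U'" "U' \<subset> U"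
    and "\<And>u j. u \<in> U \<Longrightarrow> j \<in> J \<Longrightarrow> bracket u j \<in> U" "\<And>u j. u \<in> U' \<Longrightarrow> j \<in> J \<Longrightarrow> bracket u j \<in> U'"
  shows "\<exists>v\<in>U - U'. \<forall>j\<in>J. bracket v j \<in> U'"
  using assms
proof (induction "dim J" arbitrary: J U U' rule: less_induct)
  case less
  note J = less.prems(1-4) and U = less.prems(5-9)
  show ?case
  proof (cases "J \<subseteq> {0}")
    case True
    obtain v where "v \<in> U - U'" using U(3) by blast
    moreover have "\<forall>j\<in>J. bracket v j \<in> U'"
      using True subspace_0[OF U(2)] by auto
    ultimately show ?thesis by blast
  next
    case False
    let ?P = "\<lambda>H. subspace H \<and> H \<subset> J \<and> (\<forall>a\<in>H. \<forall>b\<in>H. bracket a b \<in> H)"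
    have P0: "?P {0}"
      using False subspace_0[OF J(1)] by (auto simp: subspace_single_0)
    have dlt: "dim H < dim J" if "?P H" for H
      using that J(1) by (intro subspace_dim_less) simp_all
    then have "\<forall>H. ?P H \<longrightarrow> dim H < dim J"
      by blast
    from ex_has_greatest_nat[of ?P "{0}" dim "dim J", OF P0 this]
    obtain H where H: "?P H" and max: "\<forall>K. ?P K \<longrightarrow> dim K \<le> dim H"
      by (elim exE conjE) blast
    have HJ: "H \<subseteq> J" using H by blast
    \<comment> \<open>First use of the induction, with \<open>H\<close> acting on the pair
      \<open>H\<close> inside \<open>J\<close>: it produces \<open>v\<close> outside
      \<open>H\<close> that normalizes \<open>H\<close>.\<close>
    have "\<exists>v\<in>J - H. \<forall>h\<in>H. bracket v h \<in> H"
      by (rule less.hyps[OF dlt[OF H]]) (use H HJ J in blast)+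
    then obtain v where v: "v \<in> J" "v \<notin> H" "\<And>h. h \<in> H \<Longrightarrow> bracket v h \<in> H"
      by blast
    define K where "K = {h + scale c v |h c. h \<in> H}"
    have KI: "h + scale c v \<in> K" if "h \<in> H" for h c
      using that K_def by blast
    have "?P H" by (rule H)
    then have Hs: "subspace H" by blast
    have Ks: "subspace K"
    proof (rule subspaceI)
      show "0 \<in> K" using KI[OF subspace_0[OF Hs], of 0] by simp
      show "x + y \<in> K" if xy: "x \<in> K" "y \<in> K" for x y
      proof -
        obtain h c h' c' where "x = h + scale c v" "y = h' + scale c' v" "h \<in> H" "h' \<in> H"
          using xy K_def by blast
        then show ?thesis
          using KI[OF subspace_add[OF Hs, of h h'], of "c + c'"] by (simp add: scale_left_distrib algebra_simps)
      qed
      show "scale a x \<in> K" if xK: "x \<in> K" for x a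
      proof -
        obtain h c where "x = h + scale c v" "h \<in> H"
          using xK K_def by blast
        then show ?thesis
          using KI[OF subspace_scale[OF Hs, of h a], of "a * c"] by (simp add: scale_right_distrib)
      qed
    qed
    have KJ: "K \<subseteq> J"
      using HJ v(1) by (auto simp: K_def intro!: subspace_add[OF J(1)] subspace_scale[OF J(1)])
    have anti: "bracket h v = - bracket v h" if "h \<in> H" for h
      using that HJ v(1) J(3) subspace_add[OF J(1)] by (intro alternating_imp_antisymmetric) auto
    have closed: "\<forall>a\<in>K. \<forall>b\<in>K. bracket a b \<in> K"
    proof (intro ballI)
      fix a b assume "a \<in> K" "b \<in> K"
      then obtain h c h' c' where ab: "a = h + scale c v" "b = h' + scale c' v" "h \<in> H" "h' \<in> H"
        using K_def by blast
      have "bracket a b = (bracket h h' + scale c' (bracket h v) + scale c (bracket v h')) + scale 0 v"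
        using J(3)[OF v(1)]
        by (simp add: ab bracket_add_left bracket_add_right bracket_scale_left bracket_scale_right algebra_simps)
      also have "\<dots> \<in> K"
      proof (rule KI)
        have "bracket h v \<in> H"
          unfolding anti[OF ab(3)] by (rule subspace_neg[OF Hs v(3)[OF ab(3)]])
        moreover have "bracket h h' \<in> H"
          using H ab(3,4) by blast
        ultimately show "bracket h h' + scale c' (bracket h v) + scale c (bracket v h') \<in> H"
          using v(3)[OF ab(4)] by (intro subspace_add[OF Hs] subspace_scale[OF Hs])
      qed
      finally show "bracket a b \<in> K" .
    qed
    have "H \<subseteq> K" using KI[of _ 0] by auto
    moreover have "v \<in> K" using KI[OF subspace_0[OF Hs], of 1] by simp
    ultimately have "H \<subset> K" using v(2) by blast
    then have "dim H < dim K"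
      using Hs Ks by (intro subspace_dim_less)
    \<comment> \<open>\<open>H + F v\<close> is a strictly larger subalgebra than the maximal proper
      one \<open>H\<close>.\<close>
    then have KJ_eq: "K = J"
      using max Ks KJ closed by (metis leD psubsetI)
    have "\<exists>u\<in>U - U'. \<forall>h\<in>H. bracket u h \<in> U'"
      by (rule less.hyps[OF dlt[OF H]]) (use H HJ J U in blast)+
    then obtain u where u: "u \<in> U" "u \<notin> U'" "\<And>h. h \<in> H \<Longrightarrow> bracket u h \<in> U'"
      by blast
    let ?W = "{u \<in> U. \<forall>h\<in>H. bracket u h \<in> U'}"
    have "R v ` ?W \<subseteq> ?W"
    proof safe
      fix x assume x: "x \<in> U" "\<forall>h\<in>H. bracket x h \<in> U'"
      show "R v x \<in> U" using U(4) x(1) v(1) by (simp add: R_def)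
      fix h assume h: "h \<in> H"
      have "bracket (bracket x v) h = bracket x (bracket v h) + bracket (bracket x h) v"
        by (rule derivation)
      also have "\<dots> \<in> U'"
        using x h v(1) v(3)[OF h] U(5) by (intro subspace_add[OF U(2)]) auto
      finally show "bracket (R v x) h \<in> U'" by (simp add: R_def)
    qed
    then have W: "(R v ^^ i) u \<in> ?W" for i
      by (rule funpow_invariant) (use u in blast)
    obtain k where "(R v ^^ k) u = 0"
      using J(4)[OF v(1)] by blast
    then have ex: "(R v ^^ k) u \<in> U'"
      using subspace_0[OF U(2)] by simp
    \<comment> \<open>The last iterate of \<open>u\<close> under \<open>R v\<close> outside
      \<open>U'\<close> is mapped into \<open>U'\<close> by \<open>v\<close>, and by
      \<open>H\<close> because \<open>?W\<close> is stable under \<open>R v\<close>.\<close>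
    define l where "l = (LEAST k. (R v ^^ k) u \<in> U')"
    have l: "(R v ^^ l) u \<in> U'"
      unfolding l_def using ex by (rule LeastI)
    have "l \<noteq> 0" using l u(2) by (cases l) auto
    then obtain l' where l': "l = Suc l'" by (cases l) auto
    define w where "w = (R v ^^ l') u"
    have "w \<notin> U'"
      using not_less_Least[of l' "\<lambda>k. (R v ^^ k) u \<in> U'"] l' by (simp add: w_def l_def)
    moreover have wW: "w \<in> ?W" unfolding w_def by (rule W)
    moreover have wv: "bracket w v \<in> U'"
      using l by (simp add: l' w_def R_def)
    have "bracket w j \<in> U'" if "j \<in> J" for j
    proof -
      obtain h c where "j = h + scale c v" "h \<in> H"
        using \<open>j \<in> J\<close> KJ_eq K_def by blast
      then show ?thesis
        using wW wv by (auto simp: bracket_add_right bracket_scale_right intro!: subspace_add[OF U(2)] subspace_scale[OF U(2)])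
    qed
    ultimately show ?thesis by blast
  qed
qed

text \<open>Semisimplicity of \<open>R y\<close> is recorded by a separable annihilator, which is
  easily transported along automorphisms and still yields invariant complements in the
  quotient.\<close>

definition jordan_split :: "'v \<Rightarrow> bool" where
  "jordan_split x \<longleftrightarrow> (\<exists>y z M. (\<forall>v. bracket v x = bracket v y + bracket v z) \<and>
     separable M \<and> (\<forall>v. poly_op M (R y) v = 0) \<and> nilpotent_op (R z) \<and> (\<forall>v. R y (R z v) = R z (R y v)))"

lemma jordan_split_kernel:
  assumes "jordan_split x" "i \<in> leibniz_kernel"
  shows "jordan_split (x + i)"
  using assms(1) unfolding jordan_split_def by (simp add: bracket_add_right kernel_right[OF assms(2)])

text \<open>\<open>\<theta>\<close> intertwines \<open>R u\<close> with
  \<open>R (\<theta> u)\<close>, so a splitting of \<open>\<theta> x\<close> pulls back.\<close>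

lemma jordan_split_automorphism:
  assumes \<theta>: "endo \<theta>" "inj \<theta>" "\<And>a b. \<theta> (bracket a b) = bracket (\<theta> a) (\<theta> b)" and x: "jordan_split (\<theta> x)"
  shows "jordan_split x"
proof -
  obtain y z M where yz: "\<And>v. bracket v (\<theta> x) = bracket v y + bracket v z"
    "separable M" "\<And>v. poly_op M (R y) v = 0" "nilpotent_op (R z)" "\<And>v. R y (R z v) = R z (R y v)"
    using x unfolding jordan_split_def by blast
  have "surj \<theta>"
    using \<theta>(1,2) by (intro linear_inj_imp_surj) (simp_all add: endo_iff_linear)
  then obtain y' z' where y': "\<theta> y' = y" and z': "\<theta> z' = z"
    by (metis surjD)
  have \<theta>0: "u = 0" if "\<theta> u = 0" for u
    using \<theta>(2) that endo_0[OF \<theta>(1)] by (metis injD)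
  have tR: "\<theta> (R u v) = R (\<theta> u) (\<theta> v)" for u v
    by (simp add: R_def \<theta>(3))
  have "bracket v x = bracket v y' + bracket v z'" for v
    by (rule injD[OF \<theta>(2)]) (simp add: endo_add[OF \<theta>(1)] \<theta>(3) yz(1) y' z')
  moreover have "poly_op M (R y') v = 0" for v
  proof (rule \<theta>0)
    have "\<theta> (poly_op M (R y') v) = poly_op M (R y) (\<theta> v)"
      by (rule poly_op_intertwine) (use \<theta>(1) in \<open>simp_all add: endo_def tR y'\<close>)
    then show "\<theta> (poly_op M (R y') v) = 0" by (simp add: yz(3))
  qed
  moreover obtain k where k: "\<And>v. (R z ^^ k) v = 0" using yz(4) by blast
  have "(R z' ^^ k) v = 0" for v
  proof (rule \<theta>0)
    have "\<theta> ((R z' ^^ k) v) = (R z ^^ k) (\<theta> v)"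
      by (rule funpow_intertwine) (simp add: tR z')
    then show "\<theta> ((R z' ^^ k) v) = 0" by (simp add: k)
  qed
  then have "nilpotent_op (R z')" by blast
  moreover have "R y' (R z' v) = R z' (R y' v)" for v
    by (rule injD[OF \<theta>(2)]) (simp add: tR y' z' yz(5))
  ultimately show ?thesis
    unfolding jordan_split_def using yz(2) by blast
qed

section \<open>Exponentials of nilpotent derivations\<close>

definition divided_power :: "('v \<Rightarrow> 'v) \<Rightarrow> nat \<Rightarrow> 'v \<Rightarrow> 'v" where
  "divided_power D i v = scale (inverse (fact i)) ((D ^^ i) v)"

definition exp_op :: "('v \<Rightarrow> 'v) \<Rightarrow> nat \<Rightarrow> 'v \<Rightarrow> 'v" where
  "exp_op D k v = (\<Sum>i<k. divided_power D i v)"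

lemma divided_power_Suc: "endo D \<Longrightarrow> D (divided_power D i v) = scale (of_nat (Suc i)) (divided_power D (Suc i) v)"
  by (simp add: divided_power_def endo_scale field_simps del: of_nat_Suc)

text \<open>The Leibniz rule for powers of a derivation; division by factorials absorbs the binomial
  coefficients.\<close>

lemma divided_power_bracket:
  assumes D: "endo D" "\<And>a b. D (bracket a b) = bracket (D a) b + bracket a (D b)"
  shows "divided_power D n (bracket a b) = (\<Sum>i\<le>n. bracket (divided_power D i a) (divided_power D (n - i) b))"
proof (induction n)
  case 0
  then show ?case by (simp add: divided_power_def)
next
  case (Suc n)
  let ?u = "divided_power D"
  let ?F = "\<lambda>i. bracket (?u i a) (?u (Suc n - i) b)"
  have "scale (of_nat (Suc n)) (?u (Suc n) (bracket a b)) = D (?u n (bracket a b))"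
    by (simp only: divided_power_Suc[OF D(1)])
  also have "\<dots> = (\<Sum>i\<le>n. D (bracket (?u i a) (?u (n - i) b)))"
    by (simp only: Suc.IH endo_sum[OF D(1)])
  also have "\<dots> = (\<Sum>i\<le>n. scale (of_nat (Suc i)) (?F (Suc i)) + scale (of_nat (Suc n - i)) (?F i))"
    by (intro sum.cong refl)
      (simp add: D(2) divided_power_Suc[OF D(1)] bracket_scale_left bracket_scale_right Suc_diff_le del: of_nat_Suc)
  also have "\<dots> = (\<Sum>i\<le>n. scale (of_nat (Suc i)) (?F (Suc i))) + (\<Sum>i\<le>n. scale (of_nat (Suc n - i)) (?F i))"
    by (rule sum.distrib)
  also have "(\<Sum>i\<le>n. scale (of_nat (Suc i)) (?F (Suc i))) = (\<Sum>i\<le>Suc n. scale (of_nat i) (?F i))"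
    by (simp add: sum.atMost_Suc_shift del: sum.atMost_Suc of_nat_Suc)
  also have "(\<Sum>i\<le>n. scale (of_nat (Suc n - i)) (?F i)) = (\<Sum>i\<le>Suc n. scale (of_nat (Suc n - i)) (?F i))"
    by simp
  also have "(\<Sum>i\<le>Suc n. scale (of_nat i) (?F i)) + (\<Sum>i\<le>Suc n. scale (of_nat (Suc n - i)) (?F i)) =
      (\<Sum>i\<le>Suc n. scale (of_nat (Suc n)) (?F i))"
    unfolding sum.distrib[symmetric] scale_left_distrib[symmetric] of_nat_add[symmetric]
    by (intro sum.cong refl) simp
  also have "\<dots> = scale (of_nat (Suc n)) (\<Sum>i\<le>Suc n. ?F i)"
    by (rule scale_sum_right[symmetric])
  finally show ?case
    by (simp only: scale_cancel_left) (metis of_nat_eq_0_iff nat.distinct(1))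
qed

text \<open>Truncation at \<open>k + k\<close> makes multiplicativity exact: if \<open>i + j\<close>
  is at least \<open>k + k\<close>, one of the two divided powers already vanishes.\<close>

lemma exp_op_automorphism:
  assumes D: "endo D" "\<And>a b. D (bracket a b) = bracket (D a) b + bracket a (D b)" and nil: "\<And>v. (D ^^ k) v = 0"
  shows "endo (exp_op D (k + k))" "inj (exp_op D (k + k))"
    "exp_op D (k + k) (bracket a b) = bracket (exp_op D (k + k) a) (exp_op D (k + k) b)"
proof -
  let ?u = "divided_power D" and ?E = "exp_op D (k + k)"
  have u0: "?u i v = 0" if "k \<le> i" for i v
  proof -
    have "(D ^^ i) v = (D ^^ (i - k)) ((D ^^ k) v)"
      using that by (metis funpow_add comp_apply le_add_diff_inverse2)
    then show ?thesis
      by (simp add: divided_power_def nil endo_0[OF endo_funpow[OF D(1)]])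
  qed
  show E: "endo ?E"
    by (simp add: endo_def exp_op_def divided_power_def endo_add[OF endo_funpow[OF D(1)]]
        endo_scale[OF endo_funpow[OF D(1)]] scale_right_distrib sum.distrib scale_sum_right mult.commute)
  have "v = 0" if "?E v = 0" for v
  proof (rule ccontr)
    assume v: "v \<noteq> 0"
    define l where "l = (LEAST l. (D ^^ l) v = 0)"
    have l: "(D ^^ l) v = 0"
      unfolding l_def by (rule LeastI[of _ k]) (rule nil)
    then obtain j where j: "l = Suc j"
      using v by (cases l) auto
    have nz: "(D ^^ j) v \<noteq> 0"
      using not_less_Least[of j "\<lambda>l. (D ^^ l) v = 0"] j by (simp add: l_def)
    have "k \<noteq> 0" using nil[of v] v by (cases k) auto
    \<comment> \<open>\<open>D^j\<close> is the highest power that does not kill \<open>v\<close>,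
      so only the term \<open>i = 0\<close> of the exponential survives it.\<close>
    have "0 = (D ^^ j) (?E v)"
      using that endo_0[OF endo_funpow[OF D(1)]] by simp
    also have "\<dots> = (\<Sum>i<k + k. scale (inverse (fact i)) ((D ^^ (j + i)) v))"
      by (simp add: exp_op_def divided_power_def endo_sum[OF endo_funpow[OF D(1)]]
          endo_scale[OF endo_funpow[OF D(1)]] funpow_add)
    also have "\<dots> = (\<Sum>i\<in>{0}. scale (inverse (fact i)) ((D ^^ (j + i)) v))"
    proof (rule sum.mono_neutral_right)
      show "\<forall>i\<in>{..<k + k} - {0}. scale (inverse (fact i)) ((D ^^ (j + i)) v) = 0"
      proof
        fix i assume "i \<in> {..<k + k} - {0}"
        then obtain i' where "i = Suc i'" by (cases i) auto
        then have "j + i = i' + l"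
          by (simp add: j)
        then have "(D ^^ (j + i)) v = (D ^^ i') ((D ^^ l) v)"
          by (simp only: funpow_add comp_apply)
        then show "scale (inverse (fact i)) ((D ^^ (j + i)) v) = 0"
          by (simp add: l endo_0[OF endo_funpow[OF D(1)]])
      qed
    qed (use \<open>k \<noteq> 0\<close> in auto)
    finally show False using nz by simp
  qed
  note ker = this
  show "inj ?E"
  proof (rule injI)
    fix v w assume "?E v = ?E w"
    then have "?E (v - w) = 0"
      by (simp add: endo_diff[OF E])
    from ker[OF this] show "v = w" by simp
  qed
  have "?E (bracket a b) = (\<Sum>n<k + k. \<Sum>i\<le>n. bracket (?u i a) (?u (n - i) b))"
    by (simp add: exp_op_def divided_power_bracket[OF D])
  also have "\<dots> = (\<Sum>(i, j)\<in>{(i, j). i + j < k + k}. bracket (?u i a) (?u j b))"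
    by (rule sum.triangle_reindex[symmetric])
  also have "\<dots> = (\<Sum>(i, j)\<in>{..<k + k} \<times> {..<k + k}. bracket (?u i a) (?u j b))"
  proof (rule sum.mono_neutral_left)
    show "\<forall>x\<in>{..<k + k} \<times> {..<k + k} - {(i, j). i + j < k + k}. (case x of (i, j) \<Rightarrow> bracket (?u i a) (?u j b)) = 0"
    proof
      fix x assume "x \<in> {..<k + k} \<times> {..<k + k} - {(i, j). i + j < k + k}"
      then obtain i j where x: "x = (i, j)" "\<not> i + j < k + k"
        by (cases x) auto
      then have "k \<le> i \<or> k \<le> j" by linarith
      then show "(case x of (i, j) \<Rightarrow> bracket (?u i a) (?u j b)) = 0"
        using u0 x by auto
    qed
  qed auto
  also have "\<dots> = (\<Sum>i<k + k. \<Sum>j<k + k. bracket (?u i a) (?u j b))"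
    by (rule sum.cartesian_product[symmetric])
  also have "\<dots> = bracket (?E a) (?E b)"
    unfolding exp_op_def endo_sum[OF endo_left] endo_sum[OF endo_R, unfolded R_def]
    by (rule sum.swap)
  finally show "?E (bracket a b) = bracket (?E a) (?E b)" .
qed

end

section \<open>Almost reductive algebras\<close>

locale almost_reductive_split = fd_leibniz +
  fixes N S :: "'b set" and \<A> :: "'b set set"
  assumes nilradical: "is_nilradical N" and lie_S: "lie_subalgebra S"
    and sum_UNIV: "N + S = UNIV" and inter_0: "N \<inter> S = {0}"
    and direct_sum: "direct_sum_of N \<A>" and irreducible: "\<And>A. A \<in> \<A> \<Longrightarrow> irreducible_bimodule S A"
begin

lemma subspace_S: "subspace S" and S_closed: "x \<in> S \<Longrightarrow> y \<in> S \<Longrightarrow> bracket x y \<in> S"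
  and S_alt: "x \<in> S \<Longrightarrow> bracket x x = 0"
  using lie_S by (simp_all add: lie_subalgebra_def subalgebra_def)

lemma S_antisymmetric: "x \<in> S \<Longrightarrow> y \<in> S \<Longrightarrow> bracket x y = - bracket y x"
  by (intro alternating_imp_antisymmetric S_alt subspace_add[OF subspace_S])

lemma ideal_N: "ideal N" and nilpotent_N: "nilpotent N"
  and N_maximal: "ideal A \<Longrightarrow> nilpotent A \<Longrightarrow> A \<subseteq> N"
  using nilradical by (simp_all add: is_nilradical_def)

lemma subspace_N: "subspace N" and N_left: "n \<in> N \<Longrightarrow> bracket n x \<in> N" and N_right: "n \<in> N \<Longrightarrow> bracket x n \<in> N"
  using ideal_N by (simp_all add: ideal_def)

lemma decompose:
  obtains n s where "x = n + s" "n \<in> N" "s \<in> S"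
proof -
  have "x \<in> N + S" using sum_UNIV by simp
  then show ?thesis using that by (elim set_plus_elim) blast
qed

lemma N_induct:
  assumes "subspace P" "\<And>A. A \<in> \<A> \<Longrightarrow> A \<subseteq> P"
  shows "N \<subseteq> P"
proof
  fix x assume "x \<in> N"
  then have "x \<in> {\<Sum>A\<in>\<A>. f A |f. \<forall>A\<in>\<A>. f A \<in> A}"
    using direct_sum unfolding direct_sum_of_def by blast
  then obtain f where "x = (\<Sum>A\<in>\<A>. f A)" "\<forall>A\<in>\<A>. f A \<in> A"
    by blast
  then show "x \<in> P"
    using assms by (auto intro!: subspace_sum)
qed

lemma component_subspace: "A \<in> \<A> \<Longrightarrow> subspace A"
  and component_right: "A \<in> \<A> \<Longrightarrow> a \<in> A \<Longrightarrow> s \<in> S \<Longrightarrow> bracket a s \<in> A"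
  and component_left: "A \<in> \<A> \<Longrightarrow> a \<in> A \<Longrightarrow> s \<in> S \<Longrightarrow> bracket s a \<in> A"
  and component_nonzero: "A \<in> \<A> \<Longrightarrow> A \<noteq> {0}"
  using irreducible by (auto simp: irreducible_bimodule_def subbimodule_def)

lemma component_irreducible:
  "A \<in> \<A> \<Longrightarrow> subbimodule S B \<Longrightarrow> B \<subseteq> A \<Longrightarrow> B = {0} \<or> B = A"
  using irreducible by (auto simp: irreducible_bimodule_def)

text \<open>The elements killed by the left action form a subbimodule containing all \<open>[s, a] + [a, s]\<close>.\<close>

lemma component_dichotomy:
  assumes A: "A \<in> \<A>"
  shows "(\<forall>a\<in>A. \<forall>s\<in>S. bracket s a = 0) \<or> (\<forall>a\<in>A. \<forall>s\<in>S. bracket s a = - bracket a s)"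
proof -
  let ?B = "{a \<in> A. \<forall>s\<in>S. bracket s a = 0}"
  have "subbimodule S ?B"
    unfolding subbimodule_def
  proof (intro conjI ballI)
    show "subspace ?B"
      using component_subspace[OF A]
      by (auto simp: subspace_def bracket_add_right bracket_scale_right)
    fix a s assume a: "a \<in> ?B" and s: "s \<in> S"
    have "bracket t (bracket a s) = 0" if "t \<in> S" for t
      using leibniz[of t a s] a that S_closed[OF that s] by simp
    then show "bracket a s \<in> ?B"
      using a s component_right[OF A] by blast
    show "bracket s a \<in> ?B"
      using a s subspace_0[OF component_subspace[OF A]] by simp
  qed
  then consider "?B = A" | "?B = {0}"
    using component_irreducible[OF A] by blast
  then show ?thesis
  proof cases
    case 1
    then show ?thesis by blast
  next
    case 2
    have "bracket s a = - bracket a s" if a: "a \<in> A" and s: "s \<in> S" for a s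
    proof -
      have "bracket s a + bracket a s \<in> ?B"
        using component_left[OF A a s] component_right[OF A a s] component_subspace[OF A]
          kernel_right[OF bracket_symmetric_part] by (simp add: subspace_add)
      then have "bracket s a + bracket a s = 0"
        using 2 by blast
      then show ?thesis by (rule eq_neg_iff_add_eq_0[THEN iffD2])
    qed
    then show ?thesis by blast
  qed
qed

text \<open>By the dichotomy the left action is zero or the negative of the right one, so
  right-stable subspaces are subbimodules.\<close>

lemma component_right_irreducible:
  assumes A: "A \<in> \<A>" and B: "subspace B" "B \<subseteq> A" "\<And>b s. b \<in> B \<Longrightarrow> s \<in> S \<Longrightarrow> bracket b s \<in> B"
  shows "B = {0} \<or> B = A"
proof (rule component_irreducible[OF A _ B(2)])
  have "bracket s b \<in> B" if "b \<in> B" "s \<in> S" for b s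
    using component_dichotomy[OF A] B that subspace_0[OF B(1)] subspace_neg[OF B(1)] by (metis subsetD)
  then show "subbimodule S B"
    using B by (simp add: subbimodule_def)
qed

text \<open>The ideal \<open>J\<close> acts trivially on \<open>N\<close> by Engel's theorem and irreducibility, so its centre is an abelian ideal
  of the whole algebra and lies in \<open>N \<inter> S\<close>.\<close>

lemma nil_ideal_zero:
  assumes J: "subspace J" "J \<subseteq> S" "\<And>j s. j \<in> J \<Longrightarrow> s \<in> S \<Longrightarrow> bracket j s \<in> J"
    and nil: "\<And>j. j \<in> J \<Longrightarrow> nilpotent_op (R j)"
  shows "J = {0}"
proof (rule ccontr)
  assume "J \<noteq> {0}"
  have J_left: "bracket s j \<in> J" if "j \<in> J" "s \<in> S" for j s
    using S_antisymmetric[of s j] J(2,3) that subspace_neg[OF J(1)] by auto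
  have alt: "bracket j j = 0" if "j \<in> J" for j
    using that J(2) S_alt by blast
  have JJ: "bracket i j \<in> J" if "i \<in> J" "j \<in> J" for i j
    using that J by blast
  have AJ: "bracket a j = 0" if A: "A \<in> \<A>" "a \<in> A" and j: "j \<in> J" for A a j
  proof -
    let ?B = "{a \<in> A. \<forall>j\<in>J. bracket a j = 0}"
    have sub: "subspace A" by (rule component_subspace[OF A(1)])
    have "{0} \<subset> A"
      using component_nonzero[OF A(1)] subspace_0[OF sub] by blast
    then have "\<exists>v\<in>A - {0}. \<forall>j\<in>J. bracket v j \<in> {0}"
      using component_right[OF A(1)] J(2) by (intro engel[OF J(1) JJ alt nil sub subspace_single_0]) auto
    then have "?B \<noteq> {0}"
      by blast
    moreover have "?B = {0} \<or> ?B = A"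
    proof (rule component_right_irreducible[OF A(1)])
      show "subspace ?B"
        using sub by (auto simp: subspace_def bracket_add_left bracket_scale_left)
      fix b s assume b: "b \<in> ?B" and s: "s \<in> S"
      have "bracket (bracket b s) j = 0" if "j \<in> J" for j
        using derivation[of b s j] b that J_left[OF that s] by simp
      then show "bracket b s \<in> ?B"
        using b s component_right[OF A(1)] by blast
    qed blast
    ultimately show ?thesis
      using A(2) j by blast
  qed
  have JA: "bracket j a = 0" if A: "A \<in> \<A>" "a \<in> A" and j: "j \<in> J" for A a j
    using component_dichotomy[OF A(1)] A(2) j J(2) AJ[OF A j] by fastforce
  have NJ: "bracket n j = 0 \<and> bracket j n = 0" if "n \<in> N" "j \<in> J" for n j
  proof -
    have "N \<subseteq> {n. bracket n j = 0 \<and> bracket j n = 0}"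
      by (rule N_induct) (use AJ JA that in \<open>auto simp: subspace_def bracket_add_left bracket_add_right bracket_scale_left bracket_scale_right\<close>)
    then show ?thesis using that by blast
  qed
  have "{0} \<subset> J"
    using \<open>J \<noteq> {0}\<close> subspace_0[OF J(1)] by blast
  then have "\<exists>v\<in>J - {0}. \<forall>j\<in>J. bracket v j \<in> {0}"
    using JJ by (intro engel[OF J(1) JJ alt nil J(1) subspace_single_0]) auto
  then obtain v where v: "v \<in> J" "v \<noteq> 0" "\<And>j. j \<in> J \<Longrightarrow> bracket v j = 0"
    by blast
  let ?Z = "{v \<in> J. \<forall>j\<in>J. bracket v j = 0}"
  have Z_S: "bracket z s \<in> ?Z" if z: "z \<in> ?Z" and s: "s \<in> S" for z s
  proof -
    have "bracket (bracket z s) j = 0" if "j \<in> J" for j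
      using derivation[of z s j] z that J_left[OF that s] by simp
    then show ?thesis using z s J(3) by blast
  qed
  have subZ: "subspace ?Z"
    using J(1) by (auto simp: subspace_def bracket_add_left bracket_scale_left)
  have "ideal ?Z"
    unfolding ideal_def
  proof (intro conjI ballI allI subZ)
    fix z x assume z: "z \<in> ?Z"
    obtain n s where x: "x = n + s" "n \<in> N" "s \<in> S"
      by (rule decompose)
    have zJ: "z \<in> J" and zS: "z \<in> S"
      using z J(2) by blast+
    have "bracket z x = bracket z s"
      using NJ[OF x(2) zJ] by (simp add: x(1) bracket_add_right)
    then show "bracket z x \<in> ?Z"
      using Z_S[OF z x(3)] by (simp only:)
    have "bracket x z = - bracket z s"
      using NJ[OF x(2) zJ] S_antisymmetric[OF x(3) zS] by (simp add: x(1) bracket_add_left)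
    then show "bracket x z \<in> ?Z"
      using subspace_neg[OF subZ Z_S[OF z x(3)]] by (simp only:)
  qed
  moreover have "nilpotent ?Z"
  proof -
    have "{bracket x y |x y. x \<in> lower_central ?Z 0 \<and> y \<in> ?Z} \<subseteq> {0}"
      by auto
    then have "lower_central ?Z (Suc 0) = {0}"
      unfolding lower_central.simps(2)
      by (intro antisym span_minimal subspace_single_0) (auto intro: span_zero)
    then show ?thesis
      unfolding nilpotent_def by blast
  qed
  ultimately have "?Z \<subseteq> N"
    by (rule N_maximal)
  then have "v \<in> N \<inter> S"
    using v J(2) by blast
  then show False
    using inter_0 v(2) by blast
qed

section \<open>The trace form on the derived algebra of the complement\<close>

definition derived :: "'b set" where
  "derived = span {bracket b c |b c. b \<in> S \<and> c \<in> S}"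

lemma derived_bracket: "b \<in> S \<Longrightarrow> c \<in> S \<Longrightarrow> bracket b c \<in> derived"
  unfolding derived_def by (rule span_base) blast

lemma subspace_derived: "subspace derived"
  by (simp add: derived_def)

lemma derived_S: "derived \<subseteq> S"
  unfolding derived_def by (rule span_minimal) (use S_closed subspace_S in auto)

definition trace_form :: "'b \<Rightarrow> 'b \<Rightarrow> 'a" where
  "trace_form a b = tr (\<lambda>v. R a (R b v))"

lemma endo_RR: "endo (\<lambda>v. R a (R b v))"
  by (rule endo_compose[OF endo_R endo_R])

lemma tr_R_linear:
  assumes g: "endo g"
  shows "tr (\<lambda>v. g (R (x + y) v)) = tr (\<lambda>v. g (R x v)) + tr (\<lambda>v. g (R y v))"
    "tr (\<lambda>v. g (R (scale c x) v)) = c * tr (\<lambda>v. g (R x v))"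
  using tr_add[OF endo_compose[OF g endo_R] endo_compose[OF g endo_R]] tr_scale[OF endo_compose[OF g endo_R]]
  by (simp_all add: R_add R_scale endo_add[OF g] endo_scale[OF g])

lemma trace_form_commute: "trace_form a b = trace_form b a"
  unfolding trace_form_def by (rule tr_commute[OF endo_R endo_R])

lemma trace_form_linear:
  "trace_form (x + y) z = trace_form x z + trace_form y z" "trace_form (scale c x) z = c * trace_form x z"
  "trace_form z (x + y) = trace_form z x + trace_form z y" "trace_form z (scale c x) = c * trace_form z x"
  using tr_R_linear[OF endo_R[of z]]
  by (simp_all add: trace_form_commute[of _ z]) (simp_all add: trace_form_def)

text \<open>Since \<open>g\<close> commutes with \<open>R c\<close>, cyclicity gives both terms of
  the commutator of \<open>R b\<close> and \<open>R c\<close> the same trace against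
  \<open>g\<close>.\<close>

lemma tr_commuting_bracket:
  assumes g: "endo g" and comm: "\<And>v. g (R c v) = R c (g v)"
  shows "tr (\<lambda>v. g (R (bracket b c) v)) = 0"
proof -
  have gR: "endo (\<lambda>v. g (R x v))" for x
    by (rule endo_compose[OF g endo_R])
  have "tr (\<lambda>v. g (R (bracket b c) v)) = tr (\<lambda>v. g (R c (R b v)) - g (R b (R c v)))"
    by (simp add: R_bracket endo_diff[OF g])
  also have "\<dots> = tr (\<lambda>v. g (R c (R b v))) - tr (\<lambda>v. g (R b (R c v)))"
    by (rule tr_diff[OF endo_compose[OF gR endo_R] endo_compose[OF gR endo_R]])
  also have "tr (\<lambda>v. g (R c (R b v))) = tr (\<lambda>v. R c (g (R b v)))"
    by (simp add: comm)
  also have "\<dots> = tr (\<lambda>v. g (R b (R c v)))"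
    by (rule tr_commute[OF endo_R gR])
  finally show ?thesis by simp
qed

lemma tr_centralizer_derived:
  assumes g: "endo g" and comm: "\<And>s v. s \<in> S \<Longrightarrow> g (R s v) = R s (g v)" and w: "w \<in> derived"
  shows "tr (\<lambda>v. g (R w v)) = 0"
proof -
  have "tr (\<lambda>v. g (R 0 v)) = 0"
    using tr_R_linear(2)[OF g, of 0 0] by simp
  then have "subspace {w. tr (\<lambda>v. g (R w v)) = 0}"
    by (simp add: subspace_def tr_R_linear[OF g])
  then have "derived \<subseteq> {w. tr (\<lambda>v. g (R w v)) = 0}"
    unfolding derived_def using tr_commuting_bracket[OF g comm] by (intro span_minimal) auto
  then show ?thesis using w by blast
qed

lemma funpow_commute_R:
  assumes "\<And>s v. s \<in> S \<Longrightarrow> g (R s v) = R s (g v)" "s \<in> S"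
  shows "(g ^^ k) (R s v) = R s ((g ^^ k) v)"
  by (rule funpow_intertwine[symmetric]) (simp add: assms)

text \<open>The radical \<open>K\<close> is removed in two passes: Cartan's criterion makes
  \<open>J\<close>, spanned by the brackets of \<open>K\<close> with \<open>S\<close>, act
  nilpotently, so \<open>J = {0}\<close>; then \<open>K\<close> is central, and its elements act
  nilpotently by the power trace criterion.\<close>

lemma trace_form_nondegenerate:
  assumes "w \<in> derived" "\<And>b. b \<in> derived \<Longrightarrow> trace_form w b = 0"
  shows "w = 0"
proof -
  define K where "K = {a \<in> derived. \<forall>b\<in>derived. trace_form a b = 0}"
  have tf0: "trace_form 0 b = 0" for b
    using trace_form_linear(2)[of 0 0 b] by simp
  have subK: "subspace K"
    using subspace_derived tf0 by (auto simp: K_def subspace_def trace_form_linear)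
  have KS: "k \<in> S" if "k \<in> K" for k
    using that derived_S K_def by blast
  have K_ideal: "bracket k s \<in> K" if k: "k \<in> K" and s: "s \<in> S" for k s
  proof -
    have "trace_form (bracket k s) b = 0" if b: "b \<in> derived" for b
    proof -
      have "trace_form (bracket k s) b = tr (\<lambda>v. R s (R k (R b v)) - R k (R s (R b v)))"
        by (simp add: trace_form_def R_bracket)
      also have "\<dots> = tr (\<lambda>v. R s (R k (R b v))) - tr (\<lambda>v. R k (R s (R b v)))"
        by (rule tr_diff[OF endo_compose[OF endo_R endo_RR] endo_compose[OF endo_R endo_RR]])
      also have "tr (\<lambda>v. R s (R k (R b v))) = tr (\<lambda>v. R k (R b (R s v)))"
        by (rule tr_commute[OF endo_R endo_RR])
      also have "\<dots> - tr (\<lambda>v. R k (R s (R b v))) = tr (\<lambda>v. R k (R b (R s v)) - R k (R s (R b v)))"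
        by (rule tr_diff[OF endo_compose[OF endo_R endo_RR] endo_compose[OF endo_R endo_RR], symmetric])
      also have "\<dots> = trace_form k (bracket s b)"
        by (simp add: trace_form_def R_bracket endo_diff[OF endo_R])
      also have "\<dots> = 0"
        using k s b derived_S derived_bracket by (auto simp: K_def)
      finally show ?thesis .
    qed
    then show ?thesis
      using derived_bracket[OF KS[OF k] s] K_def by blast
  qed
  \<comment> \<open>\<open>K\<close> is orthogonal only to \<open>derived\<close>, not to all of
    \<open>S\<close>. In \<open>J\<close> every commutator has a factor from \<open>K\<close> for
    the slot \<open>h\<close> of Cartan's criterion, and the iterated commutators in the other slot
    lie in \<open>derived\<close>.\<close>
  define J where "J = span {bracket k b |k b. k \<in> K \<and> b \<in> S}"
  have JS: "J \<subseteq> S"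
    unfolding J_def by (rule span_minimal) (use S_closed KS subspace_S in auto)
  have "J = {0}"
  proof (rule nil_ideal_zero[OF _ JS])
    show "subspace J" by (simp add: J_def)
    show "bracket j s \<in> J" if "j \<in> J" "s \<in> S" for j s
    proof -
      have "J \<subseteq> {j. bracket j s \<in> J}"
        unfolding J_def
      proof (rule span_minimal)
        have "subspace (span {bracket k b |k b. k \<in> K \<and> b \<in> S})" by simp
        then show "subspace {j. bracket j s \<in> span {bracket k b |k b. k \<in> K \<and> b \<in> S}}"
          unfolding subspace_def by (simp add: bracket_add_left bracket_scale_left)
        show "{bracket k b |k b. k \<in> K \<and> b \<in> S} \<subseteq> {j. bracket j s \<in> span {bracket k b |k b. k \<in> K \<and> b \<in> S}}"
          using K_ideal that(2) by (auto intro!: span_base)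
      qed
      then show ?thesis using that(1) by blast
    qed
    fix a assume a: "a \<in> J"
    then obtain T r where T: "finite T" "T \<subseteq> {bracket k b |k b. k \<in> K \<and> b \<in> S}" "a = (\<Sum>t\<in>T. scale (r t) t)"
      unfolding J_def span_explicit by blast
    have "\<forall>t\<in>T. \<exists>x. t = bracket (fst x) (snd x) \<and> fst x \<in> K \<and> snd x \<in> S"
      using T(2) by fastforce
    then obtain x where x: "\<forall>t\<in>T. t = bracket (fst (x t)) (snd (x t)) \<and> fst (x t) \<in> K \<and> snd (x t) \<in> S"
      by (elim bchoice[THEN exE])
    define k where "k t = scale (r t) (fst (x t))" for t
    define b where "b t = snd (x t)" for t
    have k: "k t \<in> K" and b: "b t \<in> S" if "t \<in> T" for t
      using x that subspace_scale[OF subK] by (auto simp: k_def b_def)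
    have "scale (r t) t = bracket (k t) (b t)" if "t \<in> T" for t
    proof -
      have "t = bracket (fst (x t)) (snd (x t))" using x that by blast
      then show ?thesis unfolding k_def b_def bracket_scale_left by simp
    qed
    then have a_eq: "a = (\<Sum>t\<in>T. bracket (k t) (b t))"
      using T(3) by simp
    have aS: "a \<in> S" using a JS by blast
    show "nilpotent_op (R a)"
    proof (rule cartan_nilpotent[OF endo_R T(1)])
      show "endo (R (b t))" "endo (R (k t))" for t by (rule endo_R)+
      show "R a v = (\<Sum>t\<in>T. R (b t) (R (k t) v) - R (k t) (R (b t) v))" for v
        unfolding R_bracket[symmetric] a_eq by (simp add: R_def endo_sum[OF endo_left])
      fix t i assume t: "t \<in> T"
      have "(R a ^^ i) (b t) \<in> S"
        using funpow_invariant[of "R a" S "b t" i] b[OF t] S_closed[OF _ aS] by (auto simp: R_def)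
      then have "(R a ^^ Suc i) (b t) \<in> derived"
        using derived_bracket[OF _ aS] by (simp add: R_def)
      then have "trace_form (k t) ((R a ^^ Suc i) (b t)) = 0"
        using k[OF t] K_def by blast
      then show "tr (\<lambda>v. R (k t) ((commutator (R a) ^^ Suc i) (R (b t)) v)) = 0"
        unfolding commutator_R_funpow trace_form_def .
    qed
  qed
  then have central: "bracket k s = 0" if "k \<in> K" "s \<in> S" for k s
    using that span_base[of "bracket k s" "{bracket k b |k b. k \<in> K \<and> b \<in> S}"] unfolding J_def by blast
  have "K = {0}"
  proof (rule nil_ideal_zero[OF subK])
    show "K \<subseteq> S" using KS by blast
    show "bracket j s \<in> K" if "j \<in> K" "s \<in> S" for j s by (rule K_ideal[OF that])
    fix k assume k: "k \<in> K"
    have comm: "R k (R s v) = R s (R k v)" if "s \<in> S" for s v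
      using R_bracket[of k s v] central[OF k that] by (simp add: R_def)
    show "nilpotent_op (R k)"
    proof (rule nilpotent_if_traces_zero[OF endo_R])
      fix i
      \<comment> \<open>\<open>k\<close> is central in \<open>S\<close>, so the powers of
        \<open>R k\<close> commute with all \<open>R s\<close>, while the remaining factor
        \<open>R k\<close> comes from \<open>derived\<close>.\<close>
      have "tr (\<lambda>v. (R k ^^ i) (R k v)) = 0"
        using k by (intro tr_centralizer_derived endo_funpow endo_R funpow_commute_R comm) (simp_all add: K_def)
      then show "tr (R k ^^ Suc i) = 0"
        by (simp only: funpow_Suc_right comp_def)
    qed
  qed
  then show ?thesis
    using assms K_def by blast
qed

section \<open>Jordan decomposition in the complement\<close>

lemma funpow_composite_nilpotent:
  assumes g: "endo g" and gn: "\<And>v. g (n v) = n (g v)" and "nilpotent_op n"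
  shows "nilpotent_op (\<lambda>v. g (n v))"
proof -
  obtain k where k: "\<And>v. (n ^^ k) v = 0" using assms(3) by blast
  have "((\<lambda>v. g (n v)) ^^ j) v = (g ^^ j) ((n ^^ j) v)" for j v
  proof (induction j)
    case (Suc j)
    have "n ((g ^^ j) u) = (g ^^ j) (n u)" for u
      by (rule funpow_intertwine) (rule gn[symmetric])
    then show ?case using Suc by simp
  qed simp
  then have "((\<lambda>v. g (n v)) ^^ k) v = 0" for v
    using k endo_0[OF endo_funpow[OF g]] by simp
  then show ?thesis by blast
qed

text \<open>The nilpotent part \<open>n\<close> of \<open>R \<sigma>\<close> normalizes the right multiplications, so \<open>n - R w\<close> commutes with \<open>R S\<close> for the \<open>w\<close>
  representing \<open>b \<mapsto> tr (n R b)\<close>. All traces of its powers vanish, hence it is nilpotent, and irreducibility makes it zero.\<close>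

lemma jordan_in_S:
  assumes \<sigma>: "\<sigma> \<in> S"
  shows "\<exists>w M. w \<in> S \<and> separable M \<and> (\<forall>v. poly_op M (R (\<sigma> - w)) v = 0) \<and> nilpotent_op (R w) \<and>
    (\<forall>v. R (\<sigma> - w) (R w v) = R w (R (\<sigma> - w) v))"
proof -
  let ?f = "R \<sigma>"
  have f: "endo ?f" by (rule endo_R)
  obtain p M where p0: "poly.coeff p 0 = 0" and M: "separable M" "\<forall>v. poly_op M (poly_op p ?f) v = 0"
    and nil: "nilpotent_op (\<lambda>v. ?f v - poly_op p ?f v)"
    and ad: "\<forall>g v. endo g \<longrightarrow> (\<Sum>k\<le>Polynomial.degree p. scale (poly.coeff p k) ((commutator ?f ^^ k) g v)) =
      poly_op p ?f (g v) - g (poly_op p ?f v)"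
    using jordan_polynomial[OF f] by blast
  define s where "s = poly_op p ?f"
  define n where "n v = ?f v - s v" for v
  have s: "endo s" unfolding s_def by (rule endo_poly_op[OF f])
  have n: "endo n" unfolding n_def by (rule endo_diff_fun[OF f s])
  \<comment> \<open>\<open>ad s\<close> is \<open>p(ad ?f)\<close>, and \<open>ad ?f\<close> maps
    \<open>R c\<close> to \<open>R (?f c)\<close>; so \<open>s\<close> behaves like a derivation in
    this slot.\<close>
  have sR: "s (R c v) - R c (s v) = R (s c) v" for c v
  proof -
    have "s (R c v) - R c (s v) = (\<Sum>k\<le>Polynomial.degree p. scale (poly.coeff p k) (R ((?f ^^ k) c) v))"
      using ad[rule_format, OF endo_R, of c v] by (simp add: s_def commutator_R_funpow)
    also have "\<dots> = R (s c) v"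
      by (simp add: s_def poly_op_def R_def endo_sum[OF endo_left] endo_scale[OF endo_left])
    finally show ?thesis .
  qed
  have nR: "n (R c v) - R c (n v) = R (n c) v" for c v
  proof -
    have "?f (R c v) - R c (?f v) = R (?f c) v"
      by (simp add: R_def leibniz)
    then show ?thesis
      using sR[of c v] by (simp add: n_def endo_diff[OF endo_R] R_def bracket_diff algebra_simps)
  qed
  have f_derived: "?f c \<in> derived" if "c \<in> S" for c
    using derived_bracket[OF that \<sigma>] by (simp add: R_def)
  \<comment> \<open>The missing constant term of \<open>p\<close> leaves at least one factor
    \<open>?f\<close>, which maps \<open>S\<close> into \<open>derived\<close>.\<close>
  have s_derived: "s c \<in> derived" if c: "c \<in> S" for c
  proof -
    obtain q where "p = pCons 0 q"
      using p0 by (cases p) auto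
    then have "s c = poly_op q ?f (?f c)"
      by (simp add: s_def)
    also have "\<dots> \<in> derived"
      using f_derived derived_S by (intro poly_op_invariant[OF subspace_derived] f_derived c) blast
    finally show ?thesis .
  qed
  have n_derived: "n c \<in> derived" if "c \<in> S" for c
    unfolding n_def by (rule subspace_diff[OF subspace_derived f_derived[OF that] s_derived[OF that]])
  obtain w where w: "w \<in> derived" "\<And>b. b \<in> derived \<Longrightarrow> trace_form w b = tr (\<lambda>v. n (R b v))"
    using nondegenerate_represents[OF subspace_derived trace_form_linear tr_R_linear[OF n] trace_form_nondegenerate]
    by metis
  have wS: "w \<in> S" using w(1) derived_S by blast
  define t where "t v = n v - R w v" for v
  have t: "endo t" unfolding t_def by (rule endo_diff_fun[OF n endo_R])
  have tR: "t (R c v) - R c (t v) = R (t c) v" for c v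
    using nR[of c v] R_bracket[of c w v]
    by (simp add: t_def endo_diff[OF endo_R]) (simp add: R_def bracket_diff algebra_simps)
  \<comment> \<open>Cyclicity turns the pairing of \<open>t c\<close> with \<open>b\<close> into the
    trace of \<open>t\<close> times \<open>R (bracket b c)\<close>, which vanishes by the choice of
    \<open>w\<close>.\<close>
  have t_S: "t c = 0" if c: "c \<in> S" for c
  proof (rule trace_form_nondegenerate)
    have "R w c \<in> derived" using derived_bracket[OF c wS] by (simp add: R_def)
    then show "t c \<in> derived"
      unfolding t_def by (rule subspace_diff[OF subspace_derived n_derived[OF c]])
    fix b assume b: "b \<in> derived"
    then have bS: "b \<in> S" using derived_S by blast
    have tRb: "endo (\<lambda>v. t (R b v))" by (rule endo_compose[OF t endo_R])
    have "trace_form (t c) b = tr (\<lambda>v. t (R c (R b v)) - R c (t (R b v)))"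
      by (simp add: trace_form_def tR[symmetric])
    also have "\<dots> = tr (\<lambda>v. t (R c (R b v))) - tr (\<lambda>v. R c (t (R b v)))"
      by (rule tr_diff[OF endo_compose[OF t endo_RR] endo_compose[OF endo_R tRb]])
    also have "tr (\<lambda>v. R c (t (R b v))) = tr (\<lambda>v. t (R b (R c v)))"
      by (rule tr_commute[OF endo_R tRb])
    also have "tr (\<lambda>v. t (R c (R b v))) - \<dots> = tr (\<lambda>v. t (R c (R b v)) - t (R b (R c v)))"
      by (rule tr_diff[OF endo_compose[OF t endo_RR] endo_compose[OF t endo_RR], symmetric])
    also have "\<dots> = tr (\<lambda>v. t (R (bracket b c) v))"
      by (simp add: R_bracket endo_diff[OF t])
    also have "\<dots> = tr (\<lambda>v. n (R (bracket b c) v)) - tr (\<lambda>v. R w (R (bracket b c) v))"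
      unfolding t_def by (rule tr_diff[OF endo_compose[OF n endo_R] endo_RR])
    also have "\<dots> = 0"
      using w(2)[OF derived_bracket[OF bS c]] by (simp add: trace_form_def)
    finally show "trace_form (t c) b = 0" .
  qed
  have t_comm: "t (R c v) = R c (t v)" if "c \<in> S" for c v
    using tR[of c v] t_S[OF that] by (simp add: R_def)
  have tf: "t (?f v) = ?f (t v)" for v by (rule t_comm[OF \<sigma>])
  have ts: "t (s v) = s (t v)" for v
    unfolding s_def using t tf by (rule poly_op_commute)
  have tn: "t (n v) = n (t v)" for v
    by (simp add: n_def endo_diff[OF t] tf ts)
  have n_nil: "nilpotent_op n"
    using nil by (simp add: n_def[abs_def] s_def)
  have t_nil: "nilpotent_op t"
  proof (rule nilpotent_if_traces_zero[OF t])
    fix k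
    have tk: "endo (t ^^ k)" by (rule endo_funpow[OF t])
    have tkn: "(t ^^ k) (n v) = n ((t ^^ k) v)" for v
      by (rule funpow_intertwine[symmetric]) (rule tn[symmetric])
    \<comment> \<open>\<open>t^k n\<close> is nilpotent because \<open>t\<close> and
      \<open>n\<close> commute; \<open>t^k R w\<close> is traceless because \<open>t^k\<close>
      centralizes \<open>R S\<close> and \<open>w\<close> lies in \<open>derived\<close>.\<close>
    have "tr (t ^^ Suc k) = tr (\<lambda>v. (t ^^ k) (n v) - (t ^^ k) (R w v))"
      by (rule tr_cong) (simp add: funpow_Suc_right t_def endo_diff[OF tk] del: funpow.simps)
    also have "\<dots> = tr (\<lambda>v. (t ^^ k) (n v)) - tr (\<lambda>v. (t ^^ k) (R w v))"
      by (rule tr_diff[OF endo_compose[OF tk n] endo_compose[OF tk endo_R]])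
    also have "tr (\<lambda>v. (t ^^ k) (n v)) = 0"
      by (rule tr_nilpotent[OF endo_compose[OF tk n] funpow_composite_nilpotent[OF tk tkn n_nil]])
    also have "tr (\<lambda>v. (t ^^ k) (R w v)) = 0"
      by (rule tr_centralizer_derived[OF tk funpow_commute_R[OF t_comm] w(1)])
    finally show "tr (t ^^ Suc k) = 0" by (simp only: diff_zero)
  qed
  have t_A: "A \<subseteq> {v. t v = 0}" if A: "A \<in> \<A>" for A
  proof -
    have sub: "subspace A" by (rule component_subspace[OF A])
    have RA: "R c ` A \<subseteq> A" if "c \<in> S" for c
      using component_right[OF A _ that] by (auto simp: R_def)
    have tA: "t ` A \<subseteq> A"
    proof safe
      fix a assume a: "a \<in> A"
      have "?f a \<in> A" "R w a \<in> A" using RA[OF \<sigma>] RA[OF wS] a by blast+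
      moreover have "s a \<in> A"
        unfolding s_def by (rule poly_op_invariant[OF sub RA[OF \<sigma>] a])
      ultimately show "t a \<in> A"
        unfolding t_def n_def by (intro subspace_diff[OF sub])
    qed
    let ?B = "{a \<in> A. t a = 0}"
    obtain a where a: "a \<in> A" "a \<noteq> 0"
      using component_nonzero[OF A] subspace_0[OF sub] by blast
    obtain k where k: "(t ^^ k) a = 0" using t_nil by blast
    define l where "l = (LEAST k. (t ^^ k) a = 0)"
    have l: "(t ^^ l) a = 0"
      unfolding l_def using k by (rule LeastI)
    then obtain j where j: "l = Suc j"
      using a(2) by (cases l) auto
    have "(t ^^ j) a \<noteq> 0"
      using not_less_Least[of j "\<lambda>k. (t ^^ k) a = 0"] j by (simp add: l_def)
    moreover have "(t ^^ j) a \<in> ?B"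
      using funpow_invariant[OF tA a(1)] l j by simp
    ultimately have "?B \<noteq> {0}" by blast
    moreover have "?B = {0} \<or> ?B = A"
    proof (rule component_right_irreducible[OF A])
      show "subspace ?B"
        using sub by (auto simp: subspace_def endo_0[OF t] endo_add[OF t] endo_scale[OF t])
      fix b c assume "b \<in> ?B" "c \<in> S"
      then show "bracket b c \<in> ?B"
        using component_right[OF A] t_comm[of c b] endo_0[OF endo_R[of c]] by (simp add: R_def)
    qed blast
    ultimately show ?thesis by blast
  qed
  have t_N: "N \<subseteq> {v. t v = 0}"
    by (rule N_induct[OF endo_kernel_subspace[OF t] t_A])
  have t0: "t v = 0" for v
  proof -
    obtain a c where v: "v = a + c" "a \<in> N" "c \<in> S"
      by (rule decompose)
    show ?thesis
      using t_N v(2) t_S[OF v(3)] by (auto simp: v(1) endo_add[OF t])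
  qed
  then have n_eq: "n = R w"
    by (intro ext) (simp add: t_def)
  have s_eq: "R (\<sigma> - w) = s"
  proof
    fix v
    have "n v = R w v" by (simp only: n_eq)
    then show "R (\<sigma> - w) v = s v"
      by (auto simp: n_def R_def bracket_diff algebra_simps)
  qed
  have fs: "?f (s v) = s (?f v)" for v
    unfolding s_def by (rule poly_op_commute[OF f]) simp
  have "s (n v) = n (s v)" for v
    by (simp add: n_def endo_diff[OF s] fs)
  then show ?thesis
    using M wS n_nil unfolding s_def[symmetric]
    by (intro exI[of _ w] exI[of _ M]) (simp add: s_eq n_eq)
qed

section \<open>Conjugation into the centralizer of the semisimple part\<close>

abbreviation lcs :: "nat \<Rightarrow> 'b set" where
  "lcs \<equiv> lower_central N"

lemma subspace_lcs: "subspace (lcs k)"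
  by (cases k) (simp_all add: subspace_N)

lemma lcs_bracket_N: "a \<in> lcs k \<Longrightarrow> n \<in> N \<Longrightarrow> bracket a n \<in> lcs (Suc k)"
  unfolding lower_central.simps by (rule span_base) blast

lemma lcs_right: "a \<in> lcs k \<Longrightarrow> bracket a x \<in> lcs k"
proof (induction k arbitrary: a x)
  case 0
  then show ?case by (simp add: N_left)
next
  case (Suc k)
  have "lcs (Suc k) \<subseteq> {a. bracket a x \<in> lcs (Suc k)}"
    unfolding lower_central.simps(2)[of N k]
  proof (rule span_minimal)
    have "subspace (lcs (Suc k))" by (rule subspace_lcs)
    then show "subspace {a. bracket a x \<in> span {bracket x y |x y. x \<in> lcs k \<and> y \<in> N}}"
      unfolding lower_central.simps by (simp add: subspace_def bracket_add_left bracket_scale_left)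
    have "bracket (bracket b n) x \<in> lcs (Suc k)" if "b \<in> lcs k" "n \<in> N" for b n
      unfolding derivation[of b n x]
      by (intro subspace_add[OF subspace_lcs] lcs_bracket_N that Suc.IH N_left)
    then show "{bracket x y |x y. x \<in> lcs k \<and> y \<in> N} \<subseteq> {a. bracket a x \<in> span {bracket x y |x y. x \<in> lcs k \<and> y \<in> N}}"
      unfolding lower_central.simps by blast
  qed
  then show ?case using Suc.prems by blast
qed

lemma lcs_Suc: "lcs (Suc k) \<subseteq> lcs k"
  unfolding lower_central.simps by (rule span_minimal) (use lcs_right subspace_lcs in auto)

lemma lcs_N: "lcs k \<subseteq> N"
proof (induction k)
  case (Suc k)
  then show ?case using lcs_Suc[of k] by blast
qed simp

text \<open>The whole algebra is put before the lower central series of \<open>N\<close>: every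
  \<open>R x\<close> preserves this chain, and \<open>R n\<close> with \<open>n\<close> in
  \<open>N\<close> moves one step down it.\<close>

definition filtration :: "nat \<Rightarrow> 'b set" where
  "filtration k = (case k of 0 \<Rightarrow> UNIV | Suc j \<Rightarrow> lcs j)"

lemma subspace_filtration: "subspace (filtration k)"
  by (cases k) (simp_all add: filtration_def subspace_lcs)

lemma filtration_right: "a \<in> filtration k \<Longrightarrow> bracket a x \<in> filtration k"
  by (cases k) (simp_all add: filtration_def lcs_right)

lemma filtration_bracket_N: "a \<in> filtration k \<Longrightarrow> n \<in> N \<Longrightarrow> bracket a n \<in> filtration (Suc k)"
  using lcs_bracket_N N_right by (cases k) (auto simp: filtration_def)

lemma filtration_R: "a \<in> filtration k \<Longrightarrow> R x a \<in> filtration k"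
  and filtration_R_N: "a \<in> filtration k \<Longrightarrow> n \<in> N \<Longrightarrow> R n a \<in> filtration (Suc k)"
  by (simp_all add: R_def filtration_right filtration_bracket_N)

lemma filtration_zero: "\<exists>K. filtration (Suc K) = {0}"
  using nilpotent_N by (simp add: nilpotent_def filtration_def)

text \<open>\<open>w\<close> and \<open>w + m\<close> act in the same way on the associated graded space.\<close>

lemma nilpotent_R_add:
  assumes w: "nilpotent_op (R w)" and m: "m \<in> N"
  shows "nilpotent_op (R (w + m))"
proof -
  obtain j where j: "\<And>v. (R w ^^ j) v = 0" using w by blast
  have diff: "(R (w + m) ^^ i) u \<in> filtration k \<and> (R (w + m) ^^ i) u - (R w ^^ i) u \<in> filtration (Suc k)"
    if u: "u \<in> filtration k" for u k i
  proof (induction i)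
    case 0
    then show ?case using u subspace_0[OF subspace_filtration] by simp
  next
    case (Suc i)
    let ?a = "(R (w + m) ^^ i) u" and ?b = "(R w ^^ i) u"
    have "R (w + m) ?a - R w ?b = R w (?a - ?b) + R m ?a"
      by (simp add: R_add endo_diff[OF endo_R])
    also have "\<dots> \<in> filtration (Suc k)"
      using Suc by (intro subspace_add[OF subspace_filtration] filtration_R filtration_R_N m) simp_all
    finally show ?case
      using Suc filtration_R by simp
  qed
  have "\<exists>i. \<forall>v. (R (w + m) ^^ i) v \<in> filtration k" for k
  proof (induction k)
    case 0
    then show ?case by (simp add: filtration_def)
  next
    case (Suc k)
    then obtain i where i: "\<And>v. (R (w + m) ^^ i) v \<in> filtration k" by blast
    \<comment> \<open>\<open>R w\<close> vanishes after \<open>j\<close> iterations, so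
      \<open>j\<close> iterations of \<open>R (w + m)\<close> descend one step.\<close>
    have "(R (w + m) ^^ (j + i)) v \<in> filtration (Suc k)" for v
      using diff[OF i, of j v] j by (simp add: funpow_add)
    then show ?case by blast
  qed
  moreover obtain K where K: "filtration (Suc K) = {0}"
    using filtration_zero by blast
  ultimately obtain i where "\<forall>v. (R (w + m) ^^ i) v \<in> {0}"
    by metis
  then show ?thesis by blast
qed

lemma nilpotent_R_N: "m \<in> N \<Longrightarrow> nilpotent_op (R m)"
proof -
  assume "m \<in> N"
  moreover have "nilpotent_op (R 0)"
    by (rule exI[of _ 1]) (simp add: R_def)
  ultimately show ?thesis
    using nilpotent_R_add[of 0 m] by simp
qed

text \<open>The kernel has an invariant complement, on which \<open>s\<close> is injective; so
  powers of \<open>s\<close> have no larger kernel.\<close>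

lemma separable_kernel_funpow:
  assumes s: "endo s" and M: "separable M" "\<And>v. poly_op M s v = 0" and "(s ^^ k) a = 0"
  shows "s a = 0"
proof -
  let ?W = "{v. s v = 0}"
  have W: "subspace ?W" "s ` ?W \<subseteq> ?W"
    using endo_kernel_subspace[OF s] endo_0[OF s] by auto
  obtain W' where W': "subspace W'" "s ` W' \<subseteq> W'" "?W \<inter> W' = {0}" "\<And>x. \<exists>w\<in>?W. \<exists>w'\<in>W'. x = w + w'"
    using separable_invariant_complement[OF s M W] by metis
  obtain b c where bc: "a = b + c" "b \<in> ?W" "c \<in> W'"
    using W'(4)[of a] by blast
  have inj: "u = 0" if "u \<in> W'" "(s ^^ i) u = 0" for u i
    using that
  proof (induction i arbitrary: u)
    case (Suc i)
    then have "s u = 0"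
      using Suc.IH[of "s u"] W'(2) by (auto simp: funpow_Suc_right simp del: funpow.simps)
    then show ?case using Suc.prems(1) W'(3) by blast
  qed simp
  have "(s ^^ i) b = 0 \<or> i = 0" for i
    using bc(2) by (cases i) (simp_all add: funpow_Suc_right endo_0[OF endo_funpow[OF s]] del: funpow.simps)
  then have "(s ^^ Suc k) b = 0" by blast
  moreover have "(s ^^ Suc k) a = 0"
    using assms(4) by (simp add: endo_0[OF s])
  ultimately have "(s ^^ Suc k) c = 0"
    using endo_add[OF endo_funpow[OF s], of "Suc k" b c] bc(1) by simp
  then have "c = 0" by (rule inj[OF bc(3)])
  then show ?thesis using bc(1,2) by simp
qed

text \<open>Exchanging the factors of a bracket costs an element of the Leibniz kernel, so errors
  are measured modulo it; \<open>jordan_split_kernel\<close> discards this part in the end.\<close>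

definition lcs_kernel :: "nat \<Rightarrow> 'b set" where
  "lcs_kernel k = {l + i |l i. l \<in> lcs k \<and> i \<in> leibniz_kernel}"

lemma lcs_kernelI: "l \<in> lcs k \<Longrightarrow> i \<in> leibniz_kernel \<Longrightarrow> l + i \<in> lcs_kernel k"
  unfolding lcs_kernel_def by blast

lemma subspace_lcs_kernel: "subspace (lcs_kernel k)"
  unfolding lcs_kernel_def by (rule subspace_sums[OF subspace_lcs subspace_kernel])

lemma lcs_subset_lcs_kernel: "lcs k \<subseteq> lcs_kernel k" and kernel_subset_lcs_kernel: "leibniz_kernel \<subseteq> lcs_kernel k"
  using lcs_kernelI[of _ k 0] lcs_kernelI[of 0 k] subspace_0[OF subspace_lcs] subspace_0[OF subspace_kernel] by auto

lemma lcs_kernel_right: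
  assumes "a \<in> lcs_kernel k"
  shows "bracket a x \<in> lcs_kernel k"
proof -
  obtain l i where "a = l + i" "l \<in> lcs k" "i \<in> leibniz_kernel"
    using assms lcs_kernel_def by blast
  then show ?thesis
    using lcs_kernelI[OF lcs_right[of l k x] kernel_left[of i x]] by (simp add: bracket_add_left)
qed

text \<open>Fitting's decomposition for \<open>R \<sigma>\<close> writes
  \<open>m1 = a + R \<sigma> c\<close> with \<open>a\<close> in the generalized kernel. The
  automorphism \<open>exp (R c)\<close> removes \<open>R \<sigma> c\<close> up to the next term of
  the series, and \<open>a\<close> joins \<open>m0\<close> in the centralizer.\<close>

lemma jordan_split_step:
  assumes \<sigma>: "\<sigma> \<in> S" and w: "separable M" "\<And>v. poly_op M (R (\<sigma> - w)) v = 0" "nilpotent_op (R w)"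
      "\<And>v. R (\<sigma> - w) (R w v) = R w (R (\<sigma> - w) v)"
    and m0: "m0 \<in> N" "bracket m0 (\<sigma> - w) = 0" and m1: "m1 \<in> lcs k"
    and IH: "\<And>m m'. m \<in> N \<Longrightarrow> bracket m (\<sigma> - w) = 0 \<Longrightarrow> m' \<in> lcs (Suc k) \<Longrightarrow> jordan_split (\<sigma> + m + m')"
  shows "jordan_split (\<sigma> + m0 + m1)"
proof -
  let ?f = "R \<sigma>" and ?s = "R (\<sigma> - w)"
  obtain E j where E: "poly.coeff E 0 = 0" "\<And>v. (?f ^^ j) (v - poly_op E ?f v) = 0"
    using fitting_polynomial[OF endo_R[of \<sigma>]] by metis
  then obtain q where q: "E = pCons 0 q"
    by (cases E) auto
  define c where "c = poly_op q ?f m1"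
  define a where "a = m1 - ?f c"
  have f_lcs: "?f ` lcs k \<subseteq> lcs k"
    using lcs_right by (auto simp: R_def)
  have c: "c \<in> lcs k"
    unfolding c_def by (rule poly_op_invariant[OF subspace_lcs f_lcs m1])
  have fc: "?f c \<in> lcs k"
    using f_lcs c by blast
  have a_lcs: "a \<in> lcs k"
    unfolding a_def by (rule subspace_diff[OF subspace_lcs m1 fc])
  have "poly_op E ?f m1 = ?f c"
    unfolding c_def q by (simp add: poly_op_commute[OF endo_R[of \<sigma>]])
  then have fa: "(?f ^^ j) a = 0"
    using E(2)[of m1] by (simp add: a_def)
  have cN: "c \<in> N" and aN: "a \<in> N" and m1N: "m1 \<in> N"
    using c a_lcs m1 lcs_N by blast+
  obtain l where l: "\<And>v. (R w ^^ l) v = 0" using w(3) by blast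
  have s_eq: "?s = (\<lambda>v. ?f v - R w v)"
    by (rule ext) (simp add: R_def bracket_diff)
  have fw: "?f (R w v) = R w (?f v)" for v
    using w(4)[of v] unfolding s_eq by (simp add: endo_diff[OF endo_R])
  \<comment> \<open>\<open>?s\<close> differs from \<open>?f\<close> by the commuting nilpotent
    \<open>R w\<close>, so \<open>a\<close> lies in its generalized kernel, which by semisimplicity
    is its kernel.\<close>
  have "(?s ^^ (j + l)) a = 0"
    unfolding s_eq by (rule funpow_diff_commuting[OF endo_R endo_R fw fa l])
  then have sa: "?s a = 0"
    by (rule separable_kernel_funpow[OF endo_R w(1,2)])
  let ?T = "lcs_kernel (Suc k)"
  note T = subspace_lcs_kernel[of "Suc k"]
  let ?x = "\<sigma> + m0 + m1"
  have comm_T: "bracket u c \<in> ?T" if u: "u \<in> N" for u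
  proof -
    have "bracket c u \<in> ?T"
      using lcs_bracket_N[OF c u] lcs_subset_lcs_kernel by blast
    moreover have "bracket u c + bracket c u \<in> ?T"
      using bracket_symmetric_part kernel_subset_lcs_kernel by blast
    ultimately have "(bracket u c + bracket c u) - bracket c u \<in> ?T"
      by (intro subspace_diff[OF T])
    then show ?thesis by simp
  qed
  have xc: "bracket ?x c + ?f c \<in> ?T"
  proof -
    have "bracket \<sigma> c + bracket c \<sigma> \<in> ?T"
      using bracket_symmetric_part kernel_subset_lcs_kernel by blast
    then have "(bracket \<sigma> c + bracket c \<sigma>) + bracket m0 c + bracket m1 c \<in> ?T"
      using comm_T[OF m0(1)] comm_T[OF m1N] by (rule subspace_add[OF T subspace_add[OF T]])
    then show ?thesis
      by (simp add: R_def bracket_add_left algebra_simps)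
  qed
  let ?D = "R c"
  have D: "endo ?D" by (rule endo_R)
  have der: "?D (bracket u v) = bracket (?D u) v + bracket u (?D v)" for u v
    using derivation[of u v c] by (simp add: R_def add.commute)
  obtain r where r: "\<And>v. (?D ^^ r) v = 0"
    using nilpotent_R_N[OF cN] by blast
  \<comment> \<open>The surplus of two allows the constant and the linear term to be split off the
    truncated exponential.\<close>
  have r': "(?D ^^ Suc (Suc r)) v = 0" for v
    by (simp add: r endo_0[OF D])
  let ?n = "Suc (Suc r)"
  let ?\<theta> = "exp_op ?D (?n + ?n)"
  note \<theta> = exp_op_automorphism[OF D der r']
  have DT: "?D ` ?T \<subseteq> ?T"
    using lcs_kernel_right by (auto simp: R_def)
  \<comment> \<open>Modulo \<open>?T\<close>, \<open>[?x, c]\<close> is \<open>- ?f c\<close>, and a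
    further bracket with \<open>c\<close> from \<open>N\<close> carries \<open>?f c\<close> into the
    next term.\<close>
  have D2: "(?D ^^ Suc (Suc i)) ?x \<in> ?T" for i
  proof -
    have "bracket (?f c) c \<in> ?T"
      using lcs_bracket_N[OF fc cN] lcs_subset_lcs_kernel by blast
    moreover have "bracket (bracket ?x c + ?f c) c \<in> ?T"
      by (rule lcs_kernel_right[OF xc])
    ultimately have "bracket (bracket ?x c + ?f c) c - bracket (?f c) c \<in> ?T"
      by (intro subspace_diff[OF T])
    then have "?D (?D ?x) \<in> ?T"
      by (simp add: R_def bracket_add_left)
    then have "(?D ^^ i) (?D (?D ?x)) \<in> ?T"
      by (rule funpow_invariant[OF DT])
    then show ?thesis
      by (simp add: funpow_Suc_right del: funpow.simps)
  qed
  have "?\<theta> ?x = ?x + bracket ?x c + (\<Sum>i<r + ?n. divided_power ?D (Suc (Suc i)) ?x)"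
  proof -
    have "?n + ?n = Suc (Suc (r + ?n))" by simp
    then have "?\<theta> ?x = (\<Sum>i<Suc (Suc (r + ?n)). divided_power ?D i ?x)"
      by (simp only: exp_op_def)
    also have "\<dots> = divided_power ?D 0 ?x + (divided_power ?D (Suc 0) ?x + (\<Sum>i<r + ?n. divided_power ?D (Suc (Suc i)) ?x))"
      by (simp only: sum.lessThan_Suc_shift)
    also have "divided_power ?D 0 ?x = ?x"
      by (simp add: divided_power_def)
    also have "divided_power ?D (Suc 0) ?x = bracket ?x c"
      by (simp add: divided_power_def R_def)
    finally show ?thesis by (simp only: add.assoc)
  qed
  moreover have "(\<Sum>i<r + ?n. divided_power ?D (Suc (Suc i)) ?x) \<in> ?T"
    unfolding divided_power_def by (intro subspace_sum[OF T] subspace_scale[OF T] D2)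
  ultimately obtain u where u: "u \<in> ?T" "?\<theta> ?x = ?x + bracket ?x c + u"
    by blast
  have "(bracket ?x c + ?f c) + u \<in> ?T"
    by (rule subspace_add[OF T xc u(1)])
  then obtain l' i where li: "(bracket ?x c + ?f c) + u = l' + i" "l' \<in> lcs (Suc k)" "i \<in> leibniz_kernel"
    unfolding lcs_kernel_def by blast
  have "?\<theta> ?x = (?x - ?f c) + ((bracket ?x c + ?f c) + u)"
    unfolding u(2) by (simp add: algebra_simps)
  also have "\<dots> = \<sigma> + (m0 + a) + l' + i"
    unfolding li(1) by (simp add: a_def algebra_simps)
  finally have \<theta>x: "?\<theta> ?x = \<sigma> + (m0 + a) + l' + i" .
  have "jordan_split (\<sigma> + (m0 + a) + l')"
  proof (rule IH[OF _ _ li(2)])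
    show "m0 + a \<in> N" by (rule subspace_add[OF subspace_N m0(1) aN])
    show "bracket (m0 + a) (\<sigma> - w) = 0"
      using m0(2) sa by (simp add: bracket_add_left R_def)
  qed
  then have "jordan_split (?\<theta> ?x)"
    unfolding \<theta>x by (rule jordan_split_kernel[OF _ li(3)])
  then show ?thesis
    by (rule jordan_split_automorphism[OF \<theta>(1,2,3)])
qed

theorem jordan_split_all: "jordan_split x"
proof -
  obtain n \<sigma> where x: "x = n + \<sigma>" "n \<in> N" "\<sigma> \<in> S"
    by (rule decompose)
  obtain w M where w: "separable M" "\<And>v. poly_op M (R (\<sigma> - w)) v = 0" "nilpotent_op (R w)"
      "\<And>v. R (\<sigma> - w) (R w v) = R w (R (\<sigma> - w) v)"
    using jordan_in_S[OF x(3)] by blast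
  obtain K where K: "lcs K = {0}"
    using nilpotent_N nilpotent_def by blast
  \<comment> \<open>\<open>k\<close> counts the remaining steps: at \<open>k = 0\<close> the part
    \<open>m'\<close> lies in \<open>lcs K\<close> and is zero, at \<open>k = K\<close> it is an
    arbitrary element of \<open>N\<close>.\<close>
  have "k \<le> K \<Longrightarrow> m \<in> N \<Longrightarrow> bracket m (\<sigma> - w) = 0 \<Longrightarrow> m' \<in> lcs (K - k) \<Longrightarrow> jordan_split (\<sigma> + m + m')" for k m m'
  proof (induction k arbitrary: m m')
    case 0
    then have m': "m' = 0" using K by simp
    \<comment> \<open>As \<open>m\<close> is centralized by \<open>\<sigma> - w\<close>, the latter
      stays the semisimple part and \<open>w + m\<close> becomes the nilpotent part.\<close>
    have "R (\<sigma> - w) (R m v) = R m (R (\<sigma> - w) v)" for v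
      using R_bracket[of m "\<sigma> - w" v] 0(3) by (simp add: R_def)
    then have "R (\<sigma> - w) (R (w + m) v) = R (w + m) (R (\<sigma> - w) v)" for v
      by (simp add: R_add endo_add[OF endo_R] w(4))
    moreover have "bracket v (\<sigma> + m + m') = bracket v (\<sigma> - w) + bracket v (w + m)" for v
      by (simp add: m' bracket_add_right bracket_diff)
    ultimately show ?case
      unfolding jordan_split_def using w(1,2) nilpotent_R_add[OF w(3) 0(2)]
      by (intro exI[of _ "\<sigma> - w"] exI[of _ "w + m"] exI[of _ M]) simp
  next
    case (Suc k)
    show ?case
    proof (rule jordan_split_step[OF x(3) w Suc.prems(2-4)])
      fix u u' assume "u \<in> N" "bracket u (\<sigma> - w) = 0" "u' \<in> lcs (Suc (K - Suc k))"
      moreover have "Suc (K - Suc k) = K - k"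
        using Suc.prems(1) by simp
      ultimately show "jordan_split (\<sigma> + u + u')"
        using Suc.IH Suc.prems(1) by simp
    qed
  qed
  from this[of K 0 n] have "jordan_split (\<sigma> + 0 + n)"
    using x(2) subspace_0[OF subspace_N] by simp
  then show ?thesis
    by (simp add: x(1) add.commute)
qed

end

section \<open>The quotient by the Leibniz kernel\<close>

context fd_leibniz
begin

abbreviation quot :: "('f, 'v set) lie_structure" where
  "quot \<equiv> quotient_algebra leibniz_kernel"

abbreviation coset :: "'v \<Rightarrow> 'v set" where
  "coset v \<equiv> v +o leibniz_kernel"

lemma carrier_quot: "lie_structure.carrier quot = range coset"
  by (simp add: quotient_algebra_def)

lemma coset_eq: "coset u = coset v \<longleftrightarrow> u - v \<in> leibniz_kernel"
  by (rule coset_eq_iff[OF subspace_kernel])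

lemma vzero_quot: "vzero quot = coset 0"
  by (simp add: quotient_algebra_def elt_set_plus_def)

lemmas quot_simps = quotient_add[OF subspace_kernel] quotient_scale[OF subspace_kernel]
  quotient_bracket[OF ideal_leibniz_kernel]

text \<open>\<open>ad\<close> acts from the left, hence the sign.\<close>

lemma ad_coset: "ad quot (coset (- y)) (coset v) = coset (R y v)"
proof -
  have "bracket (- y) v - R y v = - (bracket y v + bracket v y)"
    by (simp add: bracket_neg R_def)
  then have "bracket (- y) v - R y v \<in> leibniz_kernel"
    using subspace_neg[OF subspace_kernel bracket_symmetric_part] by simp
  moreover have "coset v \<in> lie_structure.carrier quot"
    by (auto simp: carrier_quot)
  ultimately show ?thesis
    by (simp add: ad_def quot_simps coset_eq)
qed

lemma ad_in_gl: "ad quot (coset (- y)) \<in> gl quot"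
proof -
  have "ad quot (coset (- y)) \<in> extensional (lie_structure.carrier quot)"
    by (simp add: ad_def)
  then show ?thesis
    by (auto simp: gl_def carrier_quot PiE_def ad_coset quot_simps endo_add[OF endo_R] endo_scale[OF endo_R])
qed

text \<open>The complement is found before passing to the quotient: the preimage \<open>U\<close> of
  \<open>W\<close> has an \<open>R y\<close>-stable complement, and its cosets meet \<open>W\<close>
  trivially because membership in \<open>U\<close> depends on the coset alone.\<close>

lemma ad_semisimple:
  assumes M: "separable M" "\<And>v. poly_op M (R y) v = 0"
  shows "semisimple_endo quot (ad quot (coset (- y)))"
  unfolding semisimple_endo_def
proof (intro allI impI, elim conjE)
  fix W assume W: "is_subspace quot W" and inv: "ad quot (coset (- y)) ` W \<subseteq> W"
  define U where "U = {v. coset v \<in> W}"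
  have "subspace U"
  proof (rule subspaceI)
    show "0 \<in> U" using W by (simp add: U_def is_subspace_def vzero_quot)
    show "u + v \<in> U" if "u \<in> U" "v \<in> U" for u v
      using W that unfolding is_subspace_def U_def by (metis mem_Collect_eq quot_simps(1))
    show "scale c u \<in> U" if "u \<in> U" for c u
      using W that unfolding is_subspace_def U_def by (metis mem_Collect_eq quot_simps(2))
  qed
  moreover have "R y ` U \<subseteq> U"
    using inv by (auto simp: U_def ad_coset[symmetric])
  ultimately obtain U' where U': "subspace U'" "R y ` U' \<subseteq> U'" "U \<inter> U' = {0}"
      "\<And>x. \<exists>u\<in>U. \<exists>u'\<in>U'. x = u + u'"
    using separable_invariant_complement[OF endo_R M] by metis
  let ?W' = "coset ` U'"
  have "is_subspace quot ?W'"
    unfolding is_subspace_def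
  proof (intro conjI ballI allI)
    show "?W' \<subseteq> lie_structure.carrier quot" by (auto simp: carrier_quot)
    show "vzero quot \<in> ?W'" unfolding vzero_quot by (rule imageI[OF subspace_0[OF U'(1)]])
    show "vadd quot a b \<in> ?W'" if "a \<in> ?W'" "b \<in> ?W'" for a b
      using that subspace_add[OF U'(1)] by (auto simp: quot_simps)
    show "vscale quot c a \<in> ?W'" if "a \<in> ?W'" for c a
      using that subspace_scale[OF U'(1)] by (auto simp: quot_simps)
  qed
  note sub = this
  have "ad quot (coset (- y)) ` ?W' \<subseteq> ?W'"
    using U'(2) by (auto simp: ad_coset)
  moreover have "W \<inter> ?W' = {vzero quot}"
  proof
    show "W \<inter> ?W' \<subseteq> {vzero quot}"
    proof
      fix a assume "a \<in> W \<inter> ?W'"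
      then obtain u where "a = coset u" "u \<in> U'" "u \<in> U" by (auto simp: U_def)
      then have "u \<in> U \<inter> U'" by blast
      then have "u = 0" using U'(3) by blast
      then show "a \<in> {vzero quot}" using \<open>a = coset u\<close> by (simp only: vzero_quot singleton_iff)
    qed
    show "{vzero quot} \<subseteq> W \<inter> ?W'"
      using W sub by (simp add: is_subspace_def)
  qed
  moreover have "\<forall>a\<in>lie_structure.carrier quot. \<exists>w\<in>W. \<exists>w'\<in>?W'. a = vadd quot w w'"
  proof
    fix a assume "a \<in> lie_structure.carrier quot"
    then obtain x where x: "a = coset x" by (auto simp: carrier_quot)
    obtain u u' where u: "u \<in> U" "u' \<in> U'" "x = u + u'" using U'(4)[of x] by blast
    then have "a = vadd quot (coset u) (coset u')"
      by (simp add: x quot_simps)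
    then show "\<exists>w\<in>W. \<exists>w'\<in>?W'. a = vadd quot w w'"
      using u by (auto simp: U_def)
  qed
  moreover note sub
  ultimately show "\<exists>W'. is_subspace quot W' \<and> ad quot (coset (- y)) ` W' \<subseteq> W' \<and> W \<inter> W' = {vzero quot} \<and>
      (\<forall>x\<in>lie_structure.carrier quot. \<exists>w\<in>W. \<exists>w'\<in>W'. x = vadd quot w w')"
    by blast
qed

lemma ad_nilpotent:
  assumes "nilpotent_op (R z)"
  shows "nilpotent_endo quot (ad quot (coset (- z)))"
proof -
  obtain k where k: "\<And>v. (R z ^^ k) v = 0" using assms by blast
  have "(ad quot (coset (- z)) ^^ j) (coset v) = coset ((R z ^^ j) v)" for j v
    by (induction j) (simp_all add: ad_coset)
  then show ?thesis
    unfolding nilpotent_endo_def by (intro exI[of _ k]) (auto simp: carrier_quot k vzero_quot)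
qed

lemma almost_algebraic_if_jordan_split:
  assumes "\<And>x. jordan_split x"
  shows almost_algebraic
  unfolding almost_algebraic_def almost_algebraic_lie_def almost_algebraic_linear_def
proof
  fix f assume "f \<in> ad quot ` lie_structure.carrier quot"
  then obtain x' where "f = ad quot (coset x')"
    by (auto simp: carrier_quot)
  then obtain x where f: "f = ad quot (coset (- x))"
    by (metis minus_minus)
  obtain y z M where yz: "\<And>v. bracket v x = bracket v y + bracket v z" "separable M"
      "\<And>v. poly_op M (R y) v = 0" "nilpotent_op (R z)" "\<And>v. R y (R z v) = R z (R y v)"
    using assms[of x] unfolding jordan_split_def by blast
  have "jordan_decomposition quot f (ad quot (coset (- y))) (ad quot (coset (- z)))"
    unfolding jordan_decomposition_def
  proof (intro conjI ad_in_gl ad_semisimple[OF yz(2,3)] ad_nilpotent[OF yz(4)])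
    have "R x v = R y v + R z v" for v
      using yz(1) by (simp add: R_def)
    then show "\<forall>a\<in>lie_structure.carrier quot. f a = vadd quot (ad quot (coset (- y)) a) (ad quot (coset (- z)) a)"
      by (auto simp: carrier_quot f ad_coset quot_simps)
    show "\<forall>a\<in>lie_structure.carrier quot.
        ad quot (coset (- y)) (ad quot (coset (- z)) a) = ad quot (coset (- z)) (ad quot (coset (- y)) a)"
      by (auto simp: carrier_quot ad_coset yz(5))
  qed
  moreover have "ad quot (coset u) \<in> ad quot ` lie_structure.carrier quot" for u
    by (intro imageI) (auto simp: carrier_quot)
  ultimately show "\<exists>s n. jordan_decomposition quot f s n \<and> s \<in> ad quot ` lie_structure.carrier quot \<and>
      n \<in> ad quot ` lie_structure.carrier quot"
    by blast
qed

end

theorem theorem2p2: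
  fixes scale :: "'f::field_char_0 \<Rightarrow> 'v::ab_group_add \<Rightarrow> 'v"
    and bracket :: "'v \<Rightarrow> 'v \<Rightarrow> 'v"
    and Basis :: "'v set"
  assumes "leibniz_algebra scale bracket"
    and "finite_dimensional_vector_space scale Basis"
    and "leibniz_algebra.almost_reductive scale bracket"
  shows "leibniz_algebra.almost_algebraic scale bracket"
proof -
  interpret leibniz_algebra scale bracket by fact
  interpret finite_dimensional_vector_space scale Basis by fact
  interpret fd_leibniz scale bracket Basis ..
  obtain N S \<A> where "is_nilradical N" "lie_subalgebra S" "N + S = UNIV" "N \<inter> S = {0}"
      "direct_sum_of N \<A>" "\<And>A. A \<in> \<A> \<Longrightarrow> irreducible_bimodule S A"
    using assms(3) unfolding almost_reductive_def completely_reducible_bimodule_def by blast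
  then interpret almost_reductive_split scale bracket Basis N S \<A>
    by unfold_locales
  show ?thesis
    by (rule almost_algebraic_if_jordan_split[OF jordan_split_all])
qed

end
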